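(* Consider the Sinkhorn bridges associated with $(\mu,\eta,\mathcal{K}_0)=(\lambda_U,\lambda_V,K_W)$. (1) Assume that for every $n\ge1$ condition $A_0(\mathcal{K}_{2n-1})$ holds for some parameters $(\kappa_{2n-1},\rho_{2n-1})$, and that $\eta=\lambda_V$ satisfies the $\mathbb{T}_2(\|v_+\|_2)$ inequality for some positive definite matrix $v_+$. Set $\epsilon_{2n+1}:=\kappa_{2n+1}^2\,\rho_{2n+1}\,\|v_+\|_2$. Then for every $n\ge1$ $$\mathcal{H}(P_{\mu,\eta}|\mathcal{P}_{2n+1})\le\left(1+\epsilon_{2n+1}^{-1}\right)^{-1}\mathcal{H}(P_{\mu,\eta}|\mathcal{P}_{2n-1}).$$ (2) Assume condition $(\mathcal{W})$ holds with parameters $(\kappa,\widehat u,\widehat v)$ and condition $C_V^-(U)$ holds with positive definite $u_+$ and $v_+$, $0<u_+<\widehat u$, positive semi-definite $\overline u_+$ and $\delta\ge0$. Then there is a constant $\widetilde\rho_u>0$ depending only on $(u_+,\widehat u,\overline u_+,\delta)$ such that the estimate in (1) holds for every $n\ge1$ with $\epsilon_{2n+1}=\kappa^2\,\widetilde\rho_u\,\|v_+\|_2$.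
   Context: $\lambda$ is Lebesgue measure on $\mathbb{R}^d$. $\lambda_U(dx)=e^{-U(x)}\lambda(dx)$ and $K_W(x,dy)=e^{-W(x,y)}\lambda(dy)$ for smooth $U,V,W$; $\mu=\lambda_U$, $\eta=\lambda_V$ are probability measures and $K_W$ is a Markov transition. $W^\flat(y,x):=W(x,y)$. $(\mu\times\mathcal{K})(d(x,y))=\mu(dx)\mathcal{K}(x,dy)$; $\mathcal{H}$ is relative entropy; $\Pi(\mu,\eta)$ is the set of couplings. The reference is $P=\mu\times K_W$; it is assumed that some $Q\in\Pi(\mu,\eta)$ has $\mathcal{H}(Q|P)<\infty$, and $P_{\mu,\eta}=\arg\min_{Q\in\Pi(\mu,\eta)}\mathcal{H}(Q|P)$. Sinkhorn: $\mathcal{K}_0=K_W$. Given $\mathcal{K}_{2n}$, put $\pi_{2n}=\mu\mathcal{K}_{2n}$, $\mathcal{P}_{2n}=\mu\times\mathcal{K}_{2n}$, and let $\mathcal{K}_{2n+1}$ be defined by $\mu(dx)\mathcal{K}_{2n}(x,dy)=\pi_{2n}(dy)\mathcal{K}_{2n+1}(y,dx)$. Then $\pi_{2n+1}=\eta\mathcal{K}_{2n+1}$, $\mathcal{P}_{2n+1}(d(x,y))=\eta(dy)\mathcal{K}_{2n+1}(y,dx)$, and $\mathcal{K}_{2(n+1)}$ is defined by $\eta(dy)\mathcal{K}_{2n+1}(y,dx)=\pi_{2n+1}(dx)\mathcal{K}_{2(n+1)}(x,dy)$. The log-densities of the Sinkhorn transitions are assumed smooth, with differentiation under the integral sign allowed.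 $\mathcal{D}_2$ is the $2$-Wasserstein distance (Euclidean norm), $\|\cdot\|_2$ the Euclidean/spectral norm. A probability measure $\mu$ satisfies $\mathbb{T}_2(\rho)$ if $\frac12\mathcal{D}_2(\nu,\mu)^2\le\rho\,\mathcal{H}(\nu|\mu)$ for all probability measures $\nu$. $\mathcal{J}(\nu|\mu)=\nu(\|\nabla\log(d\nu/d\mu)\|_2^2)$ (and $+\infty$ if $\nu\not\ll\mu$). $A_0(\mathcal{K})$ with parameters $(\kappa,\rho)$, $\kappa,\rho>0$: for all $x_1,x_2$, $\mathcal{H}(\delta_{x_1}\mathcal{K}|\delta_{x_2}\mathcal{K})\le\frac\rho2\mathcal{J}(\delta_{x_1}\mathcal{K}|\delta_{x_2}\mathcal{K})$ and $\mathcal{J}(\delta_{x_1}\mathcal{K}|\delta_{x_2}\mathcal{K})\le\kappa^2\|x_1-x_2\|_2^2$. Matrix inequalities are in the Loewner order; $\nabla_1,\nabla_2$ are gradients in the first/second variable. Condition $(\mathcal{W})$ with $\kappa>0$ and positive definite $\widehat u,\widehat v$: for all arguments, $\|\nabla_2W(x_1,y)-\nabla_2W(x_2,y)\|_2\le\kappa\|x_1-x_2\|_2$, $\|\nabla_2W^\flat(y_1,x)-\nabla_2W^\flat(y_2,x)\|_2\le\kappa\|y_1-y_2\|_2$, $\nabla_1^2W(x,y_1)-\nabla_1^2W(x,y_2)\le\widehat u^{-1}$, and $\nabla_1^2W^\flat(y,x_1)-\nabla_1^2W^\flat(y,x_2)\le\widehat v^{-1}$. Condition $C_V^-(U)$: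 $\nabla^2U(x)\ge u_+^{-1}1_{\|x\|_2\ge\delta}-\overline u_+1_{\|x\|_2<\delta}$ for all $x$, and $\lambda_V$ satisfies $\mathbb{T}_2(\|v_+\|_2)$. *)

theory Defs
  imports "HOL-Probability.Probability"
begin

section \<open>Differential calculus and matrices\<close>

text \<open>Functions on a Euclidean space all of whose iterated directional derivatives up to order
  \<open>k\<close> exist and are continuous; \<open>smooth\<close> means \<open>C\<^sup>\<infinity>\<close>.\<close>

primrec Ck :: "nat \<Rightarrow> ('a::euclidean_space \<Rightarrow> real) \<Rightarrow> bool" where
  "Ck 0 f \<longleftrightarrow> continuous_on UNIV f"
| "Ck (Suc k) f \<longleftrightarrow>
     f differentiable_on UNIV \<and> (\<forall>h. Ck k (\<lambda>x. frechet_derivative f (at x) h))"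

definition smooth :: "('a::euclidean_space \<Rightarrow> real) \<Rightarrow> bool" where
  "smooth f \<longleftrightarrow> (\<forall>k. Ck k f)"

definition grad :: "(real^'d \<Rightarrow> real) \<Rightarrow> real^'d \<Rightarrow> real^'d" where
  "grad f x = (\<chi> i. frechet_derivative f (at x) (axis i 1))"

definition hessian :: "(real^'d \<Rightarrow> real) \<Rightarrow> real^'d \<Rightarrow> real^'d^'d" where
  "hessian f x = jacobian (grad f) (at x)"

definition pos_semidef :: "real^'d^'d \<Rightarrow> bool" where
  "pos_semidef A \<longleftrightarrow> transpose A = A \<and> (\<forall>x. 0 \<le> x \<bullet> (A *v x))"

definition pos_def :: "real^'d^'d \<Rightarrow> bool" where
  "pos_def A \<longleftrightarrow> transpose A = A \<and> (\<forall>x. x \<noteq> 0 \<longrightarrow> 0 < x \<bullet> (A *v x))"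

definition loewner_le :: "real^'d^'d \<Rightarrow> real^'d^'d \<Rightarrow> bool" where
  "loewner_le A B \<longleftrightarrow> pos_semidef (B - A)"

definition loewner_less :: "real^'d^'d \<Rightarrow> real^'d^'d \<Rightarrow> bool" where
  "loewner_less A B \<longleftrightarrow> pos_def (B - A)"

text \<open>The library's \<open>norm\<close> on \<open>real^'d^'d\<close> is the Frobenius norm, hence the operator norm here.\<close>

definition spectral_norm :: "real^'d^'d \<Rightarrow> real" where
  "spectral_norm A = onorm (\<lambda>x. A *v x)"


section \<open>Entropy, Fisher information, Wasserstein distance\<close>

text \<open>Relative entropy \<open>H(\<nu>|\<mu>)\<close> of probability measures. The negative part of
  \<open>log (d\<nu>/d\<mu>)\<close> is always \<open>\<nu>\<close>-integrable, so non-integrability means that the entropy is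
  infinite (whereas the Bochner integral in \<open>KL_divergence\<close> would return 0).\<close>

definition rel_entropy :: "'a measure \<Rightarrow> 'a measure \<Rightarrow> ennreal" where
  "rel_entropy \<nu> \<mu> =
     (if absolutely_continuous \<mu> \<nu> \<and> integrable \<nu> (entropy_density (exp 1) \<mu> \<nu>)
      then ennreal (KL_divergence (exp 1) \<mu> \<nu>) else \<infinity>)"

text \<open>\<open>RN_deriv\<close> is an arbitrary almost-everywhere version, whose pointwise gradient is
  meaningless. The gradient in the Fisher information \<open>J(\<nu>|\<mu>)\<close> is therefore taken of a
  differentiable version of \<open>log (d\<nu>/d\<mu>)\<close>; if \<open>\<mu>\<close> has a positive Lebesgue density, as for all
  measures considered here, there is at most one, and the infimum is just its selection
  (the value is infinite if there is none).\<close>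

definition log_densities :: "(real^'d) measure \<Rightarrow> (real^'d) measure \<Rightarrow> (real^'d \<Rightarrow> real) set" where
  "log_densities \<nu> \<mu> =
     {g. g differentiable_on UNIV \<and> \<nu> = density \<mu> (\<lambda>x. ennreal (exp (g x)))}"

definition fisher_info :: "(real^'d) measure \<Rightarrow> (real^'d) measure \<Rightarrow> ennreal" where
  "fisher_info \<nu> \<mu> =
     (if absolutely_continuous \<mu> \<nu>
      then (INF g\<in>log_densities \<nu> \<mu>. \<integral>\<^sup>+x. ennreal ((norm (grad g x))\<^sup>2) \<partial>\<nu>)
      else \<infinity>)"

definition couplings ::
  "'a::topological_space measure \<Rightarrow> 'b::topological_space measure \<Rightarrow> ('a \<times> 'b) measure set" where
  "couplings \<mu> \<eta> = {Q. sets Q = sets borel \<and> distr Q borel fst = \<mu> \<and> distr Q borel snd = \<eta>}"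

definition ennreal_sqrt :: "ennreal \<Rightarrow> ennreal" where
  "ennreal_sqrt t = (if t = \<infinity> then \<infinity> else ennreal (sqrt (enn2real t)))"

definition wasserstein2 :: "(real^'d) measure \<Rightarrow> (real^'d) measure \<Rightarrow> ennreal" where
  "wasserstein2 \<nu> \<mu> =
     ennreal_sqrt (INF Q\<in>couplings \<nu> \<mu>. \<integral>\<^sup>+z. ennreal ((norm (fst z - snd z))\<^sup>2) \<partial>Q)"

definition T2 :: "(real^'d) measure \<Rightarrow> real \<Rightarrow> bool" where
  "T2 \<mu> \<rho> \<longleftrightarrow>
     (\<forall>\<nu>. prob_space \<nu> \<and> sets \<nu> = sets borel \<longrightarrow>
        ennreal (1/2) * (wasserstein2 \<nu> \<mu>)\<^sup>2 \<le> ennreal \<rho> * rel_entropy \<nu> \<mu>)"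


section \<open>Sinkhorn bridges\<close>

definition gibbs :: "(real^'d \<Rightarrow> real) \<Rightarrow> (real^'d) measure" where
  "gibbs U = density lborel (\<lambda>x. ennreal (exp (- U x)))"

definition gibbs_kernel :: "(real^'d \<Rightarrow> real^'d \<Rightarrow> real) \<Rightarrow> real^'d \<Rightarrow> (real^'d) measure" where
  "gibbs_kernel W x = gibbs (W x)"

definition flat :: "('a \<Rightarrow> 'b \<Rightarrow> 'c) \<Rightarrow> 'b \<Rightarrow> 'a \<Rightarrow> 'c" where
  "flat W y x = W x y"

definition markov_kernel :: "(real^'d \<Rightarrow> (real^'d) measure) \<Rightarrow> bool" where
  "markov_kernel K \<longleftrightarrow> K \<in> borel \<rightarrow>\<^sub>M prob_algebra borel"

text \<open>The measure \<open>(\<mu> \<times> K)(d(x,y)) = \<mu>(dx) K(x,dy)\<close>; the marginal \<open>\<mu>K\<close> is \<open>\<mu> \<bind> K\<close>.\<close>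

definition kprod ::
  "(real^'d) measure \<Rightarrow> (real^'d \<Rightarrow> (real^'d) measure) \<Rightarrow> ((real^'d) \<times> (real^'d)) measure" where
  "kprod \<mu> K = \<mu> \<bind> (\<lambda>x. distr (K x) borel (\<lambda>y. (x, y)))"

definition swap_measure :: "((real^'d) \<times> (real^'d)) measure \<Rightarrow> ((real^'d) \<times> (real^'d)) measure" where
  "swap_measure Q = distr Q borel prod.swap"

text \<open>\<open>K (2 * n)\<close> is a transition from \<open>x\<close> to \<open>y\<close>, \<open>K (2 * n + 1)\<close> one from \<open>y\<close> to \<open>x\<close>.\<close>

definition sinkhorn_marginal ::
  "(real^'d) measure \<Rightarrow> (real^'d) measure \<Rightarrow> (nat \<Rightarrow> real^'d \<Rightarrow> (real^'d) measure)
     \<Rightarrow> nat \<Rightarrow> (real^'d) measure" where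
  "sinkhorn_marginal \<mu> \<eta> K n = (if even n then \<mu> \<bind> K n else \<eta> \<bind> K n)"

definition sinkhorn_joint ::
  "(real^'d) measure \<Rightarrow> (real^'d) measure \<Rightarrow> (nat \<Rightarrow> real^'d \<Rightarrow> (real^'d) measure)
     \<Rightarrow> nat \<Rightarrow> ((real^'d) \<times> (real^'d)) measure" where
  "sinkhorn_joint \<mu> \<eta> K n =
     (if even n then kprod \<mu> (K n) else swap_measure (kprod \<eta> (K n)))"

definition sinkhorn_transitions ::
  "(real^'d) measure \<Rightarrow> (real^'d) measure \<Rightarrow> (real^'d \<Rightarrow> (real^'d) measure)
     \<Rightarrow> (nat \<Rightarrow> real^'d \<Rightarrow> (real^'d) measure) \<Rightarrow> bool" where
  "sinkhorn_transitions \<mu> \<eta> K0 K \<longleftrightarrow>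
     K 0 = K0 \<and> (\<forall>n. markov_kernel (K n)) \<and>
     (\<forall>n. kprod \<mu> (K (2 * n)) =
            swap_measure (kprod (sinkhorn_marginal \<mu> \<eta> K (2 * n)) (K (2 * n + 1)))) \<and>
     (\<forall>n. swap_measure (kprod \<eta> (K (2 * n + 1))) =
            kprod (sinkhorn_marginal \<mu> \<eta> K (2 * n + 1)) (K (2 * (n + 1))))"

text \<open>First and second derivatives of \<open>x \<mapsto> \<integral> p x y dy\<close> can be taken under the integral sign.\<close>

definition diff_under_integral :: "(real^'d \<Rightarrow> real^'d \<Rightarrow> real) \<Rightarrow> bool" where
  "diff_under_integral p \<longleftrightarrow>
     (\<forall>x. integrable lborel (p x) \<and>
          integrable lborel (\<lambda>y. grad (\<lambda>x'. p x' y) x) \<and>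
          integrable lborel (\<lambda>y. hessian (\<lambda>x'. p x' y) x) \<and>
          GDERIV (\<lambda>x'. \<integral>y. p x' y \<partial>lborel) x :> (\<integral>y. grad (\<lambda>x'. p x' y) x \<partial>lborel) \<and>
          ((\<lambda>x'. \<integral>y. grad (\<lambda>x''. p x'' y) x' \<partial>lborel) has_derivative
             (\<lambda>h. (\<integral>y. hessian (\<lambda>x'. p x' y) x \<partial>lborel) *v h)) (at x))"

text \<open>The disintegrations only determine the Sinkhorn transitions almost everywhere. Smooth
  log-densities \<open>- w n x y\<close> single out one version, which matters for conditions on
  \<open>K n x\<close> quantified over all \<open>x\<close>.\<close>

definition regular_transitions :: "(nat \<Rightarrow> real^'d \<Rightarrow> (real^'d) measure) \<Rightarrow> bool" where
  "regular_transitions K \<longleftrightarrow>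
     (\<exists>w :: nat \<Rightarrow> real^'d \<Rightarrow> real^'d \<Rightarrow> real. \<forall>n.
        smooth (\<lambda>z. w n (fst z) (snd z)) \<and>
        (\<forall>x. K n x = gibbs (w n x)) \<and>
        diff_under_integral (\<lambda>x y. exp (- w n x y)))"

text \<open>\<open>B\<close> is the bridge \<open>P\<^bsub>\<mu>,\<eta>\<^esub>\<close> with respect to the reference measure \<open>P\<close>.\<close>

definition schroedinger_bridge ::
  "(real^'d) measure \<Rightarrow> (real^'d) measure \<Rightarrow> ((real^'d) \<times> (real^'d)) measure
     \<Rightarrow> ((real^'d) \<times> (real^'d)) measure \<Rightarrow> bool" where
  "schroedinger_bridge \<mu> \<eta> P B \<longleftrightarrow>
     is_arg_min (\<lambda>Q. rel_entropy Q P) (\<lambda>Q. Q \<in> couplings \<mu> \<eta>) B"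

text \<open>Standing assumptions: \<open>K\<close> is the sequence of Sinkhorn transitions associated with
  \<open>(\<lambda>\<^sub>U, \<lambda>\<^sub>V, K\<^sub>W)\<close>, and \<open>B\<close> is the bridge.\<close>

definition sinkhorn_setting ::
  "(real^'d \<Rightarrow> real) \<Rightarrow> (real^'d \<Rightarrow> real) \<Rightarrow> (real^'d \<Rightarrow> real^'d \<Rightarrow> real)
     \<Rightarrow> (nat \<Rightarrow> real^'d \<Rightarrow> (real^'d) measure) \<Rightarrow> ((real^'d) \<times> (real^'d)) measure \<Rightarrow> bool" where
  "sinkhorn_setting U V W K B \<longleftrightarrow>
     smooth U \<and> smooth V \<and> smooth (\<lambda>z. W (fst z) (snd z)) \<and>
     prob_space (gibbs U) \<and> prob_space (gibbs V) \<and> markov_kernel (gibbs_kernel W) \<and>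
     (\<exists>Q\<in>couplings (gibbs U) (gibbs V).
        rel_entropy Q (kprod (gibbs U) (gibbs_kernel W)) < \<infinity>) \<and>
     schroedinger_bridge (gibbs U) (gibbs V) (kprod (gibbs U) (gibbs_kernel W)) B \<and>
     sinkhorn_transitions (gibbs U) (gibbs V) (gibbs_kernel W) K \<and>
     regular_transitions K"


section \<open>Regularity conditions\<close>

definition cond_A0 :: "(real^'d \<Rightarrow> (real^'d) measure) \<Rightarrow> real \<Rightarrow> real \<Rightarrow> bool" where
  "cond_A0 K \<kappa> \<rho> \<longleftrightarrow> \<kappa> > 0 \<and> \<rho> > 0 \<and>
     (\<forall>x1 x2.
        rel_entropy (K x1) (K x2) \<le> ennreal (\<rho> / 2) * fisher_info (K x1) (K x2) \<and>
        fisher_info (K x1) (K x2) \<le> ennreal (\<kappa>\<^sup>2 * (norm (x1 - x2))\<^sup>2))"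

definition cond_W ::
  "(real^'d \<Rightarrow> real^'d \<Rightarrow> real) \<Rightarrow> real \<Rightarrow> real^'d^'d \<Rightarrow> real^'d^'d \<Rightarrow> bool" where
  "cond_W W \<kappa> u_hat v_hat \<longleftrightarrow> \<kappa> > 0 \<and> pos_def u_hat \<and> pos_def v_hat \<and>
     (\<forall>x1 x2 y. norm (grad (W x1) y - grad (W x2) y) \<le> \<kappa> * norm (x1 - x2)) \<and>
     (\<forall>y1 y2 x. norm (grad (flat W y1) x - grad (flat W y2) x) \<le> \<kappa> * norm (y1 - y2)) \<and>
     (\<forall>x y1 y2. loewner_le (hessian (\<lambda>x'. W x' y1) x - hessian (\<lambda>x'. W x' y2) x)
                  (matrix_inv u_hat)) \<and>
     (\<forall>y x1 x2. loewner_le (hessian (\<lambda>y'. flat W y' x1) y - hessian (\<lambda>y'. flat W y' x2) y)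
                  (matrix_inv v_hat))"

definition cond_CV_minus ::
  "(real^'d \<Rightarrow> real) \<Rightarrow> (real^'d \<Rightarrow> real) \<Rightarrow> real^'d^'d \<Rightarrow> real^'d^'d \<Rightarrow> real \<Rightarrow> real^'d^'d
     \<Rightarrow> bool" where
  "cond_CV_minus U V u_plus u_bar \<delta> v_plus \<longleftrightarrow>
     (\<forall>x. loewner_le (indicator {x. norm x \<ge> \<delta>} x *\<^sub>R matrix_inv u_plus
                        - indicator {x. norm x < \<delta>} x *\<^sub>R u_bar)
            (hessian U x)) \<and>
     T2 (gibbs V) (spectral_norm v_plus)"

end

theory Submission
  imports Defs
begin

text \<open>
The first statement combines four facts about relative entropy \<open>H\<close>. Write \<open>J n\<close> for the Sinkhorn
joint laws, \<open>\<pi> n\<close> for their marginals and \<open>Q\<close> for a coupling of \<open>\<mu>\<close> and \<open>\<eta>\<close>.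

\<^item> Passing from \<open>J n\<close> to \<open>J (n + 1)\<close> replaces one marginal, so the chain rule
  (\<open>rel_entropy_chain\<close>) gives \<open>H(Q|J n) = H(Q|J (n + 1)) + H(\<mu> or \<eta>|\<pi> n)\<close>. The additional term is the
  same for all couplings; hence the bridge \<open>B\<close> minimises \<open>H(\<cdot>|J n)\<close> over the couplings for every \<open>n\<close>
  and not only for \<open>n = 0\<close> (\<open>bridge_minimal\<close>).
\<^item> For even \<open>n\<close>, a coupling \<open>\<gamma>(dy',dy)\<close> of \<open>\<pi> n\<close> and \<open>\<eta>\<close>, pushed through \<open>K (n + 1) y'\<close> in the first
  variable, is a coupling of \<open>\<mu>\<close> and \<open>\<eta>\<close>, since \<open>K (n + 1)\<close> carries \<open>\<pi> n\<close> to \<open>\<mu>\<close>. Its entropy relative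
  to \<open>J (n + 1)\<close> is at most \<open>\<integral> H(K (n + 1) y'|K (n + 1) y) d\<gamma>\<close> by data processing
  (\<open>transported_coupling\<close>). If the integrand is at most \<open>c / 2 * |y' - y|\<^sup>2\<close>, minimality of \<open>B\<close> yields
  \<open>H(B|J (n + 1)) \<le> c / 2 * D\<^sub>2(\<pi> n, \<eta>)\<^sup>2\<close>, and the transport inequality of \<open>\<eta>\<close> with constant \<open>v\<close> bounds
  this by \<open>c * v * H(\<pi> n|\<eta>)\<close>.
\<^item> Data processing under the second projection gives \<open>H(\<pi> n|\<eta>) \<le> H(\<mu>|\<pi> (n - 1))\<close>
  (\<open>marginal_entropy_decreases\<close>).
\<^item> So \<open>A = H(B|J (n + 1))\<close> and \<open>X = H(\<mu>|\<pi> (n - 1))\<close> satisfy \<open>A \<le> c * v * X\<close>, whereas the chain rule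
  gives \<open>A + X \<le> H(B|J (n - 1))\<close>. Eliminating \<open>X\<close> is the contraction (\<open>bridge_entropy_contraction\<close>).

All laws involved have continuous log-densities: the disintegrations, which a priori hold almost
everywhere, become pointwise identities between potentials (\<open>gibbs_disintegration\<close>).

Under the condition of the first part the bound on \<open>H(K y'|K y)\<close> is immediate with \<open>c = \<kappa>\<^sup>2 * \<rho>\<close>. For the
second part it comes from a concentration argument. The log-densities of
\<open>K (n + 1) y'\<close> and \<open>K (n + 1) y\<close> differ by a function with Lipschitz constant \<open>L = \<kappa> * |y' - y|\<close>,
because the potential is \<open>W\<close> plus functions of one variable (\<open>separable_potentials\<close>). If a law \<open>\<nu>\<close>
satisfies \<open>\<integral> exp(\<alpha> * |x - m|\<^sup>2) d\<nu> \<le> C\<close>, then every perturbation of \<open>log d\<nu>\<close> by an \<open>L\<close>-Lipschitz function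
has entropy at most a constant times \<open>L\<^sup>2\<close>, the constant depending on \<open>\<alpha>\<close> and \<open>C\<close> only
(\<open>rel_entropy_lipschitz_le\<close>). Such a Gaussian moment bound holds with uniform constants, since the
potential \<open>\<Phi>\<close> of \<open>K (n + 1) y\<close> is uniformly convex up to a Lipschitz term: \<open>\<Phi> - U\<close> plus the quadratic
form of \<open>u_hat\<^sup>-\<^sup>1 / 2\<close> is the logarithm of an integral of log-convex functions, hence convex
(\<open>potential_convex\<close>), while \<open>U\<close> minus this quadratic form becomes uniformly convex after adding a
multiple of \<open>sqrt(D\<^sup>2 + |x|\<^sup>2)\<close> (\<open>convex_on_hessian_indicator\<close>).
\<close>

section \<open>Relative entropy through densities\<close>

lemma emeasure_density_space:
  "f \<in> borel_measurable M \<Longrightarrow> emeasure (density M f) (space M) = (\<integral>\<^sup>+x. f x \<partial>M)"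
  by (simp add: emeasure_density cong: nn_integral_cong)

text \<open>The Radon--Nikodym derivative occurring in the definition may be replaced by any given density,
since the two agree almost everywhere.\<close>

lemma rel_entropy_eq_integral_ln:
  fixes f :: "'a \<Rightarrow> real"
  assumes "prob_space M" and f[measurable]: "f \<in> borel_measurable M" and nn: "\<And>x. 0 \<le> f x"
  shows "rel_entropy (density M f) M =
    (if integrable (density M f) (\<lambda>x. ln (f x))
     then ennreal (\<integral>x. ln (f x) \<partial>density M f) else \<infinity>)"
proof -
  interpret prob_space M by fact
  have ac: "absolutely_continuous M (density M f)"
    by (intro absolutely_continuousI_density) simp
  have "density M (RN_deriv M (density M f)) = density M f"
    by (intro density_RN_deriv_density) auto
  then have "AE x in M. RN_deriv M (density M f) x = f x"
    by (intro density_unique) auto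
  then have ae: "AE x in density M f. entropy_density (exp 1) M (density M f) x = ln (f x)"
    by (auto simp: AE_density entropy_density_def log_def nn)
  have [measurable]: "entropy_density (exp 1) M (density M f) \<in> borel_measurable M"
    by (auto simp: comp_def entropy_density_def)
  have "integrable (density M f) (entropy_density (exp 1) M (density M f)) \<longleftrightarrow>
      integrable (density M f) (\<lambda>x. ln (f x))"
    using ae by (intro integrable_cong_AE) auto
  moreover have "KL_divergence (exp 1) M (density M f) = (\<integral>x. ln (f x) \<partial>density M f)"
    unfolding KL_divergence_def using ae by (intro integral_cong_AE) auto
  ultimately show ?thesis
    using ac by (simp add: rel_entropy_def)
qed

text \<open>The condition \<open>(t - h) * ln h \<ge> 0\<close> says that \<open>t\<close> lies on the far side of \<open>h\<close> as seen from \<open>1\<close>. It is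
what makes truncations of a density towards \<open>1\<close> keep the integrand of the entropy nonnegative.\<close>

lemma mult_ln_ge: "t * ln h - h + 1 \<ge> 0" if "t \<ge> 0" "h > 0" "(t - h) * ln h \<ge> 0" for t h :: real
proof -
  have "ln (1 / h) \<le> 1 / h - 1"
    using that by (intro ln_le_minus_one) simp
  then have "h * (- ln h) \<le> h * (1 / h - 1)"
    using that by (intro mult_left_mono) (auto simp: ln_div)
  then have "h * ln h - h + 1 \<ge> 0"
    using that by (simp add: algebra_simps)
  then show ?thesis
    using that by (simp add: algebra_simps)
qed

text \<open>Adding \<open>1 - t\<close> to \<open>t ln t\<close> does not change the integral of a probability density, but makes the
integrand nonnegative, so that the entropy becomes a nonnegative integral and infinite values need
no separate treatment.\<close>

definition ent_fun :: "real \<Rightarrow> real" where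
  "ent_fun t = t * ln t - t + 1"

lemma ent_fun_nonneg: "t \<ge> 0 \<Longrightarrow> ent_fun t \<ge> 0"
  using mult_ln_ge[of t t] by (cases "t = 0") (auto simp: ent_fun_def)

lemma ent_fun_measurable[measurable]: "ent_fun \<in> borel_measurable borel"
  unfolding ent_fun_def by measurable

lemma rel_entropy_eq_nn_integral:
  fixes f :: "'a \<Rightarrow> real"
  assumes "prob_space M" and f[measurable]: "f \<in> borel_measurable M" and nn: "\<And>x. 0 \<le> f x"
    and "prob_space (density M f)"
  shows "rel_entropy (density M f) M = (\<integral>\<^sup>+x. ennreal (ent_fun (f x)) \<partial>M)"
proof -
  interpret prob_space M by fact
  interpret D: prob_space "density M f" by fact
  have "(\<integral>\<^sup>+x. ennreal (f x) \<partial>M) = 1"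
    using D.emeasure_space_1 by (simp add: emeasure_density cong: nn_integral_cong)
  then have intf: "integrable M f" and "(\<integral>x. f x \<partial>M) = 1"
    using nn by (auto intro!: integrableI_nonneg simp: integral_eq_nn_integral)
  have iff1: "integrable (density M f) (\<lambda>x. ln (f x)) \<longleftrightarrow> integrable M (\<lambda>x. f x * ln (f x))"
    using nn by (subst integrable_density) auto
  have eq1: "(\<integral>x. ln (f x) \<partial>density M f) = (\<integral>x. f x * ln (f x) \<partial>M)"
    using nn by (subst integral_density) auto
  show ?thesis
  proof (cases "integrable M (\<lambda>x. f x * ln (f x))")
    case True
    then have "integrable M (\<lambda>x. ent_fun (f x))"
      using intf by (auto simp: ent_fun_def)
    then have "(\<integral>\<^sup>+x. ennreal (ent_fun (f x)) \<partial>M) = ennreal (\<integral>x. ent_fun (f x) \<partial>M)"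
      using nn by (intro nn_integral_eq_integral) (auto simp: ent_fun_nonneg)
    also have "(\<integral>x. ent_fun (f x) \<partial>M) = (\<integral>x. f x * ln (f x) \<partial>M)"
      using True intf \<open>(\<integral>x. f x \<partial>M) = 1\<close> by (simp add: ent_fun_def prob_space)
    finally show ?thesis
      using True by (simp add: rel_entropy_eq_integral_ln assms iff1 eq1)
  next
    case False
    have "(\<integral>\<^sup>+x. ennreal (ent_fun (f x)) \<partial>M) = \<infinity>"
    proof (rule ccontr)
      assume "\<not> ?thesis"
      then have "integrable M (\<lambda>x. ent_fun (f x))"
        using nn by (intro integrableI_nonneg) (auto simp: ent_fun_nonneg less_top)
      then have "integrable M (\<lambda>x. ent_fun (f x) + f x - 1)"
        using intf by auto
      then show False
        using False by (simp add: ent_fun_def)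
    qed
    then show ?thesis
      using False by (simp add: rel_entropy_eq_integral_ln assms iff1)
  qed
qed

text \<open>Finiteness of the entropy is thus only a matter of the positive part of the logarithm.\<close>

lemma integrable_neg_part_ln_density:
  fixes f :: "'a \<Rightarrow> real"
  assumes "prob_space M" and f[measurable]: "f \<in> borel_measurable M" and nn: "\<And>x. 0 \<le> f x"
  shows "integrable (density M f) (\<lambda>x. min 0 (ln (f x)))"
proof -
  interpret prob_space M by fact
  have b: "\<bar>f x * min 0 (ln (f x))\<bar> \<le> 1" for x
  proof (cases "f x = 0 \<or> ln (f x) \<ge> 0")
    case False
    then have "f x > 0" "f x < 1" "ln (f x) < 0" using nn[of x] by auto
    then show ?thesis
      using ent_fun_nonneg[OF nn[of x]] by (auto simp: ent_fun_def min_def abs_if mult_less_0_iff)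
  qed (auto simp: min_def)
  have "integrable M (\<lambda>x. f x * min 0 (ln (f x)))"
    using b by (intro integrable_const_bound[where B=1]) auto
  then show ?thesis
    using nn by (subst integrable_density) auto
qed

lemma integral_ln_density_nonneg:
  fixes f :: "'a \<Rightarrow> real"
  assumes "prob_space M" and f[measurable]: "f \<in> borel_measurable M" and nn: "\<And>x. 0 \<le> f x"
    and "prob_space (density M f)" and int: "integrable (density M f) (\<lambda>x. ln (f x))"
  shows "0 \<le> (\<integral>x. ln (f x) \<partial>density M f)"
proof -
  interpret prob_space M by fact
  interpret D: prob_space "density M f" by fact
  have "(\<integral>\<^sup>+x. ennreal (f x) \<partial>M) = 1"
    using D.emeasure_space_1 by (simp add: emeasure_density cong: nn_integral_cong)
  then have intf: "integrable M f" and f1: "(\<integral>x. f x \<partial>M) = 1"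
    using nn by (auto intro!: integrableI_nonneg simp: integral_eq_nn_integral)
  have i: "integrable M (\<lambda>x. f x * ln (f x))"
    using int nn by (subst (asm) integrable_density) auto
  have "0 \<le> (\<integral>x. ent_fun (f x) \<partial>M)"
    using nn by (intro integral_nonneg_AE) (auto simp: ent_fun_nonneg)
  also have "\<dots> = (\<integral>x. f x * ln (f x) \<partial>M)"
    using i intf f1 by (simp add: ent_fun_def prob_space)
  also have "\<dots> = (\<integral>x. ln (f x) \<partial>density M f)"
    using nn by (subst integral_density) auto
  finally show ?thesis .
qed

lemma RN_density_real:
  assumes "prob_space M" "prob_space N" "absolutely_continuous M N" "sets N = sets M"
  obtains g :: "'a \<Rightarrow> real" where "g \<in> borel_measurable M" "\<And>x. 0 \<le> g x" "N = density M g"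
proof -
  interpret prob_space M by fact
  interpret N: prob_space N by fact
  obtain D where D: "D \<in> borel_measurable M" "AE x in M. RN_deriv M N x = ennreal (D x)"
      "\<And>x. 0 \<le> D x"
    using real_RN_deriv[OF N.finite_measure_axioms assms(3,4)] by metis
  have "N = density M (RN_deriv M N)"
    using assms by (simp add: density_RN_deriv)
  also have "\<dots> = density M D"
    using D by (intro density_cong) auto
  finally show ?thesis using D that by blast
qed

text \<open>Data processing. For every positive function \<open>h\<close> on the target, Young's inequality
\<open>t ln s \<le> t ln t - t + s\<close>, applied to the density and to \<open>h\<close> at the image point, bounds the entropy
upstairs from below by \<open>\<integral> ln h d\<nu> - \<integral> h d\<mu> + 1\<close> for the image measures \<open>\<nu>\<close> and \<open>\<mu>\<close>. This is the entropy of
the image measures when \<open>h\<close> is their density; bounded truncations of the density and Fatou's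
lemma avoid all questions of integrability.\<close>

lemma rel_entropy_distr_le:
  fixes f :: "'a \<Rightarrow> real"
  assumes "prob_space M" and f[measurable]: "f \<in> borel_measurable M" and nn: "\<And>x. 0 \<le> f x"
    and "prob_space (density M f)" and T[measurable]: "T \<in> M \<rightarrow>\<^sub>M N"
  shows "rel_entropy (distr (density M f) N T) (distr M N T) \<le> rel_entropy (density M f) M"
proof -
  interpret prob_space M by fact
  interpret D: prob_space "density M f" by fact
  let ?M = "distr M N T" and ?D = "distr (density M f) N T"
  interpret M': prob_space ?M by (rule prob_space_distr) simp
  interpret D': prob_space ?D by (rule D.prob_space_distr) simp
  have ac: "absolutely_continuous ?M ?D"
    unfolding absolutely_continuous_def
  proof
    fix A assume A: "A \<in> null_sets ?M"
    then have "T -` A \<inter> space M \<in> null_sets M"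
      by (simp add: null_sets_distr_iff)
    then have "T -` A \<inter> space M \<in> null_sets (density M f)"
      using absolutely_continuousI_density[of "\<lambda>x. ennreal (f x)" M]
      by (auto simp: absolutely_continuous_def)
    then show "A \<in> null_sets ?D"
      using A by (simp add: null_sets_distr_iff)
  qed
  obtain g :: "_ \<Rightarrow> real" where g[measurable]: "g \<in> borel_measurable ?M" and gnn: "\<And>x. 0 \<le> g x"
      and Dg: "?D = density ?M g"
    using RN_density_real[OF M'.prob_space_axioms D'.prob_space_axioms ac] by auto
  have [measurable]: "g \<in> borel_measurable N" using g by simp
  have "(\<integral>\<^sup>+x. ennreal (g x) \<partial>?M) = 1"
    using D'.emeasure_space_1 emeasure_density_space[of "\<lambda>x. ennreal (g x)" ?M]
    unfolding Dg by simp
  then have intg: "integrable ?M g"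
    using gnn by (intro integrableI_nonneg) auto
  have "(\<integral>\<^sup>+x. ennreal (f x) \<partial>M) = 1"
    using D.emeasure_space_1 by (simp add: emeasure_density cong: nn_integral_cong)
  then have intf: "integrable M f"
    using nn by (intro integrableI_nonneg) auto
  let ?K = "\<integral>\<^sup>+x. ennreal (ent_fun (f x)) \<partial>M"
  \<comment> \<open>Clamping moves the density towards 1, so that the truncated integrands are nonnegative.\<close>
  define h where "h n y = max (1 / (real n + 1)) (min (real n + 1) (g y))" for n y
  have [measurable]: "h n \<in> borel_measurable N" for n unfolding h_def by measurable
  have hpos: "h n y > 0" for n y unfolding h_def
    by (simp add: less_max_iff_disj)
  have hge: "h n y \<ge> 1 / (real n + 1)" and hle: "h n y \<le> real n + 1" for n y
    unfolding h_def by (auto simp: field_simps)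
  have lnh: "\<bar>ln (h n y)\<bar> \<le> ln (real n + 1)" for n y
  proof -
    have "ln (h n y) \<le> ln (real n + 1)"
      using hle[of n y] hpos[of n y] by simp
    moreover have "ln (1 / (real n + 1)) \<le> ln (h n y)"
      using hge[of n y] by (subst ln_le_cancel_iff) (auto simp: hpos)
    ultimately show ?thesis by (auto simp: ln_div)
  qed
  have sgn: "(g y - h n y) * ln (h n y) \<ge> 0" for n y
  proof -
    consider "g y = h n y" | "g y > h n y" "h n y = real n + 1" | "g y < h n y" "h n y = 1 / (real n + 1)"
    proof -
      have "1 / (real n + 1) \<le> real n + 1" by (simp add: field_simps)
      then show ?thesis
        using that unfolding h_def by (cases "g y < 1 / (real n + 1)"; cases "g y > real n + 1") auto
    qed
    then show ?thesis
    proof cases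
      case 3
      then have "ln (h n y) \<le> 0" by (simp add: ln_div)
      then show ?thesis using 3 by (intro mult_nonpos_nonpos) auto
    qed auto
  qed
  define \<psi> where "\<psi> n y = g y * ln (h n y) - h n y + 1" for n y
  have [measurable]: "\<psi> n \<in> borel_measurable N" for n unfolding \<psi>_def by measurable
  have psinn: "\<psi> n y \<ge> 0" for n y
    unfolding \<psi>_def using mult_ln_ge[OF gnn hpos sgn] .
  have bound: "(\<integral>\<^sup>+y. ennreal (\<psi> n y) \<partial>?M) \<le> ?K" for n
  proof (cases "?K = \<infinity>")
    case False
    then have intK: "integrable M (\<lambda>x. ent_fun (f x))"
      using nn by (intro integrableI_nonneg) (auto simp: ent_fun_nonneg less_top)
    have i1: "integrable ?M (\<lambda>y. g y * ln (h n y))"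
    proof (rule Bochner_Integration.integrable_bound[where f="\<lambda>y. g y * ln (real n + 1)"])
      show "AE x in ?M. norm (g x * ln (h n x)) \<le> norm (g x * ln (real n + 1))"
        using lnh by (intro AE_I2) (auto simp: abs_mult gnn intro!: mult_left_mono)
    qed (use intg in auto)
    have i2: "integrable ?M (h n)"
      using hpos hle by (intro M'.integrable_const_bound[where B="real n + 1"]) (auto simp: less_imp_le)
    have i3: "integrable M (\<lambda>x. f x * ln (h n (T x)))"
    proof (rule Bochner_Integration.integrable_bound[where f="\<lambda>x. f x * ln (real n + 1)"])
      show "AE x in M. norm (f x * ln (h n (T x))) \<le> norm (f x * ln (real n + 1))"
        using lnh by (intro AE_I2) (auto simp: abs_mult nn intro!: mult_left_mono)
    qed (use intf in auto)
    have i4: "integrable M (\<lambda>x. h n (T x))"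
      using i2 by (subst (asm) integrable_distr_eq) auto
    have e1: "(\<integral>y. g y * ln (h n y) \<partial>?M) = (\<integral>x. f x * ln (h n (T x)) \<partial>M)"
    proof -
      have "(\<integral>y. g y * ln (h n y) \<partial>?M) = (\<integral>y. ln (h n y) \<partial>density ?M g)"
        by (subst integral_density) (auto simp: gnn)
      also have "\<dots> = (\<integral>x. ln (h n (T x)) \<partial>density M f)"
        by (subst Dg[symmetric], subst integral_distr) auto
      also have "\<dots> = (\<integral>x. f x * ln (h n (T x)) \<partial>M)"
        by (subst integral_density) (auto simp: nn)
      finally show ?thesis .
    qed
    have e2: "(\<integral>y. h n y \<partial>?M) = (\<integral>x. h n (T x) \<partial>M)"
      by (subst integral_distr) auto
    have "(\<integral>y. \<psi> n y \<partial>?M) = (\<integral>x. f x * ln (h n (T x)) - h n (T x) + 1 \<partial>M)"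
      unfolding \<psi>_def using i1 i2 i3 i4 e1 e2 M'.prob_space by (simp add: prob_space)
    also have "\<dots> \<le> (\<integral>x. ent_fun (f x) \<partial>M)"
    proof (rule integral_mono)
      fix x
      \<comment> \<open>This is Young's inequality; at a zero of the density it uses that 0 ln 0 is 0.\<close>
      show "f x * ln (h n (T x)) - h n (T x) + 1 \<le> ent_fun (f x)"
      proof (cases "f x = 0")
        case True
        then show ?thesis using hpos[of n "T x"] by (simp add: ent_fun_def)
      next
        case False
        then have fx: "f x > 0" using nn[of x] by simp
        have "ln (h n (T x) / f x) \<le> h n (T x) / f x - 1"
          using fx hpos by (intro ln_le_minus_one) simp
        then have "f x * (ln (h n (T x)) - ln (f x)) \<le> f x * (h n (T x) / f x - 1)"
          using fx hpos[of n "T x"] by (intro mult_left_mono) (auto simp: ln_div)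
        then show ?thesis using fx by (simp add: ent_fun_def algebra_simps)
      qed
    qed (use i3 i4 intK in auto)
    finally have "ennreal (\<integral>y. \<psi> n y \<partial>?M) \<le> ennreal (\<integral>x. ent_fun (f x) \<partial>M)"
      by (rule ennreal_leI)
    also have "\<dots> = ?K"
      using intK nn by (intro nn_integral_eq_integral[symmetric]) (auto simp: ent_fun_nonneg)
    also have "ennreal (\<integral>y. \<psi> n y \<partial>?M) = (\<integral>\<^sup>+y. ennreal (\<psi> n y) \<partial>?M)"
      using i1 i2 psinn by (intro nn_integral_eq_integral[symmetric]) (auto simp: \<psi>_def)
    finally show ?thesis .
  qed auto
  have lim: "(\<lambda>n. \<psi> n y) \<longlonglongrightarrow> ent_fun (g y)" for y
  proof (cases "g y = 0")
    case True
    have "(\<lambda>n. - (1 / (real n + 1)) + 1) \<longlonglongrightarrow> - 0 + 1"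
      using LIMSEQ_inverse_real_of_nat
      by (intro tendsto_intros) (simp add: inverse_eq_divide add.commute)
    moreover have "h n y = 1 / (real n + 1)" for n
      unfolding h_def True by (simp add: max_def)
    ultimately show ?thesis by (simp add: \<psi>_def True ent_fun_def)
  next
    case False
    then have gy: "g y > 0" using gnn[of y] by simp
    have "eventually (\<lambda>n. real n \<ge> g y \<and> real n \<ge> 1 / g y) sequentially"
      by (intro eventually_conj eventually_compose_filterlim[OF eventually_ge_at_top filterlim_real_sequentially])
    then have "eventually (\<lambda>n. \<psi> n y = ent_fun (g y)) sequentially"
    proof eventually_elim
      case (elim n)
      then have "1 / (real n + 1) \<le> g y" using gy by (simp add: field_simps)
      then have "h n y = g y" using elim by (simp add: h_def)
      then show ?case by (simp add: \<psi>_def ent_fun_def)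
    qed
    then show ?thesis by (rule tendsto_eventually)
  qed
  have "rel_entropy ?D ?M = (\<integral>\<^sup>+y. ennreal (ent_fun (g y)) \<partial>?M)"
    unfolding Dg using D'.prob_space_axioms
    by (intro rel_entropy_eq_nn_integral M'.prob_space_axioms g gnn) (simp add: Dg)
  also have "\<dots> = (\<integral>\<^sup>+y. liminf (\<lambda>n. ennreal (\<psi> n y)) \<partial>?M)"
    using lim by (intro nn_integral_cong lim_imp_Liminf[symmetric] tendsto_ennrealI) auto
  also have "\<dots> \<le> liminf (\<lambda>n. \<integral>\<^sup>+y. ennreal (\<psi> n y) \<partial>?M)"
    by (intro nn_integral_liminf) auto
  also have "\<dots> \<le> liminf (\<lambda>n. ?K)"
    using bound by (intro Liminf_mono) auto
  also have "\<dots> = rel_entropy (density M f) M"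
    by (simp add: rel_entropy_eq_nn_integral assms Liminf_const)
  finally show ?thesis .
qed

text \<open>Replacing the law of \<open>T\<close> under \<open>P\<close> by the one under \<open>Q\<close> multiplies \<open>P\<close> by \<open>r \<circ> T\<close>, so
\<open>ln (dQ/dP) = ln (dQ/dP') + ln (r \<circ> T)\<close> with the new reference measure \<open>P'\<close>. Both summands have integrable
negative parts, so the sum is integrable precisely if both summands are, and the identity holds
including infinite values.\<close>

lemma rel_entropy_chain:
  fixes r :: "'b \<Rightarrow> real"
  assumes P: "prob_space P" and Q: "prob_space Q" and sQ: "sets Q = sets P"
    and T[measurable]: "T \<in> P \<rightarrow>\<^sub>M N" and r[measurable]: "r \<in> borel_measurable N"
    and pos: "\<And>y. 0 < r y"
    and marg: "distr Q N T = density (distr P N T) r"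
  shows "rel_entropy Q P =
    rel_entropy Q (density P (\<lambda>x. r (T x))) + rel_entropy (distr Q N T) (distr P N T)"
proof -
  interpret P: prob_space P by fact
  interpret Q: prob_space Q by fact
  have TQ[measurable]: "T \<in> Q \<rightarrow>\<^sub>M N" using T sQ by (simp cong: measurable_cong_sets)
  let ?P' = "density P (\<lambda>x. ennreal (r (T x)))"
  interpret PT: prob_space "distr P N T" by (rule P.prob_space_distr) simp
  interpret QT: prob_space "distr Q N T" by (rule Q.prob_space_distr) simp
  have P': "prob_space ?P'"
  proof
    have "emeasure ?P' (space ?P') = (\<integral>\<^sup>+x. ennreal (r (T x)) \<partial>P)"
      by (simp add: emeasure_density cong: nn_integral_cong)
    also have "\<dots> = (\<integral>\<^sup>+y. ennreal (r y) \<partial>distr P N T)"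
      by (simp add: nn_integral_distr)
    also have "\<dots> = emeasure (density (distr P N T) r) (space N)"
      using emeasure_density_space[of "\<lambda>x. ennreal (r x)" "distr P N T"] by simp
    also have "\<dots> = 1"
      using QT.emeasure_space_1 by (simp add: marg)
    finally show "emeasure ?P' (space ?P') = 1" .
  qed
  interpret P': prob_space ?P' by fact
  have Pr: "P = density ?P' (\<lambda>x. ennreal (1 / r (T x)))"
  proof -
    have "density ?P' (\<lambda>x. ennreal (1 / r (T x))) = density P (\<lambda>x. ennreal (r (T x)) * ennreal (1 / r (T x)))"
      by (intro density_density_eq) auto
    also have "\<dots> = density P (\<lambda>x. 1)"
      using pos by (intro density_cong) (auto simp: ennreal_mult'[symmetric] less_imp_le less_imp_neq[symmetric])
    finally show ?thesis by (simp add: density_1)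
  qed
  have acs: "absolutely_continuous P ?P'" "absolutely_continuous ?P' P"
    subgoal by (rule absolutely_continuousI_density) simp
    subgoal by (subst (2) Pr, rule absolutely_continuousI_density) simp
    done
  show ?thesis
  proof (cases "absolutely_continuous P Q")
    case False
    then have "\<not> absolutely_continuous ?P' Q"
      using acs by (auto simp: absolutely_continuous_def)
    with False show ?thesis by (simp add: rel_entropy_def)
  next
    case True
    then have "absolutely_continuous ?P' Q"
      using acs by (auto simp: absolutely_continuous_def)
    then obtain g :: "_ \<Rightarrow> real" where g[measurable]: "g \<in> borel_measurable ?P'"
        and gnn: "\<And>x. 0 \<le> g x" and Qg: "Q = density ?P' g"
      using RN_density_real[OF P' Q] sQ by auto
    have [measurable]: "g \<in> borel_measurable P" using g by simp
    have Qf: "Q = density P (\<lambda>x. r (T x) * g x)"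
      unfolding Qg using pos
      by (subst density_density_eq) (auto simp: ennreal_mult' less_imp_le)
    have mQ[measurable]: "g \<in> borel_measurable Q"
      using g sQ by (simp cong: measurable_cong_sets)
    have fnn: "0 \<le> r (T x) * g x" for x using pos gnn by (simp add: less_imp_le)
    have gpos: "AE x in Q. 0 < g x"
    proof -
      have "AE x in density ?P' g. 0 < g x"
        using gnn by (subst AE_density) auto
      then show ?thesis by (simp only: Qg[symmetric])
    qed
    have lnf: "AE x in Q. ln (r (T x) * g x) = ln (g x) + ln (r (T x))"
      using gpos
    proof eventually_elim
      case (elim x)
      then show ?case using pos[of "T x"] by (simp add: ln_mult)
    qed
    let ?A = "integrable Q (\<lambda>x. ln (r (T x) * g x))"
    let ?B = "integrable Q (\<lambda>x. ln (g x))"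
    let ?C = "integrable Q (\<lambda>x. ln (r (T x)))"
    have n1: "integrable Q (\<lambda>x. min 0 (ln (g x)))"
      using integrable_neg_part_ln_density[OF P' g gnn] by (simp add: Qg[symmetric])
    have "integrable (distr Q N T) (\<lambda>y. min 0 (ln (r y)))"
      unfolding marg by (intro integrable_neg_part_ln_density PT.prob_space_axioms) (auto simp: pos less_imp_le)
    then have n2: "integrable Q (\<lambda>x. min 0 (ln (r (T x))))"
      by (subst (asm) integrable_distr_eq) auto
    have BC: "?B \<and> ?C" if A: "?A"
    proof
      show ?B
      proof (rule Bochner_Integration.integrable_bound)
        show "integrable Q (\<lambda>x. \<bar>ln (r (T x) * g x)\<bar> + \<bar>min 0 (ln (r (T x)))\<bar> + \<bar>min 0 (ln (g x))\<bar>)"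
          using A n1 n2 by (intro Bochner_Integration.integrable_add integrable_abs)
        show "AE x in Q. norm (ln (g x))
            \<le> norm (\<bar>ln (r (T x) * g x)\<bar> + \<bar>min 0 (ln (r (T x)))\<bar> + \<bar>min 0 (ln (g x))\<bar>)"
          using lnf by eventually_elim (auto simp: min_def abs_if)
      qed simp
      show ?C
      proof (rule Bochner_Integration.integrable_bound)
        show "integrable Q (\<lambda>x. \<bar>ln (r (T x) * g x)\<bar> + \<bar>min 0 (ln (r (T x)))\<bar> + \<bar>min 0 (ln (g x))\<bar>)"
          using A n1 n2 by (intro Bochner_Integration.integrable_add integrable_abs)
        show "AE x in Q. norm (ln (r (T x)))
            \<le> norm (\<bar>ln (r (T x) * g x)\<bar> + \<bar>min 0 (ln (r (T x)))\<bar> + \<bar>min 0 (ln (g x))\<bar>)"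
          using lnf by eventually_elim (auto simp: min_def abs_if)
      qed simp
    qed
    have A: "?A" if "?B" "?C"
    proof -
      have "integrable Q (\<lambda>x. ln (g x) + ln (r (T x)))" using that by auto
      then show ?thesis using lnf by (subst integrable_cong_AE) auto
    qed
    have hP: "rel_entropy Q P = (if ?A then ennreal (\<integral>x. ln (r (T x) * g x) \<partial>Q) else \<infinity>)"
      using rel_entropy_eq_integral_ln[OF P, of "\<lambda>x. r (T x) * g x"] fnn
      by (simp add: Qf[symmetric])
    have hP': "rel_entropy Q ?P' = (if ?B then ennreal (\<integral>x. ln (g x) \<partial>Q) else \<infinity>)"
      using rel_entropy_eq_integral_ln[OF P' g gnn] by (simp add: Qg[symmetric])
    have hT: "rel_entropy (distr Q N T) (distr P N T)
        = (if ?C then ennreal (\<integral>x. ln (r (T x)) \<partial>Q) else \<infinity>)"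
      using rel_entropy_eq_integral_ln[OF PT.prob_space_axioms, of r] pos
      by (simp add: marg[symmetric] less_imp_le integrable_distr_eq integral_distr)
    have nonneg: "0 \<le> (\<integral>x. ln (g x) \<partial>Q)" if "?B"
      using integral_ln_density_nonneg[OF P' g gnn] that Q by (simp add: Qg[symmetric])
    have nonneg2: "0 \<le> (\<integral>x. ln (r (T x)) \<partial>Q)" if "?C"
      using integral_ln_density_nonneg[OF PT.prob_space_axioms, of r] that pos
      by (simp add: marg[symmetric] less_imp_le integrable_distr_eq integral_distr QT.prob_space_axioms)
    show ?thesis
    proof (cases "?B \<and> ?C")
      case True
      then have "(\<integral>x. ln (r (T x) * g x) \<partial>Q) = (\<integral>x. ln (g x) + ln (r (T x)) \<partial>Q)"
        using lnf by (intro integral_cong_AE) auto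
      also have "\<dots> = (\<integral>x. ln (g x) \<partial>Q) + (\<integral>x. ln (r (T x)) \<partial>Q)"
        using True by simp
      finally show ?thesis
        using True A nonneg nonneg2 by (simp add: hP hP' hT ennreal_plus)
    next
      case False
      then have "\<not> ?A" using BC by blast
      then show ?thesis using False by (auto simp: hP hP' hT)
    qed
  qed
qed

section \<open>Kernels with continuous log-densities\<close>

lemma fst_borel_measurable[measurable]:
    "fst \<in> (borel :: ('a::topological_space \<times> 'b::topological_space) measure) \<rightarrow>\<^sub>M borel"
  and snd_borel_measurable[measurable]:
    "snd \<in> (borel :: ('a::topological_space \<times> 'b::topological_space) measure) \<rightarrow>\<^sub>M borel"
  by (intro borel_measurable_continuous_onI continuous_intros)+

lemma swap_borel_measurable[measurable]:
  "prod.swap \<in> (borel :: ('a::topological_space \<times> 'b::topological_space) measure) \<rightarrow>\<^sub>M borel"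
  unfolding prod.swap_def by (intro borel_measurable_continuous_onI continuous_intros)

lemma sets_gibbs[simp, measurable_cong]: "sets (gibbs U) = sets borel"
  by (simp add: gibbs_def)

lemma space_gibbs[simp]: "space (gibbs U) = UNIV"
  by (simp add: gibbs_def)

text \<open>The set where two continuous functions differ is open, hence not a null set unless it is empty.
This upgrades almost sure identities between smooth densities to pointwise ones.\<close>

lemma AE_lborel_continuous_eq:
  fixes f g :: "'a::euclidean_space \<Rightarrow> real"
  assumes "continuous_on UNIV f" "continuous_on UNIV g" and ae: "AE x in lborel. f x = g x"
  shows "f x = g x"
proof (rule ccontr)
  assume ne: "f x \<noteq> g x"
  have op: "open {x. f x \<noteq> g x}"
    using assms by (intro open_Collect_neq)
  then have "{x. f x \<noteq> g x} \<in> null_sets lborel"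
    using ae by (subst AE_iff_null_sets) (auto simp: borel_open)
  then have "negligible {x. f x \<noteq> g x}"
    by (simp add: negligible_iff_null_sets null_sets_completionI)
  with op ne show False
    using open_not_negligible by blast
qed

lemma kernel_prob_space: "markov_kernel K \<Longrightarrow> prob_space (K x)"
  and kernel_sets: "markov_kernel K \<Longrightarrow> sets (K x) = sets borel"
  using measurable_space[of K borel "prob_algebra borel" x]
  by (auto simp: markov_kernel_def space_prob_algebra)

lemma kernel_subprob: "markov_kernel K \<Longrightarrow> K \<in> borel \<rightarrow>\<^sub>M subprob_algebra borel"
  by (simp add: markov_kernel_def measurable_prob_algebraD)

lemma kprod_kernel_measurable:
  assumes "markov_kernel K"
  shows "(\<lambda>x. distr (K x) borel (\<lambda>y. (x, y))) \<in> borel \<rightarrow>\<^sub>M subprob_algebra borel"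
  by (rule measurable_distr2[OF _ kernel_subprob[OF assms]]) (simp add: borel_prod)

lemma sets_kprod: "sets \<mu> = sets borel \<Longrightarrow> sets (kprod \<mu> K) = sets borel"
  unfolding kprod_def by (subst sets_bind[where N=borel]) (auto dest: sets_eq_imp_space_eq)

lemma nn_integral_kprod:
  fixes K :: "real^'d \<Rightarrow> (real^'d) measure"
  assumes "markov_kernel K" "sets \<mu> = sets borel" and [measurable]: "f \<in> borel_measurable borel"
  shows "(\<integral>\<^sup>+z. f z \<partial>kprod \<mu> K) = (\<integral>\<^sup>+x. \<integral>\<^sup>+y. f (x, y) \<partial>K x \<partial>\<mu>)"
proof -
  note [simp] = kernel_sets[OF assms(1)] and [measurable_cong] = kernel_sets[OF assms(1)]
  have "(\<lambda>x. distr (K x) borel (\<lambda>y. (x, y))) \<in> \<mu> \<rightarrow>\<^sub>M subprob_algebra borel"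
    using kprod_kernel_measurable[OF assms(1)] assms(2) by (simp cong: measurable_cong_sets)
  then have "(\<integral>\<^sup>+z. f z \<partial>kprod \<mu> K) = (\<integral>\<^sup>+x. \<integral>\<^sup>+z. f z \<partial>distr (K x) borel (\<lambda>y. (x, y)) \<partial>\<mu>)"
    unfolding kprod_def by (intro nn_integral_bind) auto
  also have "\<dots> = (\<integral>\<^sup>+x. \<integral>\<^sup>+y. f (x, y) \<partial>K x \<partial>\<mu>)"
  proof (intro nn_integral_cong nn_integral_distr)
    fix x :: "real^'d"
    have "Pair x \<in> borel \<rightarrow>\<^sub>M borel"
      by (intro borel_measurable_continuous_onI continuous_intros)
    then show "Pair x \<in> K x \<rightarrow>\<^sub>M borel"
      by (simp cong: measurable_cong_sets)
  qed auto
  finally show ?thesis .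
qed

lemma emeasure_bind_kernel:
  assumes "markov_kernel K" "sets \<mu> = sets borel" "A \<in> sets borel"
  shows "emeasure (\<mu> \<bind> K) A = (\<integral>\<^sup>+x. emeasure (K x) A \<partial>\<mu>)"
  using assms kernel_subprob[OF assms(1)] sets_eq_imp_space_eq[OF assms(2)]
  by (intro emeasure_bind) (auto cong: measurable_cong_sets)

lemma sets_bind_kernel:
  "markov_kernel K \<Longrightarrow> sets \<mu> = sets borel \<Longrightarrow> sets (\<mu> \<bind> K) = sets borel"
  by (subst sets_bind[where N=borel]) (auto simp: kernel_sets dest: sets_eq_imp_space_eq)

lemma distr_kprod_fst:
  assumes "markov_kernel K" "sets \<mu> = sets borel"
  shows "distr (kprod \<mu> K) borel fst = \<mu>"
proof (rule measure_eqI)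
  note [measurable_cong] = sets_kprod[OF assms(2)]
  fix A assume "A \<in> sets (distr (kprod \<mu> K) borel fst)"
  then have A[measurable]: "A \<in> sets borel" by simp
  have "emeasure (distr (kprod \<mu> K) borel fst) A
      = (\<integral>\<^sup>+a. indicator A a \<partial>distr (kprod \<mu> K) borel fst)"
    by simp
  also have "\<dots> = (\<integral>\<^sup>+z. indicator A (fst z) \<partial>kprod \<mu> K)"
    by (subst nn_integral_distr) auto
  also have "\<dots> = (\<integral>\<^sup>+x. indicator A x \<partial>\<mu>)"
    using assms kernel_prob_space[OF assms(1), THEN prob_space.emeasure_space_1]
    by (subst nn_integral_kprod) auto
  also have "\<dots> = emeasure \<mu> A"
    using assms by simp
  finally show "emeasure (distr (kprod \<mu> K) borel fst) A = emeasure \<mu> A" .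
qed (simp add: assms)

lemma distr_kprod_snd:
  assumes "markov_kernel K" "sets \<mu> = sets borel"
  shows "distr (kprod \<mu> K) borel snd = \<mu> \<bind> K"
proof (rule measure_eqI)
  note [measurable_cong] = sets_kprod[OF assms(2)]
  fix A assume "A \<in> sets (distr (kprod \<mu> K) borel snd)"
  then have A[measurable]: "A \<in> sets borel" by simp
  have "emeasure (distr (kprod \<mu> K) borel snd) A
      = (\<integral>\<^sup>+a. indicator A a \<partial>distr (kprod \<mu> K) borel snd)"
    by simp
  also have "\<dots> = (\<integral>\<^sup>+z. indicator A (snd z) \<partial>kprod \<mu> K)"
    by (subst nn_integral_distr) auto
  also have "\<dots> = (\<integral>\<^sup>+x. emeasure (K x) A \<partial>\<mu>)"
    using assms by (subst nn_integral_kprod) (auto simp: kernel_sets)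
  also have "\<dots> = emeasure (\<mu> \<bind> K) A"
    using assms by (simp add: emeasure_bind_kernel)
  finally show "emeasure (distr (kprod \<mu> K) borel snd) A = emeasure (\<mu> \<bind> K) A" .
qed (simp add: assms sets_bind_kernel)

lemma prob_space_kprod:
  assumes "prob_space \<mu>" "markov_kernel K" "sets \<mu> = sets borel"
  shows "prob_space (kprod \<mu> K)"
proof
  have "emeasure (kprod \<mu> K) (space (kprod \<mu> K)) = (\<integral>\<^sup>+z. 1 \<partial>kprod \<mu> K)" by simp
  also have "\<dots> = (\<integral>\<^sup>+x. \<integral>\<^sup>+y. 1 \<partial>K x \<partial>\<mu>)"
    using assms by (subst nn_integral_kprod) auto
  also have "\<dots> = 1"
    using assms kernel_prob_space[OF assms(2), THEN prob_space.emeasure_space_1]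
    by (simp add: prob_space.emeasure_space_1)
  finally show "emeasure (kprod \<mu> K) (space (kprod \<mu> K)) = 1" .
qed

lemma sets_swap_measure[simp, measurable_cong]: "sets (swap_measure Q) = sets borel"
  by (simp add: swap_measure_def)

lemma swap_swap_measure:
  assumes [measurable_cong]: "sets Q = sets borel"
  shows "swap_measure (swap_measure Q) = Q"
proof -
  have "swap_measure (swap_measure Q) = distr Q borel (prod.swap \<circ> prod.swap)"
    unfolding swap_measure_def by (intro distr_distr) auto
  also have "\<dots> = distr Q Q (\<lambda>x. x)"
    using assms by (intro distr_cong) auto
  finally show ?thesis by simp
qed

lemma distr_swap_fst:
  assumes [measurable_cong]: "sets Q = sets borel"
  shows "distr (swap_measure Q) borel fst = distr Q borel snd"
  unfolding swap_measure_def by (subst distr_distr) (auto intro!: distr_cong)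

lemma distr_swap_snd:
  assumes [measurable_cong]: "sets Q = sets borel"
  shows "distr (swap_measure Q) borel snd = distr Q borel fst"
  unfolding swap_measure_def by (subst distr_distr) (auto intro!: distr_cong)

lemma prob_space_swap_measure:
  assumes [measurable_cong]: "sets Q = sets borel" and "prob_space Q"
  shows "prob_space (swap_measure Q)"
  unfolding swap_measure_def by (rule prob_space.prob_space_distr[OF assms(2)]) measurable

definition joint_gibbs :: "((real^'d) \<times> (real^'d) \<Rightarrow> real) \<Rightarrow> ((real^'d) \<times> (real^'d)) measure" where
  "joint_gibbs h = density lborel (\<lambda>z. ennreal (exp (- h z)))"

lemma sets_joint_gibbs[simp, measurable_cong]: "sets (joint_gibbs h) = sets borel"
  by (simp add: joint_gibbs_def)

lemma density_joint_gibbs: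
  assumes [measurable]: "h \<in> borel_measurable borel" "r \<in> borel_measurable borel"
  shows "density (joint_gibbs h) (\<lambda>z. ennreal (exp (r z))) = joint_gibbs (\<lambda>z. h z - r z)"
  unfolding joint_gibbs_def
  by (subst density_density_eq) (auto simp: ennreal_mult'[symmetric] exp_add[symmetric] intro!: density_cong)

lemma density_gibbs:
  assumes [measurable]: "h \<in> borel_measurable borel" "r \<in> borel_measurable borel"
  shows "density (gibbs h) (\<lambda>z. ennreal (exp (r z))) = gibbs (\<lambda>z. h z - r z)"
  unfolding gibbs_def
  by (subst density_density_eq) (auto simp: ennreal_mult'[symmetric] exp_add[symmetric] intro!: density_cong)

lemma nn_integral_lborel_pair:
  assumes [measurable]: "f \<in> borel_measurable (borel :: ('a::euclidean_space \<times> 'b::euclidean_space) measure)"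
  shows "(\<integral>\<^sup>+z. f z \<partial>lborel) = (\<integral>\<^sup>+x. \<integral>\<^sup>+y. f (x, y) \<partial>lborel \<partial>lborel)"
    and "(\<integral>\<^sup>+z. f z \<partial>lborel) = (\<integral>\<^sup>+y. \<integral>\<^sup>+x. f (x, y) \<partial>lborel \<partial>lborel)"
proof -
  have f: "f \<in> borel_measurable (lborel \<Otimes>\<^sub>M lborel)"
    by (simp add: lborel_prod)
  show "(\<integral>\<^sup>+z. f z \<partial>lborel) = (\<integral>\<^sup>+x. \<integral>\<^sup>+y. f (x, y) \<partial>lborel \<partial>lborel)"
    unfolding lborel_prod[symmetric] by (rule lborel.nn_integral_fst[OF f, symmetric])
  show "(\<integral>\<^sup>+z. f z \<partial>lborel) = (\<integral>\<^sup>+y. \<integral>\<^sup>+x. f (x, y) \<partial>lborel \<partial>lborel)"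
    unfolding lborel_prod[symmetric] by (rule lborel_pair.nn_integral_snd[OF f, symmetric])
qed

lemma continuous_on_section:
  fixes w :: "'a::topological_space \<Rightarrow> 'b::topological_space \<Rightarrow> 'c::topological_space"
  assumes "continuous_on UNIV (\<lambda>z. w (fst z) (snd z))"
    and "continuous_on S f" "continuous_on S g"
  shows "continuous_on S (\<lambda>x. w (f x) (g x))"
  using continuous_on_compose2[OF assms(1) continuous_on_Pair[OF assms(2,3)]] by simp

lemma kprod_gibbs:
  assumes U: "continuous_on UNIV U" and w: "continuous_on UNIV (\<lambda>z. w (fst z) (snd z))"
    and K: "markov_kernel (\<lambda>x. gibbs (w x))"
  shows "kprod (gibbs U) (\<lambda>x. gibbs (w x)) = joint_gibbs (\<lambda>z. U (fst z) + w (fst z) (snd z))"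
proof (rule measure_eqI)
  let ?h = "\<lambda>z. U (fst z) + w (fst z) (snd z)"
  have h[measurable]: "?h \<in> borel_measurable borel"
    by (intro borel_measurable_continuous_onI continuous_intros w continuous_on_compose2[OF U]) auto
  have [measurable]: "U \<in> borel_measurable borel" "w x \<in> borel_measurable borel" for x
    using U continuous_on_section[OF w, of UNIV "\<lambda>_. x" "\<lambda>y. y"]
    by (auto intro!: borel_measurable_continuous_onI)
  fix A assume "A \<in> sets (kprod (gibbs U) (\<lambda>x. gibbs (w x)))"
  then have A[measurable]: "A \<in> sets borel" by (simp add: sets_kprod)
  have m1: "(\<lambda>y. indicator A (x, y) :: ennreal) \<in> borel_measurable borel" for x
    by (intro measurable_compose[OF _ borel_measurable_indicator[OF A]] borel_measurable_continuous_onI continuous_intros)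
  note m1[measurable]
  have [measurable]: "(\<lambda>x. w (fst x) (snd x)) \<in> borel_measurable (borel \<Otimes>\<^sub>M borel)"
    unfolding borel_prod by (intro borel_measurable_continuous_onI w)
  then have [measurable]: "(\<lambda>x. w (fst x) (snd x)) \<in> borel_measurable borel"
    unfolding borel_prod .
  have A'[measurable]: "A \<in> sets (borel \<Otimes>\<^sub>M borel)" unfolding borel_prod by (rule A)
  have m2: "(\<lambda>x. \<integral>\<^sup>+y. ennreal (exp (- w x y)) * indicator A (x, y) \<partial>lborel) \<in> borel_measurable borel"
  proof (rule lborel.borel_measurable_nn_integral)
    have "(\<lambda>z. ennreal (exp (- w (fst z) (snd z))) * indicator A z) \<in> borel_measurable (borel \<Otimes>\<^sub>M borel)"
      by measurable
    then show "(\<lambda>(x, y). ennreal (exp (- w x y)) * indicator A (x, y)) \<in> borel_measurable (borel \<Otimes>\<^sub>M lborel)"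
      by (simp add: case_prod_beta' cong: measurable_cong_sets sets_pair_measure_cong)
  qed
  have "emeasure (kprod (gibbs U) (\<lambda>x. gibbs (w x))) A
      = (\<integral>\<^sup>+z. indicator A z \<partial>kprod (gibbs U) (\<lambda>x. gibbs (w x)))"
    by (subst nn_integral_indicator) (auto simp: sets_kprod)
  also have "\<dots> = (\<integral>\<^sup>+x. \<integral>\<^sup>+y. indicator A (x, y) \<partial>gibbs (w x) \<partial>gibbs U)"
    by (rule nn_integral_kprod) (auto simp: K)
  also have "\<dots> = (\<integral>\<^sup>+x. \<integral>\<^sup>+y. ennreal (exp (- w x y)) * indicator A (x, y) \<partial>lborel \<partial>gibbs U)"
    unfolding gibbs_def[of "w _"] by (subst nn_integral_density) auto
  also have "\<dots> = (\<integral>\<^sup>+x. ennreal (exp (- U x)) *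
      (\<integral>\<^sup>+y. ennreal (exp (- w x y)) * indicator A (x, y) \<partial>lborel) \<partial>lborel)"
    unfolding gibbs_def[of U] using m2 by (subst nn_integral_density) auto
  also have "\<dots> = (\<integral>\<^sup>+x. (\<integral>\<^sup>+y. ennreal (exp (- ?h (x, y))) * indicator A (x, y) \<partial>lborel) \<partial>lborel)"
    by (subst nn_integral_cmult[symmetric])
      (simp_all add: mult.assoc[symmetric] ennreal_mult'[symmetric] exp_add[symmetric] algebra_simps)
  also have "\<dots> = (\<integral>\<^sup>+z. ennreal (exp (- ?h z)) * indicator A z \<partial>lborel)"
    by (subst nn_integral_lborel_pair(1)) auto
  also have "\<dots> = emeasure (joint_gibbs ?h) A"
    unfolding joint_gibbs_def by (subst emeasure_density) auto
  finally show "emeasure (kprod (gibbs U) (\<lambda>x. gibbs (w x))) A = emeasure (joint_gibbs ?h) A" .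
qed (simp add: sets_kprod)

lemma continuous_on_swap_args:
  fixes w :: "'a::topological_space \<Rightarrow> 'b::topological_space \<Rightarrow> 'c::topological_space"
  assumes "continuous_on UNIV (\<lambda>z. w (fst z) (snd z))"
  shows "continuous_on UNIV (\<lambda>z. w (snd z) (fst z))"
  using assms by (rule continuous_on_section) (intro continuous_intros)+

text \<open>Comparing densities of the two sides of the disintegration gives
\<open>exp (- U x - w x y) = p y * exp (- w' y x)\<close> for almost all pairs, with \<open>p\<close> the density of the marginal.
For almost every \<open>y\<close> continuity in \<open>x\<close> turns this into an identity for all \<open>x\<close>; in particular \<open>p y\<close> is
positive and finite, and its logarithm can be read off at \<open>x = 0\<close>. The resulting potential \<open>a\<close> is
continuous, so the identity extends to all \<open>y\<close> as well.\<close>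

lemma gibbs_disintegration:
  fixes U :: "real^'d \<Rightarrow> real" and w w' :: "real^'d \<Rightarrow> real^'d \<Rightarrow> real"
  assumes U: "continuous_on UNIV U" and w: "continuous_on UNIV (\<lambda>z. w (fst z) (snd z))"
    and w': "continuous_on UNIV (\<lambda>z. w' (fst z) (snd z))"
    and prob: "prob_space (gibbs U)"
    and K: "markov_kernel (\<lambda>x. gibbs (w x))" and K': "markov_kernel (\<lambda>x. gibbs (w' x))"
    and eq: "kprod (gibbs U) (\<lambda>x. gibbs (w x)) =
      swap_measure (kprod (gibbs U \<bind> (\<lambda>x. gibbs (w x))) (\<lambda>y. gibbs (w' y)))"
  obtains a where "continuous_on UNIV a" "gibbs U \<bind> (\<lambda>x. gibbs (w x)) = gibbs a"
    "\<And>x y. U x + w x y = a y + w' y x"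
proof -
  let ?\<pi> = "gibbs U \<bind> (\<lambda>x. gibbs (w x))"
  let ?h = "\<lambda>z. U (fst z) + w (fst z) (snd z)"
  have s\<pi>: "sets ?\<pi> = sets borel" by (rule sets_bind_kernel[OF K]) simp
  have h[measurable]: "?h \<in> borel_measurable borel"
    by (intro borel_measurable_continuous_onI continuous_intros w continuous_on_compose2[OF U]) auto
  have U_m[measurable]: "U \<in> borel_measurable borel"
    using U by (auto intro!: borel_measurable_continuous_onI)
  have w'_m[measurable]: "w' y \<in> borel_measurable borel" for y
    using continuous_on_section[OF w', of UNIV "\<lambda>_. y" "\<lambda>y. y"]
    by (auto intro!: borel_measurable_continuous_onI)
  have w2[measurable]: "(\<lambda>z. w (fst z) (snd z)) \<in> borel_measurable borel"
    using w by (auto intro!: borel_measurable_continuous_onI)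
  have w'2[measurable]: "(\<lambda>z. w' (snd z) (fst z)) \<in> borel_measurable borel"
    using continuous_on_swap_args[OF w'] by (auto intro!: borel_measurable_continuous_onI)
  define p where "p y = (\<integral>\<^sup>+x. ennreal (exp (- ?h (x, y))) \<partial>lborel)" for y
  have "(\<lambda>(y, x). ennreal (exp (- ?h (x, y)))) \<in> borel_measurable (borel \<Otimes>\<^sub>M lborel)"
  proof -
    have "(\<lambda>z. ?h (snd z, fst z)) \<in> borel_measurable (borel \<Otimes>\<^sub>M borel)"
      unfolding borel_prod using continuous_on_swap_args[OF w]
      by (auto intro!: borel_measurable_continuous_onI continuous_intros continuous_on_compose2[OF U])
    then have "(\<lambda>z. ennreal (exp (- ?h (snd z, fst z)))) \<in> borel_measurable (borel \<Otimes>\<^sub>M borel)"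
      by measurable
    then show ?thesis
      by (simp add: case_prod_beta' cong: measurable_cong_sets sets_pair_measure_cong)
  qed
  then have p[measurable]: "p \<in> borel_measurable borel"
    unfolding p_def by (rule lborel.borel_measurable_nn_integral)
  have pi_int: "(\<integral>\<^sup>+y. f y \<partial>?\<pi>) = (\<integral>\<^sup>+y. p y * f y \<partial>lborel)"
    if [measurable]: "f \<in> borel_measurable borel" for f :: "real^'d \<Rightarrow> ennreal"
  proof -
    note [measurable_cong] = sets_kprod[OF sets_gibbs]
    have "(\<integral>\<^sup>+y. f y \<partial>?\<pi>) = (\<integral>\<^sup>+y. f y \<partial>distr (kprod (gibbs U) (\<lambda>x. gibbs (w x))) borel snd)"
      by (subst distr_kprod_snd) (auto simp: K)
    also have "\<dots> = (\<integral>\<^sup>+z. f (snd z) \<partial>kprod (gibbs U) (\<lambda>x. gibbs (w x)))"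
      by (subst nn_integral_distr) auto
    also have "\<dots> = (\<integral>\<^sup>+z. ennreal (exp (- ?h z)) * f (snd z) \<partial>lborel)"
      unfolding kprod_gibbs[OF U w K] joint_gibbs_def by (subst nn_integral_density) auto
    also have "\<dots> = (\<integral>\<^sup>+y. \<integral>\<^sup>+x. ennreal (exp (- ?h (x, y))) * f y \<partial>lborel \<partial>lborel)"
      by (subst nn_integral_lborel_pair(2)) auto
    also have "\<dots> = (\<integral>\<^sup>+y. p y * f y \<partial>lborel)"
    proof (intro nn_integral_cong)
      fix y
      have "(\<lambda>x. exp (- ?h (x, y))) \<in> borel_measurable borel"
        using continuous_on_section[OF w, of UNIV "\<lambda>x. x" "\<lambda>_. y"]
        by (auto intro!: borel_measurable_continuous_onI continuous_intros U)
      then show "(\<integral>\<^sup>+x. ennreal (exp (- ?h (x, y))) * f y \<partial>lborel) = p y * f y"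
        unfolding p_def by (intro nn_integral_multc) auto
    qed
    finally show ?thesis .
  qed
  have "density lborel (\<lambda>z. ennreal (exp (- ?h z))) =
      density lborel (\<lambda>z. p (snd z) * ennreal (exp (- w' (snd z) (fst z))))" (is "?L = ?R")
  proof (rule measure_eqI)
    fix A assume "A \<in> sets ?L"
    then have A[measurable]: "A \<in> sets borel" by simp
    have [measurable]: "A \<in> sets (borel \<Otimes>\<^sub>M borel)" unfolding borel_prod by (rule A)
    have m1[measurable]: "(\<lambda>x. indicator A (x, y) :: ennreal) \<in> borel_measurable borel" for y
      by (intro measurable_compose[OF _ borel_measurable_indicator[OF A]] borel_measurable_continuous_onI continuous_intros)
    have m2[measurable]: "(\<lambda>y. \<integral>\<^sup>+x. ennreal (exp (- w' y x)) * indicator A (x, y) \<partial>lborel) \<in> borel_measurable borel"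
    proof (rule lborel.borel_measurable_nn_integral)
      have [measurable]: "(\<lambda>z. w' (fst z) (snd z)) \<in> borel_measurable (borel \<Otimes>\<^sub>M borel)"
        unfolding borel_prod using w' by (auto intro!: borel_measurable_continuous_onI)
      have [measurable]: "(\<lambda>z. indicator A (snd z, fst z) :: ennreal) \<in> borel_measurable (borel \<Otimes>\<^sub>M borel)"
        by measurable
      have "(\<lambda>z. ennreal (exp (- w' (fst z) (snd z))) * indicator A (snd z, fst z)) \<in> borel_measurable (borel \<Otimes>\<^sub>M borel)"
        by measurable
      then show "(\<lambda>(y, x). ennreal (exp (- w' y x)) * indicator A (x, y)) \<in> borel_measurable (borel \<Otimes>\<^sub>M lborel)"
        by (simp add: case_prod_beta' cong: measurable_cong_sets sets_pair_measure_cong)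
    qed
    note [measurable_cong] = sets_kprod[OF s\<pi>]
    have "emeasure ?L A = emeasure (swap_measure (kprod ?\<pi> (\<lambda>y. gibbs (w' y)))) A"
      unfolding eq[symmetric] kprod_gibbs[OF U w K] joint_gibbs_def ..
    also have "\<dots> = (\<integral>\<^sup>+z. indicator A z \<partial>swap_measure (kprod ?\<pi> (\<lambda>y. gibbs (w' y))))"
      by simp
    also have "\<dots> = (\<integral>\<^sup>+z. indicator A (snd z, fst z) \<partial>kprod ?\<pi> (\<lambda>y. gibbs (w' y)))"
      unfolding swap_measure_def by (subst nn_integral_distr) (auto simp: prod.swap_def)
    also have "\<dots> = (\<integral>\<^sup>+y. \<integral>\<^sup>+x. indicator A (x, y) \<partial>gibbs (w' y) \<partial>?\<pi>)"
      by (subst nn_integral_kprod[OF K' s\<pi>]) (auto simp: borel_prod[symmetric])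
    also have "\<dots> = (\<integral>\<^sup>+y. \<integral>\<^sup>+x. ennreal (exp (- w' y x)) * indicator A (x, y) \<partial>lborel \<partial>?\<pi>)"
      unfolding gibbs_def[of "w' _"] by (subst nn_integral_density) auto
    also have "\<dots> = (\<integral>\<^sup>+y. p y * (\<integral>\<^sup>+x. ennreal (exp (- w' y x)) * indicator A (x, y) \<partial>lborel) \<partial>lborel)"
      by (subst pi_int) auto
    also have "\<dots> = (\<integral>\<^sup>+y. \<integral>\<^sup>+x. p y * ennreal (exp (- w' y x)) * indicator A (x, y) \<partial>lborel \<partial>lborel)"
      by (subst nn_integral_cmult[symmetric]) (auto simp: mult.assoc)
    also have "\<dots> = (\<integral>\<^sup>+z. p (snd z) * ennreal (exp (- w' (snd z) (fst z))) * indicator A z \<partial>lborel)"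
      by (subst nn_integral_lborel_pair(2)) auto
    also have "\<dots> = emeasure ?R A"
      by (subst emeasure_density) auto
    finally show "emeasure ?L A = emeasure ?R A" .
  qed simp
  then have "AE z in lborel. ennreal (exp (- ?h z)) = p (snd z) * ennreal (exp (- w' (snd z) (fst z)))"
    by (subst (asm) sigma_finite_measure.density_unique_iff[OF sigma_finite_lborel]) auto
  then have "AE z in lborel \<Otimes>\<^sub>M lborel.
      ennreal (exp (- ?h z)) = p (snd z) * ennreal (exp (- w' (snd z) (fst z)))"
    by (simp only: lborel_prod)
  from lborel_pair.AE_pair[OF this] have "AE x in lborel. AE y in lborel.
      ennreal (exp (- (U x + w x y))) = p y * ennreal (exp (- w' y x))"
    by simp
  moreover have "{z \<in> space (lborel \<Otimes>\<^sub>M lborel). ennreal (exp (- (U (fst z) + w (fst z) (snd z))))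
      = p (snd z) * ennreal (exp (- w' (snd z) (fst z)))} \<in> sets (lborel \<Otimes>\<^sub>M lborel)"
  proof -
    have "Measurable.pred borel
       (\<lambda>z. ennreal (exp (- ?h z)) = p (snd z) * ennreal (exp (- w' (snd z) (fst z))))"
      by measurable
    then show ?thesis
      unfolding lborel_prod by (simp add: pred_def)
  qed
  ultimately have ae: "AE y in lborel. AE x in lborel.
      ennreal (exp (- (U x + w x y))) = p y * ennreal (exp (- w' y x))"
    by (subst (asm) lborel_pair.AE_commute) auto
  \<comment> \<open>The value at 0 determines the potential of the marginal and makes its continuity visible.\<close>
  define a where "a y = U 0 + w 0 y - w' y 0" for y
  have ac: "continuous_on UNIV a"
    unfolding a_def
    by (intro continuous_intros continuous_on_section[OF w] continuous_on_section[OF w'])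
  have ae2: "AE y in lborel. p y = ennreal (exp (- a y)) \<and> (\<forall>x. U x + w x y = a y + w' y x)"
    using ae
  proof eventually_elim
    case (elim y)
    have "p y \<noteq> \<top>" "p y \<noteq> 0"
    proof -
      have "\<exists>x. ennreal (exp (- (U x + w x y))) = p y * ennreal (exp (- w' y x))"
      proof (rule ccontr)
        assume "\<not> ?thesis"
        then have "AE x in (lborel :: (real^'d) measure). False" using elim by auto
        then show False by (simp add: trivial_limit_def[symmetric] ae_filter_eq_bot_iff)
      qed
      then show "p y \<noteq> \<top>" "p y \<noteq> 0"
        by (auto simp: ennreal_top_mult)
    qed
    then obtain q where q: "p y = ennreal q" "q > 0"
      by (cases "p y") (auto simp: less_le)
    have "AE x in lborel. U x + w x y = - ln q + w' y x"
      using elim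
    proof eventually_elim
      case (elim x)
      then have "exp (- (U x + w x y)) = q * exp (- w' y x)"
        using q by (simp add: ennreal_mult'[symmetric])
      also have "\<dots> = exp (ln q - w' y x)"
        using q by (simp add: exp_diff exp_minus field_simps)
      finally show ?case by simp
    qed
    then have all: "U x + w x y = - ln q + w' y x" for x
      by (intro AE_lborel_continuous_eq)
        (intro continuous_intros U continuous_on_section[OF w] continuous_on_section[OF w'])+
    from all[of 0] have "a y = - ln q" by (simp add: a_def)
    with all q show ?case by simp
  qed
  show ?thesis
  proof
    show "continuous_on UNIV a" by fact
    show "U x + w x y = a y + w' y x" for x y
    proof (rule AE_lborel_continuous_eq[where f="\<lambda>y. U x + w x y" and g="\<lambda>y. a y + w' y x"])
      show "AE y in lborel. U x + w x y = a y + w' y x"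
        using ae2 by eventually_elim auto
    qed (intro continuous_intros ac continuous_on_section[OF w] continuous_on_section[OF w'])+
    show "?\<pi> = gibbs a"
    proof (rule measure_eqI)
      fix A assume "A \<in> sets ?\<pi>"
      then have A[measurable]: "A \<in> sets borel" using s\<pi> by simp
      have [measurable]: "a \<in> borel_measurable borel"
        using ac by (rule borel_measurable_continuous_onI)
      have "emeasure ?\<pi> A = (\<integral>\<^sup>+y. indicator A y \<partial>?\<pi>)"
        using s\<pi> by simp
      also have "\<dots> = (\<integral>\<^sup>+y. p y * indicator A y \<partial>lborel)"
        by (rule pi_int) simp
      also have "\<dots> = (\<integral>\<^sup>+y. ennreal (exp (- a y)) * indicator A y \<partial>lborel)"
        using ae2 by (intro nn_integral_cong_AE) auto
      also have "\<dots> = emeasure (gibbs a) A"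
        unfolding gibbs_def by (subst emeasure_density) auto
      finally show "emeasure ?\<pi> A = emeasure (gibbs a) A" .
    qed (simp add: s\<pi>)
  qed
qed

section \<open>Couplings transported by a kernel\<close>

lemma couplingsD:
  assumes "\<gamma> \<in> couplings \<pi> \<eta>"
  shows "sets \<gamma> = sets borel" "distr \<gamma> borel fst = \<pi>" "distr \<gamma> borel snd = \<eta>"
  using assms by (auto simp: couplings_def)

text \<open>Couplings are only required to have probability measures as marginals; their own total mass is
recovered here.\<close>

lemma prob_space_distrD:
  assumes "prob_space (distr M N f)" "f \<in> M \<rightarrow>\<^sub>M N"
  shows "prob_space M"
proof
  have "emeasure (distr M N f) (space (distr M N f)) = 1"
    using assms(1) by (rule prob_space.emeasure_space_1)
  moreover have "f -` space N \<inter> space M = space M"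
    using measurable_space[OF assms(2)] by auto
  ultimately show "emeasure M (space M) = 1"
    using assms(2) by (simp add: emeasure_distr)
qed

lemma prob_space_coupling:
  assumes "\<gamma> \<in> couplings \<pi> \<eta>" "prob_space \<pi>"
  shows "prob_space \<gamma>"
proof -
  have [measurable_cong]: "sets \<gamma> = sets borel" using couplingsD[OF assms(1)] by simp
  have "prob_space (distr \<gamma> borel fst)" using assms couplingsD[OF assms(1)] by simp
  then show ?thesis by (rule prob_space_distrD) simp
qed

text \<open>The test coupling for the bridge. On triples \<open>((y', y), x)\<close> let \<open>R\<close> and \<open>M\<close> be the laws under which
\<open>(y', y)\<close> has law \<open>\<gamma>\<close> and \<open>x\<close> is drawn from \<open>K y'\<close> and from \<open>K y\<close> respectively. Forgetting \<open>y'\<close> maps \<open>M\<close> to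
the reference law and \<open>R\<close> to a coupling of \<open>\<pi> K\<close> and \<open>\<eta>\<close>; the entropy of \<open>R\<close> relative to \<open>M\<close> is the
\<open>\<gamma>\<close>-average of the entropies of the kernels and can only decrease under this map.\<close>

lemma transported_coupling:
  fixes w :: "real^'d \<Rightarrow> real^'d \<Rightarrow> real"
  defines "K \<equiv> (\<lambda>y. gibbs (w y))"
  assumes w: "continuous_on UNIV (\<lambda>z. w (fst z) (snd z))" and K: "markov_kernel K"
    and \<gamma>: "\<gamma> \<in> couplings \<pi> \<eta>" and "prob_space \<pi>"
    and s\<pi>: "sets \<pi> = sets borel" and s\<eta>: "sets \<eta> = sets borel"
    and G[measurable]: "G \<in> borel_measurable borel"
    and le: "\<And>y' y. rel_entropy (K y') (K y) \<le> G (y', y)"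
  shows "\<exists>Q\<in>couplings (\<pi> \<bind> K) \<eta>. rel_entropy Q (swap_measure (kprod \<eta> K)) \<le> (\<integral>\<^sup>+p. G p \<partial>\<gamma>)"
proof -
  have s\<gamma>: "sets \<gamma> = sets borel" and m1: "distr \<gamma> borel fst = \<pi>" and m2: "distr \<gamma> borel snd = \<eta>"
    using couplingsD[OF \<gamma>] by auto
  note [measurable_cong] = s\<gamma>
  have p\<gamma>: "prob_space \<gamma>" by (rule prob_space_coupling[OF \<gamma>]) fact
  interpret \<gamma>: prob_space \<gamma> by fact
  interpret pair: pair_sigma_finite \<gamma> "lborel :: (real^'d) measure" ..
  have w2[measurable]: "(\<lambda>z. w (fst z) (snd z)) \<in> borel_measurable borel"
    using w by (auto intro!: borel_measurable_continuous_onI)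
  have w1[measurable]: "w y \<in> borel_measurable borel" for y
    using continuous_on_section[OF w, of UNIV "\<lambda>_. y" "\<lambda>y. y"]
    by (auto intro!: borel_measurable_continuous_onI)
  have bp: "sets (\<gamma> \<Otimes>\<^sub>M (lborel :: (real^'d) measure)) = sets borel"
    using sets_pair_measure_cong[OF s\<gamma> sets_lborel] by (simp only: borel_prod)
  let ?L = "\<gamma> \<Otimes>\<^sub>M (lborel :: (real^'d) measure)"
  have [measurable]: "(\<lambda>z. w (snd (fst z)) (snd z)) \<in> borel_measurable ?L"
      "(\<lambda>z. w (fst (fst z)) (snd z)) \<in> borel_measurable ?L"
    unfolding measurable_cong_sets[OF bp refl]
    by (intro borel_measurable_continuous_onI continuous_on_section[OF w] continuous_intros)+
  define T :: "((real^'d) \<times> (real^'d)) \<times> (real^'d) \<Rightarrow> (real^'d) \<times> (real^'d)"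
    where "T z = (snd z, snd (fst z))" for z
  have T[measurable]: "T \<in> ?L \<rightarrow>\<^sub>M borel"
    unfolding measurable_cong_sets[OF bp refl] T_def
    by (intro borel_measurable_continuous_onI continuous_intros)
  define M where "M = density ?L (\<lambda>z. ennreal (exp (- w (snd (fst z)) (snd z))))"
  define R where "R = density ?L (\<lambda>z. ennreal (exp (- w (fst (fst z)) (snd z))))"
  define f where "f z = exp (w (snd (fst z)) (snd z) - w (fst (fst z)) (snd z))" for z
  have [measurable]: "f \<in> borel_measurable ?L" unfolding f_def by measurable
  have fnn: "0 \<le> f z" for z by (simp add: f_def)
  have sM[measurable_cong]: "sets M = sets ?L" and sR[measurable_cong]: "sets R = sets ?L"
    by (auto simp: M_def R_def)
  have Rf: "R = density M f"
    unfolding R_def M_def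
    by (subst density_density_eq)
      (auto simp: f_def ennreal_mult'[symmetric] exp_add[symmetric] intro!: density_cong)
  have intM: "(\<integral>\<^sup>+z. F z \<partial>M) = (\<integral>\<^sup>+p. \<integral>\<^sup>+x. F (p, x) \<partial>K (snd p) \<partial>\<gamma>)"
    if [measurable]: "F \<in> borel_measurable ?L" for F
  proof -
    have "(\<integral>\<^sup>+z. F z \<partial>M) = (\<integral>\<^sup>+z. ennreal (exp (- w (snd (fst z)) (snd z))) * F z \<partial>?L)"
      unfolding M_def by (subst nn_integral_density) auto
    also have "\<dots> = (\<integral>\<^sup>+p. \<integral>\<^sup>+x. ennreal (exp (- w (snd p) x)) * F (p, x) \<partial>lborel \<partial>\<gamma>)"
      by (subst lborel.nn_integral_fst[symmetric]) auto
    also have "\<dots> = (\<integral>\<^sup>+p. \<integral>\<^sup>+x. F (p, x) \<partial>K (snd p) \<partial>\<gamma>)"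
      unfolding K_def gibbs_def by (intro nn_integral_cong, subst nn_integral_density) auto
    finally show ?thesis .
  qed
  have intR: "(\<integral>\<^sup>+z. F z \<partial>R) = (\<integral>\<^sup>+p. \<integral>\<^sup>+x. F (p, x) \<partial>K (fst p) \<partial>\<gamma>)"
    if [measurable]: "F \<in> borel_measurable ?L" for F
  proof -
    have "(\<integral>\<^sup>+z. F z \<partial>R) = (\<integral>\<^sup>+z. ennreal (exp (- w (fst (fst z)) (snd z))) * F z \<partial>?L)"
      unfolding R_def by (subst nn_integral_density) auto
    also have "\<dots> = (\<integral>\<^sup>+p. \<integral>\<^sup>+x. ennreal (exp (- w (fst p) x)) * F (p, x) \<partial>lborel \<partial>\<gamma>)"
      by (subst lborel.nn_integral_fst[symmetric]) auto
    also have "\<dots> = (\<integral>\<^sup>+p. \<integral>\<^sup>+x. F (p, x) \<partial>K (fst p) \<partial>\<gamma>)"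
      unfolding K_def gibbs_def by (intro nn_integral_cong, subst nn_integral_density) auto
    finally show ?thesis .
  qed
  have spK[simp]: "space (K y) = UNIV" and seK[simp]: "sets (K y) = sets borel" for y
    by (auto simp: K_def)
  have K1[simp]: "emeasure (K y) UNIV = 1" for y
    using prob_space.emeasure_space_1[OF kernel_prob_space[OF K, of y]] by (simp add: K_def)
  have pM: "prob_space M" and pR: "prob_space R"
  proof -
    have "(\<integral>\<^sup>+z. 1 \<partial>M) = 1"
      by (subst intM) (auto simp: \<gamma>.emeasure_space_1)
    moreover have "(\<integral>\<^sup>+z. 1 \<partial>R) = 1"
      by (subst intR) (auto simp: \<gamma>.emeasure_space_1)
    ultimately
    show "prob_space M" "prob_space R"
      by (auto intro!: prob_spaceI)
  qed
  let ?Q = "distr R borel T"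
  have sQ: "distr (distr R borel T) borel snd = \<eta>"
  proof (rule measure_eqI)
    fix A assume "A \<in> sets (distr (distr R borel T) borel snd)"
    then have A[measurable]: "A \<in> sets borel" by simp
    have "emeasure (distr (distr R borel T) borel snd) A = (\<integral>\<^sup>+y. indicator A y \<partial>distr (distr R borel T) borel snd)"
      by simp
    also have "\<dots> = (\<integral>\<^sup>+z. indicator A (snd (T z)) \<partial>R)"
      by (simp add: nn_integral_distr del: nn_integral_indicator)
    also have "\<dots> = (\<integral>\<^sup>+p. \<integral>\<^sup>+x. indicator A (snd p) \<partial>K (fst p) \<partial>\<gamma>)"
      by (subst intR) (auto simp: T_def)
    also have "\<dots> = (\<integral>\<^sup>+p. indicator A (snd p) \<partial>\<gamma>)"
      by simp
    also have "\<dots> = (\<integral>\<^sup>+y. indicator A y \<partial>distr \<gamma> borel snd)"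
      by (subst nn_integral_distr) auto
    finally show "emeasure (distr (distr R borel T) borel snd) A = emeasure \<eta> A"
      using A s\<eta> by (simp add: m2)
  qed (simp add: s\<eta>)
  have fQ: "distr (distr R borel T) borel fst = \<pi> \<bind> K"
  proof (rule measure_eqI)
    fix A assume "A \<in> sets (distr (distr R borel T) borel fst)"
    then have A[measurable]: "A \<in> sets borel" by simp
    have Km: "(\<lambda>y. emeasure (K y) A) \<in> borel_measurable borel"
      using kernel_subprob[OF K] by measurable
    have "emeasure (distr (distr R borel T) borel fst) A = (\<integral>\<^sup>+y. indicator A y \<partial>distr (distr R borel T) borel fst)"
      by simp
    also have "\<dots> = (\<integral>\<^sup>+z. indicator A (fst (T z)) \<partial>R)"
      by (simp add: nn_integral_distr del: nn_integral_indicator)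
    also have "\<dots> = (\<integral>\<^sup>+p. \<integral>\<^sup>+x. indicator A x \<partial>K (fst p) \<partial>\<gamma>)"
      by (subst intR) (auto simp: T_def)
    also have "\<dots> = (\<integral>\<^sup>+p. emeasure (K (fst p)) A \<partial>\<gamma>)"
      by (intro nn_integral_cong nn_integral_indicator) (simp add: kernel_sets[OF K])
    also have "\<dots> = (\<integral>\<^sup>+y. emeasure (K y) A \<partial>distr \<gamma> borel fst)"
      using Km by (subst nn_integral_distr) auto
    also have "\<dots> = emeasure (\<pi> \<bind> K) A"
      using A by (simp add: m1 emeasure_bind_kernel[OF K s\<pi>])
    finally show "emeasure (distr (distr R borel T) borel fst) A = emeasure (\<pi> \<bind> K) A" .
  qed (simp add: sets_bind_kernel[OF K s\<pi>])
  have MT: "distr M borel T = swap_measure (kprod \<eta> K)"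
  proof (rule measure_eqI)
    fix A assume "A \<in> sets (distr M borel T)"
    then have A[measurable]: "A \<in> sets borel" by simp
    have [measurable]: "(\<lambda>z. indicator A (snd z, fst z) :: ennreal) \<in> borel_measurable borel"
      by (rule measurable_compose[OF _ borel_measurable_indicator[OF A]])
        (intro borel_measurable_continuous_onI continuous_intros)
    have [measurable]: "(\<lambda>x. indicator A (x, y) :: ennreal) \<in> borel_measurable borel" for y
      by (rule measurable_compose[OF _ borel_measurable_indicator[OF A]])
        (intro borel_measurable_continuous_onI continuous_intros)
    have "(\<lambda>z. ennreal (exp (- w (fst z) (snd z))) * indicator A (snd z, fst z)) \<in> borel_measurable (borel \<Otimes>\<^sub>M borel)"
      unfolding borel_prod by measurable
    then have m: "(\<lambda>y. \<integral>\<^sup>+x. ennreal (exp (- w y x)) * indicator A (x, y) \<partial>lborel) \<in> borel_measurable borel"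
      by (intro lborel.borel_measurable_nn_integral)
        (simp add: case_prod_beta' cong: measurable_cong_sets sets_pair_measure_cong)
    have eqm: "(\<integral>\<^sup>+x. indicator A (x, y) \<partial>K y) = (\<integral>\<^sup>+x. ennreal (exp (- w y x)) * indicator A (x, y) \<partial>lborel)" for y
      unfolding K_def gibbs_def by (subst nn_integral_density) auto
    note [measurable_cong] = sets_kprod[OF s\<eta>, of K]
    have "emeasure (distr M borel T) A = (\<integral>\<^sup>+y. indicator A y \<partial>distr M borel T)"
      by simp
    also have "\<dots> = (\<integral>\<^sup>+z. indicator A (T z) \<partial>M)"
      by (simp add: nn_integral_distr del: nn_integral_indicator)
    also have "\<dots> = (\<integral>\<^sup>+p. \<integral>\<^sup>+x. indicator A (x, snd p) \<partial>K (snd p) \<partial>\<gamma>)"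
      by (subst intM) (auto simp: T_def)
    also have "\<dots> = (\<integral>\<^sup>+y. \<integral>\<^sup>+x. indicator A (x, y) \<partial>K y \<partial>distr \<gamma> borel snd)"
      unfolding eqm using m by (subst nn_integral_distr) auto
    also have "\<dots> = (\<integral>\<^sup>+z. indicator A (snd z, fst z) \<partial>kprod \<eta> K)"
      unfolding m2 by (subst nn_integral_kprod[OF K]) (auto simp: s\<eta>)
    also have "\<dots> = (\<integral>\<^sup>+z. indicator A z \<partial>swap_measure (kprod \<eta> K))"
      unfolding swap_measure_def by (subst nn_integral_distr) (auto simp: prod.swap_def)
    finally show "emeasure (distr M borel T) A = emeasure (swap_measure (kprod \<eta> K)) A"
      by simp
  qed simp
  have "rel_entropy (distr (density M f) borel T) (distr M borel T) \<le> rel_entropy (density M f) M"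
    using pM pR by (intro rel_entropy_distr_le) (auto simp: Rf[symmetric] fnn)
  also have "\<dots> = (\<integral>\<^sup>+z. ennreal (ent_fun (f z)) \<partial>M)"
    using pM pR by (intro rel_entropy_eq_nn_integral) (auto simp: Rf[symmetric] fnn)
  also have "\<dots> = (\<integral>\<^sup>+p. \<integral>\<^sup>+x. ennreal (ent_fun (f (p, x))) \<partial>K (snd p) \<partial>\<gamma>)"
    by (subst intM) auto
  also have "\<dots> = (\<integral>\<^sup>+p. rel_entropy (K (fst p)) (K (snd p)) \<partial>\<gamma>)"
  proof (intro nn_integral_cong)
    fix p :: "(real^'d) \<times> (real^'d)"
    have m: "(\<lambda>x. f (p, x)) \<in> borel_measurable borel" unfolding f_def by simp
    have d: "K (fst p) = density (K (snd p)) (\<lambda>x. ennreal (f (p, x)))"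
      unfolding K_def f_def by (simp add: density_gibbs)
    have "rel_entropy (density (K (snd p)) (\<lambda>x. ennreal (f (p, x)))) (K (snd p))
        = (\<integral>\<^sup>+x. ennreal (ent_fun (f (p, x))) \<partial>K (snd p))"
      using m kernel_prob_space[OF K]
      by (intro rel_entropy_eq_nn_integral)
        (auto simp: fnn d[symmetric] cong: measurable_cong_sets)
    then show "(\<integral>\<^sup>+x. ennreal (ent_fun (f (p, x))) \<partial>K (snd p)) = rel_entropy (K (fst p)) (K (snd p))"
      by (simp add: d[symmetric])
  qed
  also have "\<dots> \<le> (\<integral>\<^sup>+p. G p \<partial>\<gamma>)"
    using le by (intro nn_integral_mono) (metis prod.collapse)
  finally have "rel_entropy ?Q (swap_measure (kprod \<eta> K)) \<le> (\<integral>\<^sup>+p. G p \<partial>\<gamma>)"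
    by (simp add: MT Rf)
  moreover have "?Q \<in> couplings (\<pi> \<bind> K) \<eta>"
    unfolding couplings_def using sQ fQ by simp
  ultimately show ?thesis by blast
qed

section \<open>The Sinkhorn recursion and the contraction estimate\<close>

lemma smooth_continuous: "smooth f \<Longrightarrow> continuous_on UNIV f"
  unfolding smooth_def by (metis Ck.simps(1))

lemma swap_joint_gibbs:
  fixes h :: "(real^'d) \<times> (real^'d) \<Rightarrow> real"
  assumes [measurable]: "h \<in> borel_measurable borel"
  shows "swap_measure (joint_gibbs h) = joint_gibbs (\<lambda>z. h (prod.swap z))"
proof (rule measure_eqI)
  fix A assume "A \<in> sets (swap_measure (joint_gibbs h))"
  then have A[measurable]: "A \<in> sets borel" by simp
  have "emeasure (swap_measure (joint_gibbs h)) A = (\<integral>\<^sup>+z. indicator A z \<partial>swap_measure (joint_gibbs h))"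
    by simp
  also have "\<dots> = (\<integral>\<^sup>+z. indicator A (prod.swap z) \<partial>joint_gibbs h)"
    unfolding swap_measure_def by (subst nn_integral_distr) auto
  also have "\<dots> = (\<integral>\<^sup>+z. ennreal (exp (- h z)) * indicator A (prod.swap z) \<partial>lborel)"
    unfolding joint_gibbs_def by (subst nn_integral_density) auto
  also have "\<dots> = (\<integral>\<^sup>+y. \<integral>\<^sup>+x. ennreal (exp (- h (x, y))) * indicator A (y, x) \<partial>lborel \<partial>lborel)"
    by (subst nn_integral_lborel_pair(2)) auto
  also have "\<dots> = (\<integral>\<^sup>+z. ennreal (exp (- h (prod.swap z))) * indicator A z \<partial>lborel)"
    by (subst nn_integral_lborel_pair(1)) auto
  also have "\<dots> = emeasure (joint_gibbs (\<lambda>z. h (prod.swap z))) A"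
    unfolding joint_gibbs_def by (subst emeasure_density) auto
  finally show "emeasure (swap_measure (joint_gibbs h)) A = emeasure (joint_gibbs (\<lambda>z. h (prod.swap z))) A" .
qed simp

lemma rel_entropy_refl: "prob_space M \<Longrightarrow> rel_entropy M M = 0"
  using rel_entropy_eq_integral_ln[of M "\<lambda>_. 1"] by (simp add: density_1)

lemma ennreal_sqrt_power2: "(ennreal_sqrt t)\<^sup>2 = t"
  by (cases t) (auto simp: ennreal_sqrt_def power2_eq_square ennreal_mult'[symmetric] ennreal_top_mult)

text \<open>The Sinkhorn recursion expressed pointwise: \<open>w n\<close> is the negative log-density of \<open>K n\<close> and \<open>a n\<close> that of
the \<open>n\<close>-th marginal. The single equation covers both parities, because the starting measure of \<open>K n\<close>
alternates between \<open>\<mu>\<close> and \<open>\<eta>\<close>.\<close>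

locale sinkhorn_potentials =
  fixes U V :: "real^'d \<Rightarrow> real" and w :: "nat \<Rightarrow> real^'d \<Rightarrow> real^'d \<Rightarrow> real" and a :: "nat \<Rightarrow> real^'d \<Rightarrow> real"
    and K :: "nat \<Rightarrow> real^'d \<Rightarrow> (real^'d) measure"
  assumes continuous_U: "continuous_on UNIV U" and continuous_V: "continuous_on UNIV V"
    and continuous_w: "\<And>n. continuous_on UNIV (\<lambda>z. w n (fst z) (snd z))"
    and continuous_a: "\<And>n. continuous_on UNIV (a n)"
    and prob_U: "prob_space (gibbs U)" and prob_V: "prob_space (gibbs V)"
    and K_eq: "\<And>n. K n = (\<lambda>x. gibbs (w n x))" and kernel: "\<And>n. markov_kernel (K n)"
    and marginal: "\<And>n. sinkhorn_marginal (gibbs U) (gibbs V) K n = gibbs (a n)"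
    and potentials: "\<And>n x y. (if even n then U else V) x + w n x y = a n y + w (Suc n) y x"
begin

abbreviation "\<mu> \<equiv> gibbs U"
abbreviation "\<eta> \<equiv> gibbs V"
abbreviation "J \<equiv> sinkhorn_joint \<mu> \<eta> K"

lemma measurable_potentials[measurable]:
  "U \<in> borel_measurable borel" "V \<in> borel_measurable borel" "a n \<in> borel_measurable borel"
  "(\<lambda>z. w n (fst z) (snd z)) \<in> borel_measurable borel"
  "(\<lambda>z. w n (snd z) (fst z)) \<in> borel_measurable borel"
  using continuous_U continuous_V continuous_a continuous_w continuous_on_swap_args[OF continuous_w]
  by (auto intro!: borel_measurable_continuous_onI)

lemma kprod_base: "continuous_on UNIV F \<Longrightarrow>
    kprod (gibbs F) (K n) = joint_gibbs (\<lambda>z. F (fst z) + w n (fst z) (snd z))"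
  using kernel[of n] unfolding K_eq by (intro kprod_gibbs continuous_w)

lemma joint_even: "even n \<Longrightarrow> J n = joint_gibbs (\<lambda>z. U (fst z) + w n (fst z) (snd z))"
  by (simp add: sinkhorn_joint_def kprod_base continuous_U)

lemma joint_odd: "odd n \<Longrightarrow> J n = joint_gibbs (\<lambda>z. V (snd z) + w n (snd z) (fst z))"
  by (simp add: sinkhorn_joint_def kprod_base continuous_V swap_joint_gibbs)

lemma prob_J: "prob_space (J n)"
  by (auto simp: sinkhorn_joint_def intro!: prob_space_kprod prob_space_swap_measure sets_kprod prob_U prob_V
      kernel)

lemma sets_J[simp, measurable_cong]: "sets (J n) = sets borel"
  by (auto simp: sinkhorn_joint_def sets_kprod)

lemma joint_Suc_even:
  assumes "even n"
  shows "J (Suc n) = density (J n) (\<lambda>z. ennreal (exp (a n (snd z) - V (snd z))))"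
  using assms potentials[of n]
  by (simp add: joint_even joint_odd density_joint_gibbs algebra_simps)

lemma joint_Suc_odd:
  assumes "odd n"
  shows "J (Suc n) = density (J n) (\<lambda>z. ennreal (exp (a n (fst z) - U (fst z))))"
  using assms potentials[of n]
  by (simp add: joint_even joint_odd density_joint_gibbs algebra_simps)

lemma joint_even_fst: "even n \<Longrightarrow> distr (J n) borel fst = \<mu>"
  by (simp add: sinkhorn_joint_def distr_kprod_fst kernel)

lemma joint_even_snd: "even n \<Longrightarrow> distr (J n) borel snd = gibbs (a n)"
  using marginal[of n] by (simp add: sinkhorn_joint_def distr_kprod_snd kernel sinkhorn_marginal_def)

lemma joint_odd_snd: "odd n \<Longrightarrow> distr (J n) borel snd = \<eta>"
  by (simp add: sinkhorn_joint_def distr_swap_snd sets_kprod distr_kprod_fst kernel)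

lemma joint_odd_fst: "odd n \<Longrightarrow> distr (J n) borel fst = gibbs (a n)"
  using marginal[of n]
  by (simp add: sinkhorn_joint_def distr_swap_fst sets_kprod distr_kprod_snd kernel sinkhorn_marginal_def)

lemma prob_marginal: "prob_space (gibbs (a n))"
proof (cases "even n")
  case True
  then show ?thesis
    using prob_space.prob_space_distr[OF prob_J[of n], of snd borel] by (simp add: joint_even_snd)
next
  case False
  then show ?thesis
    using prob_space.prob_space_distr[OF prob_J[of n], of fst borel] by (simp add: joint_odd_fst)
qed

lemma entropy_step_even:
  assumes Q: "Q \<in> couplings \<mu> \<eta>" and n: "even n"
  shows "rel_entropy Q (J n) = rel_entropy Q (J (Suc n)) + rel_entropy \<eta> (gibbs (a n))"
proof -
  have "distr Q borel snd = density (distr (J n) borel snd) (\<lambda>y. ennreal (exp (a n y - V y)))"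
    using n by (simp add: couplingsD[OF Q] joint_even_snd density_gibbs)
  then have "rel_entropy Q (J n) = rel_entropy Q (density (J n) (\<lambda>z. ennreal (exp (a n (snd z) - V (snd z)))))
      + rel_entropy (distr Q borel snd) (distr (J n) borel snd)"
    by (intro rel_entropy_chain prob_J prob_space_coupling[OF Q] prob_U)
      (auto simp: couplingsD[OF Q])
  then show ?thesis
    using n by (simp add: joint_Suc_even couplingsD[OF Q] joint_even_snd)
qed

lemma entropy_step_odd:
  assumes Q: "prob_space Q" "sets Q = sets borel" "distr Q borel fst = \<mu>" and n: "odd n"
  shows "rel_entropy Q (J n) = rel_entropy Q (J (Suc n)) + rel_entropy \<mu> (gibbs (a n))"
proof -
  have "distr Q borel fst = density (distr (J n) borel fst) (\<lambda>y. ennreal (exp (a n y - U y)))"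
    using n by (simp add: Q joint_odd_fst density_gibbs)
  then have "rel_entropy Q (J n) = rel_entropy Q (density (J n) (\<lambda>z. ennreal (exp (a n (fst z) - U (fst z)))))
      + rel_entropy (distr Q borel fst) (distr (J n) borel fst)"
    by (intro rel_entropy_chain prob_J Q) (auto simp: Q)
  then show ?thesis
    using n by (simp add: joint_Suc_odd Q joint_odd_fst)
qed

text \<open>The constant is the sum of the entropies of the prescribed marginals relative to the first \<open>n\<close>
Sinkhorn marginals; only its independence of \<open>Q\<close> matters.\<close>

lemma entropy_coupling_const:
  "\<exists>C. \<forall>Q\<in>couplings \<mu> \<eta>. rel_entropy Q (J 0) = rel_entropy Q (J n) + C"
proof (induction n)
  case 0
  show ?case by (intro exI[of _ 0]) auto
next
  case (Suc n)
  then obtain C where C: "\<forall>Q\<in>couplings \<mu> \<eta>. rel_entropy Q (J 0) = rel_entropy Q (J n) + C" by blast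
  show ?case
  proof (cases "even n")
    case True
    then show ?thesis
      using C entropy_step_even[OF _ True]
      by (intro exI[of _ "rel_entropy \<eta> (gibbs (a n)) + C"]) (auto simp: add.assoc)
  next
    case False
    have "rel_entropy Q (J n) = rel_entropy Q (J (Suc n)) + rel_entropy \<mu> (gibbs (a n))"
      if "Q \<in> couplings \<mu> \<eta>" for Q
      using that False by (intro entropy_step_odd) (auto simp: couplingsD prob_space_coupling[OF that prob_U])
    then show ?thesis
      using C by (intro exI[of _ "rel_entropy \<mu> (gibbs (a n)) + C"]) (auto simp: add.assoc)
  qed
qed

text \<open>The entropies relative to \<open>J 0\<close> and \<open>J n\<close> differ by a constant on couplings, and this constant is finite
as soon as one coupling has finite entropy, so it can be cancelled.\<close>

lemma bridge_minimal:
  assumes B: "B \<in> couplings \<mu> \<eta>" and min: "\<And>Q. Q \<in> couplings \<mu> \<eta> \<Longrightarrow> rel_entropy B (J 0) \<le> rel_entropy Q (J 0)"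
    and fin: "rel_entropy B (J 0) < \<infinity>" and Q: "Q \<in> couplings \<mu> \<eta>"
  shows "rel_entropy B (J n) \<le> rel_entropy Q (J n)"
proof -
  obtain C where C: "\<forall>Q\<in>couplings \<mu> \<eta>. rel_entropy Q (J 0) = rel_entropy Q (J n) + C"
    using entropy_coupling_const by blast
  have "C < \<infinity>" using fin C B by auto
  moreover have "rel_entropy B (J n) + C \<le> rel_entropy Q (J n) + C"
    using min[OF Q] C B Q by auto
  ultimately show ?thesis
    by (auto simp: ennreal_add_left_cancel_le add.commute)
qed

text \<open>For odd \<open>n\<close>, \<open>J n\<close> and \<open>J (Suc n)\<close> have second marginals \<open>\<eta>\<close> and \<open>\<pi> (Suc n)\<close>, and their densities differ
by a function of the first variable alone. Hence their relative entropy equals that of the first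
marginals and dominates that of the second ones.\<close>

lemma marginal_entropy_decreases:
  assumes n: "odd n"
  shows "rel_entropy (gibbs (a (Suc n))) \<eta> \<le> rel_entropy \<mu> (gibbs (a n))"
proof -
  let ?f = "\<lambda>z. exp (a n (fst z) - U (fst z))"
  have J: "J (Suc n) = density (J n) (\<lambda>z. ennreal (?f z))"
    by (rule joint_Suc_odd[OF n])
  have "rel_entropy (distr (density (J n) ?f) borel snd) (distr (J n) borel snd)
      \<le> rel_entropy (density (J n) ?f) (J n)"
    by (rule rel_entropy_distr_le) (auto simp: prob_J J[symmetric])
  then have "rel_entropy (gibbs (a (Suc n))) \<eta> \<le> rel_entropy (J (Suc n)) (J n)"
    using n by (simp add: J[symmetric] joint_even_snd joint_odd_snd)
  also have "\<dots> = rel_entropy (J (Suc n)) (J (Suc n)) + rel_entropy \<mu> (gibbs (a n))"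
    using n by (intro entropy_step_odd) (auto simp: prob_J joint_even_fst)
  also have "\<dots> = rel_entropy \<mu> (gibbs (a n))"
    by (simp add: rel_entropy_refl prob_J)
  finally show ?thesis .
qed

text \<open>By construction \<open>K (Suc n)\<close> disintegrates \<open>J n\<close>, whose first marginal is \<open>\<mu>\<close>, along its second marginal.\<close>

lemma kernel_maps_marginal:
  assumes "even n"
  shows "gibbs (a n) \<bind> K (Suc n) = \<mu>"
proof -
  have "gibbs (a n) \<bind> K (Suc n) = distr (swap_measure (kprod (gibbs (a n)) (K (Suc n)))) borel fst"
    by (simp add: distr_swap_fst sets_kprod distr_kprod_snd kernel)
  also have "swap_measure (kprod (gibbs (a n)) (K (Suc n))) = J n"
    using assms potentials[of n] by (simp add: kprod_base[OF continuous_a] swap_joint_gibbs joint_even)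
  finally show ?thesis
    using assms by (simp add: joint_even_fst)
qed

text \<open>The infimum over all couplings \<open>\<gamma>\<close> of the bounds obtained from the transported couplings.\<close>

lemma bridge_entropy_le_transport:
  assumes B: "\<And>Q. Q \<in> couplings \<mu> \<eta> \<Longrightarrow> rel_entropy B (J (Suc n)) \<le> rel_entropy Q (J (Suc n))"
    and n: "even n" and c: "c > 0"
    and le: "\<And>y1 y2. rel_entropy (K (Suc n) y1) (K (Suc n) y2) \<le> ennreal (c / 2 * (norm (y1 - y2))\<^sup>2)"
  shows "rel_entropy B (J (Suc n)) \<le> ennreal (c / 2) * (wasserstein2 (gibbs (a n)) \<eta>)\<^sup>2"
proof -
  have "rel_entropy B (J (Suc n)) \<le> ennreal (c / 2) * (\<integral>\<^sup>+z. ennreal ((norm (fst z - snd z))\<^sup>2) \<partial>\<gamma>)"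
    if \<gamma>: "\<gamma> \<in> couplings (gibbs (a n)) \<eta>" for \<gamma>
  proof -
    have [measurable]: "(\<lambda>z::(real^'d)\<times>(real^'d). (norm (fst z - snd z))\<^sup>2) \<in> borel_measurable borel"
      by (intro borel_measurable_continuous_onI continuous_intros)
    have [measurable_cong]: "sets \<gamma> = sets borel" by (rule couplingsD[OF \<gamma>])
    have "\<exists>Q\<in>couplings (gibbs (a n) \<bind> (\<lambda>y. gibbs (w (Suc n) y))) \<eta>.
        rel_entropy Q (swap_measure (kprod \<eta> (\<lambda>y. gibbs (w (Suc n) y))))
        \<le> (\<integral>\<^sup>+z. ennreal (c / 2 * (norm (fst z - snd z))\<^sup>2) \<partial>\<gamma>)"
      using kernel[of "Suc n"] le
      by (intro transported_coupling[OF continuous_w _ \<gamma>] prob_marginal) (auto simp: K_eq)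
    then obtain Q where "Q \<in> couplings \<mu> \<eta>"
        "rel_entropy Q (J (Suc n)) \<le> (\<integral>\<^sup>+z. ennreal (c / 2 * (norm (fst z - snd z))\<^sup>2) \<partial>\<gamma>)"
      using kernel_maps_marginal[OF n] n by (auto simp: K_eq sinkhorn_joint_def)
    then have "rel_entropy B (J (Suc n)) \<le> (\<integral>\<^sup>+z. ennreal (c / 2 * (norm (fst z - snd z))\<^sup>2) \<partial>\<gamma>)"
      using B order_trans by blast
    also have "\<dots> = ennreal (c / 2) * (\<integral>\<^sup>+z. ennreal ((norm (fst z - snd z))\<^sup>2) \<partial>\<gamma>)"
      using c by (subst nn_integral_cmult[symmetric]) (auto simp: ennreal_mult'[symmetric] intro!: nn_integral_cong)
    finally show ?thesis .
  qed
  note A = this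
  have one: "ennreal (c / 2) * (ennreal (2 / c) * t) = t" "ennreal (2 / c) * (ennreal (c / 2) * t) = t" for t
    using c by (simp_all add: mult.assoc[symmetric] ennreal_mult'[symmetric])
  have "ennreal (2 / c) * rel_entropy B (J (Suc n))
      \<le> (INF \<gamma>\<in>couplings (gibbs (a n)) \<eta>. \<integral>\<^sup>+z. ennreal ((norm (fst z - snd z))\<^sup>2) \<partial>\<gamma>)"
  proof (rule INF_greatest)
    fix \<gamma> assume "\<gamma> \<in> couplings (gibbs (a n)) \<eta>"
    from mult_left_mono[OF A[OF this], of "ennreal (2 / c)"]
    show "ennreal (2 / c) * rel_entropy B (J (Suc n)) \<le> (\<integral>\<^sup>+z. ennreal ((norm (fst z - snd z))\<^sup>2) \<partial>\<gamma>)"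
      by (simp add: one)
  qed
  also have "\<dots> = (wasserstein2 (gibbs (a n)) \<eta>)\<^sup>2"
    by (simp add: wasserstein2_def ennreal_sqrt_power2)
  finally have "ennreal (c / 2) * (ennreal (2 / c) * rel_entropy B (J (Suc n)))
      \<le> ennreal (c / 2) * (wasserstein2 (gibbs (a n)) \<eta>)\<^sup>2"
    by (rule mult_left_mono) simp
  then show ?thesis by (simp only: one)
qed

text \<open>With \<open>A = H(B|J (n + 2))\<close>, \<open>X = H(\<mu>|\<pi> n)\<close> and \<open>Y = H(B|J n)\<close>, transport and data processing give
\<open>A \<le> c * v * X\<close>, and two applications of the chain rule give \<open>A + X \<le> Y\<close>.\<close>

lemma bridge_entropy_contraction:
  assumes B: "B \<in> couplings \<mu> \<eta>" and min: "\<And>Q. Q \<in> couplings \<mu> \<eta> \<Longrightarrow> rel_entropy B (J 0) \<le> rel_entropy Q (J 0)"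
    and fin: "rel_entropy B (J 0) < \<infinity>"
    and n: "odd n" and c: "c > 0" and v: "v > 0" and T2: "T2 \<eta> v"
    and le: "\<And>y1 y2. rel_entropy (K (n + 2) y1) (K (n + 2) y2) \<le> ennreal (c / 2 * (norm (y1 - y2))\<^sup>2)"
  shows "rel_entropy B (J (n + 2)) \<le> ennreal (inverse (1 + inverse (c * v))) * rel_entropy B (J n)"
proof -
  let ?A = "rel_entropy B (J (n + 2))" and ?X = "rel_entropy \<mu> (gibbs (a n))" and ?Y = "rel_entropy B (J n)"
  have "?A \<le> ennreal (c / 2) * (wasserstein2 (gibbs (a (n + 1))) \<eta>)\<^sup>2"
    using bridge_entropy_le_transport[of B "Suc n" c] bridge_minimal[OF B min fin] n c le by auto
  also have "\<dots> = ennreal c * (ennreal (1 / 2) * (wasserstein2 (gibbs (a (n + 1))) \<eta>)\<^sup>2)"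
  proof -
    have "ennreal (c / 2) = ennreal c * ennreal (1 / 2)"
      using c by (subst ennreal_mult'[symmetric]) auto
    then show ?thesis by (simp only: mult.assoc)
  qed
  also have "\<dots> \<le> ennreal c * (ennreal v * rel_entropy (gibbs (a (n + 1))) \<eta>)"
    using T2 prob_marginal[of "n + 1"] unfolding T2_def by (intro mult_left_mono) auto
  also have "\<dots> \<le> ennreal c * (ennreal v * ?X)"
    using marginal_entropy_decreases[OF n] by (intro mult_left_mono) auto
  finally have A: "?A \<le> ennreal (c * v) * ?X"
    using c v by (simp add: ennreal_mult' mult.assoc)
  have "?Y = rel_entropy B (J (Suc n)) + ?X"
    using n by (intro entropy_step_odd) (auto simp: couplingsD[OF B] prob_space_coupling[OF B prob_U])
  also have "rel_entropy B (J (Suc n)) = ?A + rel_entropy \<eta> (gibbs (a (Suc n)))"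
    using entropy_step_even[OF B, of "Suc n"] n by simp
  finally have Y: "?A + ?X \<le> ?Y"
    by (simp add: add_right_mono)
  show ?thesis
  \<comment> \<open>The coefficient on the right is positive, so an infinite right-hand side is harmless.\<close>
  proof (cases "?Y = \<infinity>")
    case True
    have "inverse (1 + inverse (c * v)) > 0" using c v by (simp add: add_pos_pos)
    then show ?thesis using True by (simp add: ennreal_mult_top)
  next
    case False
    then obtain y where y: "?Y = ennreal y" "y \<ge> 0" by (cases ?Y) auto
    moreover from Y False have "?A \<noteq> \<infinity>" "?X \<noteq> \<infinity>" by (auto simp: top_unique)
    ultimately obtain \<alpha> x where ax: "?A = ennreal \<alpha>" "\<alpha> \<ge> 0" "?X = ennreal x" "x \<ge> 0"
      by (cases ?A; cases ?X) auto
    have "\<alpha> \<le> c * v * x" using A ax c v by (simp add: ennreal_mult'[symmetric])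
    moreover have "\<alpha> + x \<le> y" using Y ax y by (simp add: ennreal_plus[symmetric] del: ennreal_plus)
    ultimately have "\<alpha> * (1 + inverse (c * v)) \<le> y"
    proof -
      assume 1: "\<alpha> \<le> c * v * x" and 2: "\<alpha> + x \<le> y"
      have "\<alpha> * inverse (c * v) \<le> x" using 1 c v by (simp add: field_simps)
      then show ?thesis using 2 by (simp add: algebra_simps)
    qed
    moreover have "1 + inverse (c * v) > 0" using c v by (simp add: add_pos_pos)
    ultimately have "\<alpha> \<le> inverse (1 + inverse (c * v)) * y"
      by (simp add: field_simps)
    then show ?thesis using y ax c v by (simp add: ennreal_mult'[symmetric] add_nonneg_nonneg)
  qed
qed

end

lemma sinkhorn_potentials_exist:
  assumes "sinkhorn_setting U V W K B"
  obtains w a where "sinkhorn_potentials U V w a K"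
proof -
  let ?\<mu> = "gibbs U" and ?\<eta> = "gibbs V"
  have U: "continuous_on UNIV U" and V: "continuous_on UNIV V" and pU: "prob_space ?\<mu>" and pV: "prob_space ?\<eta>"
      and tr: "sinkhorn_transitions ?\<mu> ?\<eta> (gibbs_kernel W) K" and reg: "regular_transitions K"
    using assms by (auto simp: sinkhorn_setting_def smooth_continuous)
  obtain w where w: "\<And>n. smooth (\<lambda>z. w n (fst z) (snd z))" and Kw: "\<And>n x. K n x = gibbs (w n x)"
    using reg unfolding regular_transitions_def by metis
  have wc: "continuous_on UNIV (\<lambda>z. w n (fst z) (snd z))" for n
    using w by (rule smooth_continuous)
  have K_eq: "K n = (\<lambda>x. gibbs (w n x))" for n using Kw by auto
  have ker: "markov_kernel (K n)" for n using tr by (simp add: sinkhorn_transitions_def)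
  have "\<exists>b. continuous_on UNIV b \<and> sinkhorn_marginal ?\<mu> ?\<eta> K n = gibbs b \<and>
      (\<forall>x y. (if even n then U else V) x + w n x y = b y + w (Suc n) y x)" for n
  proof -
    let ?F = "if even n then U else V"
    have F: "continuous_on UNIV ?F" "prob_space (gibbs ?F)" using U V pU pV by auto
    have m: "sinkhorn_marginal ?\<mu> ?\<eta> K n = gibbs ?F \<bind> K n" by (simp add: sinkhorn_marginal_def)
    have "kprod (gibbs ?F) (K n) = swap_measure (kprod (gibbs ?F \<bind> K n) (K (Suc n)))"
    proof (cases "even n")
      case True
      then obtain k where k: "n = 2 * k" by (elim evenE)
      then have "kprod ?\<mu> (K n) = swap_measure (kprod (sinkhorn_marginal ?\<mu> ?\<eta> K n) (K (Suc n)))"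
        using tr by (simp add: sinkhorn_transitions_def)
      then show ?thesis using True m by simp
    next
      case False
      then obtain k where k: "n = 2 * k + 1" by (elim oddE)
      then have "swap_measure (kprod ?\<eta> (K n)) = kprod (sinkhorn_marginal ?\<mu> ?\<eta> K n) (K (Suc n))"
        using tr by (simp add: sinkhorn_transitions_def)
      then have "swap_measure (swap_measure (kprod ?\<eta> (K n))) =
          swap_measure (kprod (sinkhorn_marginal ?\<mu> ?\<eta> K n) (K (Suc n)))"
        by simp
      then show ?thesis using False m by (simp add: swap_swap_measure sets_kprod)
    qed
    then have eq: "kprod (gibbs ?F) (\<lambda>x. gibbs (w n x)) =
        swap_measure (kprod (gibbs ?F \<bind> (\<lambda>x. gibbs (w n x))) (\<lambda>y. gibbs (w (Suc n) y)))"
      by (simp only: K_eq)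
    obtain b where "continuous_on UNIV b" "gibbs ?F \<bind> (\<lambda>x. gibbs (w n x)) = gibbs b"
        "\<And>x y. ?F x + w n x y = b y + w (Suc n) y x"
      by (rule gibbs_disintegration[OF F(1) wc wc F(2) _ _ eq])
        (use ker in \<open>auto simp only: K_eq\<close>)
    then show ?thesis
      unfolding m K_eq by blast
  qed
  then obtain a where a: "\<And>n. continuous_on UNIV (a n)" and m: "\<And>n. sinkhorn_marginal ?\<mu> ?\<eta> K n = gibbs (a n)"
      and p: "\<And>n x y. (if even n then U else V) x + w n x y = a n y + w (Suc n) y x"
    by metis
  have "sinkhorn_potentials U V w a K"
    by (rule sinkhorn_potentials.intro[OF U V wc a pU pV K_eq ker m p])
  then show ?thesis by (rule that)
qed

lemma sinkhorn_setting_contraction: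
  assumes set: "sinkhorn_setting U V W K B" and n: "n \<ge> 1" and c: "c > 0"
    and v: "pos_def (v_plus :: real^'d^'d)" and T2: "T2 (gibbs V) (spectral_norm v_plus)"
    and le: "\<And>y1 y2. rel_entropy (K (2 * n + 1) y1) (K (2 * n + 1) y2) \<le> ennreal (c / 2 * (norm (y1 - y2))\<^sup>2)"
  shows "rel_entropy B (sinkhorn_joint (gibbs U) (gibbs V) K (2 * n + 1))
    \<le> ennreal (inverse (1 + inverse (c * spectral_norm v_plus))) *
       rel_entropy B (sinkhorn_joint (gibbs U) (gibbs V) K (2 * n - 1))"
proof -
  obtain w a where "sinkhorn_potentials U V w a K"
    using sinkhorn_potentials_exist[OF set] .
  then interpret sinkhorn_potentials U V w a K .
  have J0: "kprod \<mu> (gibbs_kernel W) = J 0"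
    using set by (simp add: sinkhorn_joint_def sinkhorn_setting_def sinkhorn_transitions_def)
  have "is_arg_min (\<lambda>Q. rel_entropy Q (J 0)) (\<lambda>Q. Q \<in> couplings \<mu> \<eta>) B"
    using set by (simp add: sinkhorn_setting_def schroedinger_bridge_def J0)
  then have B: "B \<in> couplings \<mu> \<eta>" and min: "\<And>Q. Q \<in> couplings \<mu> \<eta> \<Longrightarrow> rel_entropy B (J 0) \<le> rel_entropy Q (J 0)"
    by (auto simp: is_arg_min_linorder)
  obtain Q where "Q \<in> couplings \<mu> \<eta>" "rel_entropy Q (J 0) < \<infinity>"
    using set unfolding sinkhorn_setting_def J0 by blast
  then have fin: "rel_entropy B (J 0) < \<infinity>"
    using min order_le_less_trans by blast
  have "spectral_norm v_plus > 0"
  proof -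
    obtain b :: "real^'d" where "b \<noteq> 0" using nonempty_Basis nonzero_Basis by blast
    then have "v_plus *v b \<noteq> 0" using v by (force simp: pos_def_def)
    then show ?thesis
      unfolding spectral_norm_def
      by (subst onorm_pos_lt) (auto intro: matrix_vector_mul_bounded_linear)
  qed
  with bridge_entropy_contraction[OF B min fin, of "2 * n - 1" c] n c T2 le
  show ?thesis by simp
qed

section \<open>Entropy of Lipschitz perturbations\<close>

lemma exp_le_add_exp_square: "exp t \<le> t + exp (t\<^sup>2)" for t :: real
proof -
  have e2: "1 + t\<^sup>2 \<le> exp (t\<^sup>2)" by simp
  consider "t > 1" | "t < - 1" | "0 \<le> t" "t \<le> 1" | "- 1 \<le> t" "t \<le> 0" by linarith
  then show ?thesis
  proof cases
    case 1
    then have "t \<le> t\<^sup>2" by (simp add: power2_eq_square)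
    then have "exp t \<le> exp (t\<^sup>2)" by simp
    then show ?thesis using 1 by linarith
  next
    case 2
    then have "- t \<le> t\<^sup>2"
      using mult_right_mono_neg[of t "-1" t] by (simp add: power2_eq_square)
    moreover have "exp t \<le> 1" using 2 by simp
    ultimately show ?thesis using e2 by linarith
  next
    case 3
    then have "exp t \<le> 1 + t + t\<^sup>2" by (intro exp_bound)
    then show ?thesis using e2 by linarith
  next
    case 4
    define s where "s = - t"
    have s: "0 \<le> s" "s \<le> 1" using 4 by (auto simp: s_def)
    have q: "1 + s + s\<^sup>2 / 2 \<le> exp s" by (rule exp_lower_Taylor_quadratic) (rule s)
    have "1 \<le> (1 - s + s\<^sup>2) * (1 + s + s\<^sup>2 / 2)"
    proof -
      have "(1 - s + s\<^sup>2) * (1 + s + s\<^sup>2 / 2) = 1 + s^2 / 2 + s^3 / 2 + s^4 / 2"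
        by (simp add: field_simps power2_eq_square power3_eq_cube power4_eq_xxxx)
      then show ?thesis using s by simp
    qed
    also have "\<dots> \<le> (1 - s + s\<^sup>2) * exp s"
      using q s by (intro mult_left_mono) auto
    finally have "exp (- s) \<le> 1 - s + s\<^sup>2"
      by (simp add: exp_minus field_simps)
    then have "exp t \<le> 1 + t + t\<^sup>2" by (simp add: s_def)
    then show ?thesis using e2 by linarith
  qed
qed

text \<open>Let \<open>f = ln (d gibbs \<Phi>1 / d gibbs \<Phi>2)\<close> and \<open>E\<close> the expectation under \<open>gibbs \<Phi>2\<close>, so that
\<open>E (exp f) = 1\<close>. Since the logarithm lies below its tangents, the entropy \<open>E (f * exp f)\<close> is at most
\<open>ln (E (exp (2 * f)))\<close>, and since \<open>E (exp (- 2 * f)) \<ge> 1\<close> it is at most the logarithm of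
\<open>E (exp (2 * f)) * E (exp (- 2 * f))\<close>. This product does not change if a constant is subtracted from
\<open>f\<close>, so \<open>f\<close> may be replaced by \<open>X = f - f m\<close> with \<open>|X| \<le> L * |x - m|\<close>.

For small \<open>L\<close> the inequality \<open>exp t \<le> t + exp (t\<^sup>2)\<close> makes the linear terms of the two factors cancel
and leaves a quantity of order \<open>L\<^sup>2\<close>; for large \<open>L\<close> the crude bound \<open>2 * |X| \<le> L\<^sup>2 / \<alpha> + \<alpha> * |x - m|\<^sup>2\<close> is
sufficient.\<close>

lemma rel_entropy_lipschitz_le:
  fixes \<Phi>1 \<Phi>2 :: "real^'d \<Rightarrow> real"
  assumes c1: "continuous_on UNIV \<Phi>1" and c2: "continuous_on UNIV \<Phi>2"
    and p1: "prob_space (gibbs \<Phi>1)" and p2: "prob_space (gibbs \<Phi>2)"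
    and L: "L \<ge> 0" and lip: "\<And>x. \<bar>(\<Phi>2 x - \<Phi>1 x) - (\<Phi>2 m - \<Phi>1 m)\<bar> \<le> L * norm (x - m)"
    and \<alpha>: "\<alpha> > 0" and mom: "(\<integral>\<^sup>+x. ennreal (exp (\<alpha> * (norm (x - m))\<^sup>2)) \<partial>gibbs \<Phi>2) \<le> ennreal C"
  shows "rel_entropy (gibbs \<Phi>1) (gibbs \<Phi>2) \<le> ennreal (L\<^sup>2 * ((2 + 8 * (C - 1)) / \<alpha>))"
proof -
  interpret N: prob_space "gibbs \<Phi>2" by (rule p2)
  let ?N = "gibbs \<Phi>2"
  define f where "f x = \<Phi>2 x - \<Phi>1 x" for x
  define X where "X x = f x - f m" for x
  define \<psi> where "\<psi> x = exp (\<alpha> * (norm (x - m))\<^sup>2)" for x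
  have fc: "continuous_on UNIV f" unfolding f_def by (intro continuous_intros c1 c2)
  have [measurable]: "f \<in> borel_measurable borel" using fc by (rule borel_measurable_continuous_onI)
  have [measurable]: "\<Phi>1 \<in> borel_measurable borel" "\<Phi>2 \<in> borel_measurable borel"
    using c1 c2 by (auto intro!: borel_measurable_continuous_onI)
  have [measurable]: "X \<in> borel_measurable borel" unfolding X_def by measurable
  have [measurable]: "\<psi> \<in> borel_measurable borel" unfolding \<psi>_def by measurable
  have X: "\<bar>X x\<bar> \<le> L * norm (x - m)" for x using lip[of x] by (simp add: X_def f_def)
  have \<psi>1: "1 \<le> \<psi> x" for x using \<alpha> by (simp add: \<psi>_def)
  have \<psi>0: "0 \<le> \<psi> x" for x by (simp add: \<psi>_def)
  have int\<psi>: "integrable ?N \<psi>"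
  proof (rule integrableI_nonneg)
    show "(\<integral>\<^sup>+x. ennreal (\<psi> x) \<partial>?N) < \<infinity>"
      unfolding \<psi>_def by (rule order_le_less_trans[OF mom]) simp
  qed (auto simp: \<psi>_def)
  have E\<psi>: "(\<integral>x. \<psi> x \<partial>?N) \<le> C" and C1: "1 \<le> C"
  proof -
    have "(\<integral>x. 1 \<partial>?N) \<le> (\<integral>x. \<psi> x \<partial>?N)"
      using int\<psi> \<psi>1 by (intro integral_mono) auto
    then have 1: "1 \<le> (\<integral>x. \<psi> x \<partial>?N)" using N.prob_space by simp
    have "ennreal (\<integral>x. \<psi> x \<partial>?N) = (\<integral>\<^sup>+x. ennreal (\<psi> x) \<partial>?N)"
      using int\<psi> by (intro nn_integral_eq_integral[symmetric]) (auto simp: \<psi>0)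
    also have "\<dots> \<le> ennreal C" using mom by (simp add: \<psi>_def)
    finally show "(\<integral>x. \<psi> x \<partial>?N) \<le> C" using 1 by (auto simp: ennreal_le_iff2)
    with 1 show "1 \<le> C" by linarith
  qed
  \<comment> \<open>This bound gives all integrability needed below, and settles the case of large \<open>L\<close>.\<close>
  have b2: "exp (2 * \<bar>X x\<bar>) \<le> exp (L\<^sup>2 / \<alpha>) * \<psi> x" for x
  proof -
    have "0 \<le> (L / sqrt \<alpha> - sqrt \<alpha> * norm (x - m))\<^sup>2" by simp
    also have "\<dots> = L\<^sup>2 / \<alpha> + \<alpha> * (norm (x - m))\<^sup>2 - 2 * (L * norm (x - m))"
      using \<alpha> by (simp add: power2_diff power_divide power_mult_distrib)
    finally have "2 * \<bar>X x\<bar> \<le> L\<^sup>2 / \<alpha> + \<alpha> * (norm (x - m))\<^sup>2" using X[of x] by linarith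
    then show ?thesis by (simp add: \<psi>_def exp_add[symmetric])
  qed
  have i2: "integrable ?N (\<lambda>x. exp (2 * \<bar>X x\<bar>))"
    by (rule Bochner_Integration.integrable_bound[where f="\<lambda>x. exp (L\<^sup>2 / \<alpha>) * \<psi> x"])
      (use int\<psi> b2 \<psi>1 in \<open>auto intro!: AE_I2 simp: \<psi>0\<close>)
  have ip: "integrable ?N (\<lambda>x. exp (2 * X x))" and im: "integrable ?N (\<lambda>x. exp (- 2 * X x))"
    by (rule Bochner_Integration.integrable_bound[OF i2]; auto)+
  have iX: "integrable ?N X"
  proof (rule Bochner_Integration.integrable_bound[OF i2])
    have "\<bar>X x\<bar> \<le> exp (2 * \<bar>X x\<bar>)" for x
      using exp_ge_add_one_self[of "2 * \<bar>X x\<bar>"] by linarith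
    then show "AE x in ?N. norm (X x) \<le> norm (exp (2 * \<bar>X x\<bar>))" by auto
  qed auto
  define A where "A = (\<integral>x. exp (2 * X x) \<partial>?N)"
  define B where "B = (\<integral>x. exp (- 2 * X x) \<partial>?N)"
  have A0: "0 \<le> A" and B0: "0 \<le> B" by (auto simp: A_def B_def)
  have AB: "A * B \<le> exp (L\<^sup>2 * ((2 + 8 * (C - 1)) / \<alpha>))"
  proof (cases "4 * L\<^sup>2 \<le> \<alpha>")
    case False
    have Cexp: "C \<le> exp (C - 1)" using exp_ge_add_one_self[of "C - 1"] by simp
    have "A \<le> (\<integral>x. exp (L\<^sup>2 / \<alpha>) * \<psi> x \<partial>?N)"
      unfolding A_def using ip int\<psi> by (intro integral_mono order_trans[OF _ b2]) auto
    also have "\<dots> \<le> exp (L\<^sup>2 / \<alpha>) * C" using E\<psi> by simp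
    finally have A: "A \<le> exp (L\<^sup>2 / \<alpha>) * C" .
    have "B \<le> (\<integral>x. exp (L\<^sup>2 / \<alpha>) * \<psi> x \<partial>?N)"
      unfolding B_def using im int\<psi> by (intro integral_mono order_trans[OF _ b2]) auto
    also have "\<dots> \<le> exp (L\<^sup>2 / \<alpha>) * C" using E\<psi> by simp
    finally have B: "B \<le> exp (L\<^sup>2 / \<alpha>) * C" .
    have "A * B \<le> (exp (L\<^sup>2 / \<alpha>) * C) * (exp (L\<^sup>2 / \<alpha>) * C)"
      using A B A0 B0 C1 by (intro mult_mono) auto
    also have "\<dots> \<le> (exp (L\<^sup>2 / \<alpha>) * exp (C - 1)) * (exp (L\<^sup>2 / \<alpha>) * exp (C - 1))"
      using Cexp C1 by (intro mult_mono) auto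
    also have "\<dots> = exp (2 * (L\<^sup>2 / \<alpha>) + 2 * (C - 1) * 1)"
      by (simp add: exp_add[symmetric] algebra_simps)
    also have "\<dots> \<le> exp (2 * (L\<^sup>2 / \<alpha>) + 2 * (C - 1) * (4 * L\<^sup>2 / \<alpha>))"
      using False \<alpha> C1 by (intro exp_le_cancel_iff[THEN iffD2] add_left_mono mult_left_mono) auto
    also have "2 * (L\<^sup>2 / \<alpha>) + 2 * (C - 1) * (4 * L\<^sup>2 / \<alpha>) = L\<^sup>2 * ((2 + 8 * (C - 1)) / \<alpha>)"
      using \<alpha> by (simp add: field_simps)
    finally show ?thesis .
  next
    case True
    \<comment> \<open>As \<open>\<theta> \<le> 1\<close>, convexity of the exponential interpolates \<open>exp (4 * X\<^sup>2)\<close> between \<open>1\<close> and \<open>\<psi>\<close>.\<close>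
    define \<theta> where "\<theta> = 4 * L\<^sup>2 / \<alpha>"
    have \<theta>: "0 \<le> \<theta>" "\<theta> \<le> 1" using True \<alpha> by (auto simp: \<theta>_def)
    have b: "exp (t * X x) \<le> t * X x + (1 + \<theta> * (\<psi> x - 1))" if t: "t\<^sup>2 = 4" for t x
    proof -
      have "(t * X x)\<^sup>2 = 4 * \<bar>X x\<bar>\<^sup>2" using t by (simp add: power_mult_distrib)
      also have "\<dots> \<le> 4 * (L * norm (x - m))\<^sup>2"
        using X[of x] by (intro mult_left_mono power_mono) auto
      also have "\<dots> = (1 - \<theta>) * 0 + \<theta> * (\<alpha> * (norm (x - m))\<^sup>2)"
        using \<alpha> by (simp add: \<theta>_def power_mult_distrib)
      finally have "exp ((t * X x)\<^sup>2) \<le> exp ((1 - \<theta>) * 0 + \<theta> * (\<alpha> * (norm (x - m))\<^sup>2))" by simp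
      also have "\<dots> \<le> (1 - \<theta>) * exp 0 + \<theta> * exp (\<alpha> * (norm (x - m))\<^sup>2)"
        using \<theta> convex_onD[OF exp_convex, of \<theta> 0 "\<alpha> * (norm (x - m))\<^sup>2"] by simp
      also have "\<dots> = 1 + \<theta> * (\<psi> x - 1)" by (simp add: \<psi>_def algebra_simps)
      finally show ?thesis using exp_le_add_exp_square[of "t * X x"] by linarith
    qed
    define e where "e = (\<integral>x. X x \<partial>?N)"
    define M where "M = 1 + \<theta> * (C - 1)"
    have up: "(\<integral>x. exp (t * X x) \<partial>?N) \<le> t * e + M"
      if t: "t\<^sup>2 = 4" and i: "integrable ?N (\<lambda>x. exp (t * X x))" for t
    proof -
      have "(\<integral>x. exp (t * X x) \<partial>?N) \<le> (\<integral>x. t * X x + (1 + \<theta> * (\<psi> x - 1)) \<partial>?N)"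
        using i iX int\<psi> b[OF t] by (intro integral_mono) auto
      also have "\<dots> = t * e + (1 + \<theta> * ((\<integral>x. \<psi> x \<partial>?N) - 1))"
        using iX int\<psi> N.prob_space by (simp add: e_def)
      also have "\<dots> \<le> t * e + M"
        unfolding M_def using \<theta> E\<psi> by (intro add_left_mono mult_left_mono) auto
      finally show ?thesis .
    qed
    have "A \<le> 2 * e + M" "B \<le> - 2 * e + M"
      using up[of 2] up[of "- 2"] ip im by (auto simp: A_def B_def)
    \<comment> \<open>The linear terms \<open>\<plusminus> 2 * e\<close> of the two factors only contribute \<open>- (2 * e)\<^sup>2\<close>.\<close>
    then have "A * B \<le> (2 * e + M) * (- 2 * e + M)"
      using A0 B0 by (intro mult_mono) auto
    also have "\<dots> = M\<^sup>2 - (2 * e)\<^sup>2" by (simp add: algebra_simps power2_eq_square)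
    also have "\<dots> \<le> M\<^sup>2" by simp
    also have "\<dots> \<le> (exp (\<theta> * (C - 1)))\<^sup>2"
      unfolding M_def using \<theta> C1 by (intro power_mono) (auto intro: add_nonneg_nonneg)
    also have "\<dots> = exp (8 * (C - 1) * (L\<^sup>2 / \<alpha>))"
    proof -
      have "\<theta> * (C - 1) + \<theta> * (C - 1) = 8 * (C - 1) * (L\<^sup>2 / \<alpha>)"
        using \<alpha> by (simp add: \<theta>_def field_simps)
      then show ?thesis by (simp only: power2_eq_square[of "exp _"] exp_add[symmetric])
    qed
    also have "\<dots> \<le> exp (L\<^sup>2 * ((2 + 8 * (C - 1)) / \<alpha>))"
      using \<alpha> C1 by (simp add: field_simps)
    finally show ?thesis .
  qed
  have ief: "integrable ?N (\<lambda>x. exp (f x * 2))" "integrable ?N (\<lambda>x. exp (- f x * 2))"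
  proof -
    have "exp (f x * 2) = exp (2 * f m) * exp (2 * X x)" "exp (- f x * 2) = exp (- 2 * f m) * exp (- 2 * X x)" for x
      by (auto simp: X_def exp_add[symmetric] algebra_simps)
    then show "integrable ?N (\<lambda>x. exp (f x * 2))" "integrable ?N (\<lambda>x. exp (- f x * 2))"
      using ip im by auto
  qed
  have d: "gibbs \<Phi>1 = density ?N (\<lambda>x. ennreal (exp (f x)))"
    by (simp add: density_gibbs f_def)
  have ie: "integrable ?N (\<lambda>x. exp (f x))"
  proof (rule Bochner_Integration.integrable_bound[where f="\<lambda>x. exp (f x * 2) + 1"])
    have "exp (f x) \<le> exp (f x * 2) + 1" for x
    proof (cases "f x \<ge> 0")
      case True
      then show ?thesis using exp_le_cancel_iff[of "f x" "f x * 2"] by linarith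
    next
      case False
      then have "exp (f x) \<le> 1" by simp
      then show ?thesis using exp_gt_zero[of "f x * 2"] by linarith
    qed
    then show "AE x in ?N. norm (exp (f x)) \<le> norm (exp (f x * 2) + 1)"
      by (auto intro!: AE_I2 simp: abs_of_nonneg add_nonneg_nonneg)
  qed (use ief in auto)
  have E1: "(\<integral>x. exp (f x) \<partial>?N) = 1"
  proof -
    interpret D: prob_space "density ?N (\<lambda>x. ennreal (exp (f x)))" using p1 by (simp add: d)
    have "(\<integral>\<^sup>+x. ennreal (exp (f x)) \<partial>?N) = 1"
      using D.emeasure_space_1 emeasure_density_space[of "\<lambda>x. ennreal (exp (f x))" ?N] by simp
    then show ?thesis by (simp add: integral_eq_nn_integral)
  qed
  have ief1: "integrable ?N (\<lambda>x. exp (f x) * f x)"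
  proof (rule Bochner_Integration.integrable_bound[where f="\<lambda>x. exp (f x * 2) + 1"])
    have "\<bar>exp (f x) * f x\<bar> \<le> exp (f x * 2) + 1" for x
    proof -
      have "\<bar>exp (f x) * f x\<bar> \<le> exp (f x) * exp \<bar>f x\<bar>"
      proof -
        have "\<bar>f x\<bar> \<le> exp \<bar>f x\<bar>" using exp_ge_add_one_self[of "\<bar>f x\<bar>"] by linarith
        then show ?thesis by (simp add: abs_mult)
      qed
      also have "\<dots> = exp (f x + \<bar>f x\<bar>)" by (simp add: exp_add)
      also have "\<dots> \<le> exp (f x * 2) + 1"
        by (cases "f x \<ge> 0") (auto simp: mult.commute)
      finally show ?thesis .
    qed
    then show "AE x in ?N. norm (exp (f x) * f x) \<le> norm (exp (f x * 2) + 1)"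
      by (auto intro!: AE_I2 simp: abs_of_nonneg add_nonneg_nonneg)
  qed (use ief in auto)
  define c where "c = (\<integral>x. exp (f x * 2) \<partial>?N)"
  define c' where "c' = (\<integral>x. exp (- f x * 2) \<partial>?N)"
  have c'1: "1 \<le> c'"
  proof -
    have "3 - 2 * exp (f x) \<le> exp (- f x * 2)" for x
    proof -
      define u where "u = exp (f x)"
      have u: "u > 0" by (simp add: u_def)
      \<comment> \<open>The tangent of \<open>u\<^sup>-\<^sup>2\<close> at \<open>u = 1\<close> is \<open>3 - 2 * u\<close>.\<close>
      have "0 \<le> (u - 1)\<^sup>2 * (2 * u + 1)" using u by auto
      also have "\<dots> = 1 - (3 - 2 * u) * u\<^sup>2" by (simp add: power2_eq_square algebra_simps)
      finally have "3 - 2 * u \<le> 1 / u\<^sup>2" using u by (simp add: field_simps)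
      also have "1 / u\<^sup>2 = exp (- f x * 2)"
        by (simp add: u_def exp_minus exp_double[symmetric] mult.commute field_simps)
      finally show ?thesis by (simp add: u_def)
    qed
    then have "(\<integral>x. 3 - 2 * exp (f x) \<partial>?N) \<le> c'"
      unfolding c'_def using ie ief by (intro integral_mono) auto
    moreover have "(\<integral>x. 3 - 2 * exp (f x) \<partial>?N) = 1"
      using ie E1 N.prob_space by simp
    ultimately show ?thesis by simp
  qed
  have cc: "c * c' = A * B"
  proof -
    have "c = exp (2 * f m) * A"
      unfolding c_def A_def by (subst integral_mult_right_zero[symmetric])
        (auto simp: X_def exp_add[symmetric] algebra_simps intro!: Bochner_Integration.integral_cong)
    moreover have "c' = exp (- 2 * f m) * B"
      unfolding c'_def B_def by (subst integral_mult_right_zero[symmetric])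
        (auto simp: X_def exp_add[symmetric] algebra_simps intro!: Bochner_Integration.integral_cong)
    moreover have "exp (2 * f m) * exp (- 2 * f m) = 1" by (simp add: exp_add[symmetric])
    ultimately show ?thesis by (simp add: algebra_simps)
  qed
  \<comment> \<open>Expanding \<open>E ((exp f - 1)\<^sup>2) \<ge> 0\<close> even gives \<open>c \<ge> 1\<close>.\<close>
  have c0: "0 < c"
  proof -
    have "0 \<le> (\<integral>x. (exp (f x) - 1)\<^sup>2 \<partial>?N)" by simp
    also have "(\<integral>x. (exp (f x) - 1)\<^sup>2 \<partial>?N) = (\<integral>x. exp (f x * 2) - 2 * exp (f x) + 1 \<partial>?N)"
      by (intro Bochner_Integration.integral_cong refl)
        (simp add: power2_eq_square algebra_simps exp_add[symmetric])
    also have "\<dots> = c - 1"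
      using ie ief E1 N.prob_space by (simp add: c_def)
    finally show ?thesis by simp
  qed
  have "c * 1 \<le> c * c'" using c0 c'1 by (intro mult_left_mono) auto
  then have lnc: "ln c \<le> L\<^sup>2 * ((2 + 8 * (C - 1)) / \<alpha>)"
    using AB c0 unfolding cc
    by (metis exp_ln exp_le_cancel_iff mult.right_neutral order_trans)
  have "(\<integral>x. exp (f x) * f x \<partial>?N) \<le> (\<integral>x. exp (f x * 2) / c + (ln c - 1) * exp (f x) \<partial>?N)"
  proof (rule integral_mono)
    fix x
    have "ln (exp (f x) / c) \<le> exp (f x) / c - 1"
      using c0 by (intro ln_le_minus_one) auto
    then have "f x \<le> exp (f x) / c + (ln c - 1)"
      using c0 by (simp add: ln_div)
    then have "exp (f x) * f x \<le> exp (f x) * (exp (f x) / c + (ln c - 1))"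
      by (intro mult_left_mono) auto
    also have "\<dots> = exp (f x * 2) / c + (ln c - 1) * exp (f x)"
      by (simp add: algebra_simps exp_add[symmetric])
    finally show "exp (f x) * f x \<le> exp (f x * 2) / c + (ln c - 1) * exp (f x)" .
  qed (use ie ief ief1 in auto)
  also have "\<dots> = ln c"
    using ie ief E1 c0 by (simp add: c_def[symmetric])
  finally have H: "(\<integral>x. exp (f x) * f x \<partial>?N) \<le> ln c" .
  have "rel_entropy (gibbs \<Phi>1) ?N = ennreal (\<integral>x. exp (f x) * f x \<partial>?N)"
    unfolding d using rel_entropy_eq_integral_ln[OF p2, of "\<lambda>x. exp (f x)"] ief1
    by (simp add: integrable_density integral_density)
  also have "\<dots> \<le> ennreal (L\<^sup>2 * ((2 + 8 * (C - 1)) / \<alpha>))"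
    using H lnc by (intro ennreal_leI) linarith
  finally show ?thesis .
qed

section \<open>Gaussian moments and convexity of potentials\<close>

lemma nn_integral_lborel_affine:
  fixes t :: "'a::euclidean_space"
  assumes [measurable]: "f \<in> borel_measurable borel" and c: "c > 0"
  shows "(\<integral>\<^sup>+x. f x \<partial>lborel) = ennreal (c ^ DIM('a)) * (\<integral>\<^sup>+x. f (t + c *\<^sub>R x) \<partial>lborel)"
  using c by (subst lborel_affine[of c t])
    (auto simp: nn_integral_density nn_integral_distr nn_integral_cmult)

text \<open>Let \<open>m\<close> almost minimise \<open>\<Phi>\<close>. Midpoint convexity of \<open>\<Phi> + \<beta> - a / 2 * |x|\<^sup>2\<close> on the segment from \<open>m\<close> to
\<open>m + z\<close> shows that \<open>\<Phi>\<close> grows between \<open>m + z / 2\<close> and \<open>m + z\<close> by nearly \<open>a / 4 * |z|\<^sup>2 - k * |z|\<close>, which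
exceeds \<open>a / 8 * |z|\<^sup>2\<close> up to a constant. Thus the integrand \<open>exp (a / 8 * |z|\<^sup>2 - \<Phi> (m + z))\<close> is bounded
by a constant times \<open>exp (- \<Phi> (m + z / 2))\<close>, whose integral is \<open>2 ^ d\<close> by scaling.\<close>

lemma exp_moment_strongly_convex_mod_lipschitz:
  fixes \<Phi> :: "real^'d \<Rightarrow> real"
  assumes cont: "continuous_on UNIV \<Phi>" and prob: "prob_space (gibbs \<Phi>)"
    and a: "a > 0" and k: "k \<ge> 0"
    and lip: "\<And>x y. \<bar>\<beta> x - \<beta> y\<bar> \<le> k * norm (x - y)"
    and conv: "convex_on UNIV (\<lambda>x. \<Phi> x + \<beta> x - a / 2 * (norm x)\<^sup>2)"
  shows "\<exists>m. (\<integral>\<^sup>+x. ennreal (exp (a / 8 * (norm (x - m))\<^sup>2)) \<partial>gibbs \<Phi>)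
    \<le> ennreal (2 ^ CARD('d) * exp (2 * k\<^sup>2 / a + 1))"
proof -
  define G where "G x = \<Phi> x + \<beta> x - a / 2 * (norm x)\<^sup>2" for x
  have [measurable]: "\<Phi> \<in> borel_measurable borel" using cont by (rule borel_measurable_continuous_onI)
  have "bounded (\<Phi> ` cball 0 1)"
    by (intro compact_imp_bounded compact_continuous_image continuous_on_subset[OF cont]) auto
  then obtain M where M: "\<And>x. norm x \<le> 1 \<Longrightarrow> \<bar>\<Phi> x\<bar> \<le> M"
    unfolding bounded_iff by (metis image_eqI mem_cball_0 real_norm_def)
  define N where "N = 2 * M + k + a / 2"
  have M0: "0 \<le> M" using M[of 0] by simp
  have N0: "0 \<le> N" using M0 k a by (simp add: N_def)
  \<comment> \<open>Outside the unit ball, convexity along the ray from \<open>0\<close> yields an affine lower bound, which the quadratic term dominates.\<close>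
  have lower: "\<Phi> x \<ge> \<Phi> 0 - M - N - (N + k)\<^sup>2 / (2 * a)" for x
  proof (cases "norm x \<le> 1")
    case True
    then have "\<bar>\<Phi> x\<bar> \<le> M" "\<bar>\<Phi> 0\<bar> \<le> M" using M by auto
    moreover have "0 \<le> (N + k)\<^sup>2 / (2 * a)" using a by simp
    ultimately show ?thesis using M0 k a unfolding N_def by linarith
  next
    case False
    define r where "r = norm x"
    have r: "r > 1" using False by (simp add: r_def)
    let ?e = "(1 / r) *\<^sub>R x"
    have ne: "norm ?e = 1" using r unfolding r_def by (simp, force)
    have "G ((1 - 1 / r) *\<^sub>R 0 + (1 / r) *\<^sub>R x) \<le> (1 - 1 / r) * G 0 + 1 / r * G x"
      using r by (intro convex_onD[OF conv[folded G_def]]) auto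
    then have "r * G ?e \<le> r * ((1 - 1 / r) * G 0 + 1 / r * G x)"
      using r by (intro mult_left_mono) auto
    then have 1: "G x \<ge> G 0 + r * (G ?e - G 0)"
      using r by (simp add: algebra_simps)
    have "\<bar>\<Phi> ?e\<bar> \<le> M" "\<bar>\<Phi> 0\<bar> \<le> M" using M ne by auto
    moreover have "\<bar>\<beta> ?e - \<beta> 0\<bar> \<le> k" using lip[of ?e 0] unfolding diff_zero ne by simp
    ultimately have "G ?e - G 0 \<ge> - N"
      unfolding G_def N_def ne norm_zero by simp
    then have "r * (G ?e - G 0) \<ge> r * (- N)" using r by (intro mult_left_mono) auto
    with 1 have 2: "G x \<ge> G 0 - r * N" by simp
    have "\<bar>\<beta> x - \<beta> 0\<bar> \<le> k * r" using lip[of x 0] by (simp add: r_def)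
    with 2 have 3: "\<Phi> x \<ge> \<Phi> 0 + a / 2 * r\<^sup>2 - r * N - k * r"
      unfolding G_def r_def[symmetric] by simp
    have "0 \<le> (a * r - (N + k))\<^sup>2 / (2 * a)" using a by simp
    also have "\<dots> = a / 2 * r\<^sup>2 - r * N - k * r + (N + k)\<^sup>2 / (2 * a)"
      using a by (simp add: power2_eq_square field_simps)
    finally show ?thesis using 3 M0 N0 by linarith
  qed
  \<comment> \<open>A minimum up to \<open>1\<close> is enough; this costs the factor \<open>exp 1\<close> in the final bound.\<close>
  have "\<exists>m. \<forall>x. \<Phi> m \<le> \<Phi> x + 1"
  proof -
    have bb: "bdd_below (range \<Phi>)" using lower by (intro bdd_belowI2)
    have "Inf (range \<Phi>) < Inf (range \<Phi>) + 1" by simp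
    then obtain m where "\<Phi> m < Inf (range \<Phi>) + 1"
      using cInf_lessD[of "range \<Phi>" "Inf (range \<Phi>) + 1"] by auto
    moreover have "Inf (range \<Phi>) \<le> \<Phi> x" for x using bb by (intro cInf_lower) auto
    ultimately show ?thesis by (metis add_right_mono less_le_not_le order_trans less_imp_le)
  qed
  then obtain m where m: "\<And>x. \<Phi> m \<le> \<Phi> x + 1" by blast
  have growth: "\<Phi> (m + z) - \<Phi> (m + (1/2) *\<^sub>R z) \<ge> a / 8 * (norm z)\<^sup>2 - 2 * k\<^sup>2 / a - 1" for z
  proof -
    let ?h = "m + (1/2) *\<^sub>R z"
    have "G ((1 - 1/2) *\<^sub>R m + (1/2) *\<^sub>R (m + z)) \<le> (1 - 1/2) * G m + 1/2 * G (m + z)"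
      by (intro convex_onD[OF conv[folded G_def]]) auto
    moreover have "(1 - 1/2) *\<^sub>R m + (1/2) *\<^sub>R (m + z) = ?h"
      by (simp add: vec_eq_iff field_simps)
    ultimately have 1: "2 * G ?h \<le> G m + G (m + z)" by simp
    have n: "(norm (m + z))\<^sup>2 - 2 * (norm ?h)\<^sup>2 + (norm m)\<^sup>2 = (norm z)\<^sup>2 / 2"
      by (simp add: power2_norm_eq_inner inner_add_left inner_add_right inner_commute field_simps)
    have b1: "\<bar>\<beta> (m + z) - \<beta> ?h\<bar> \<le> k * (norm z / 2)"
    proof -
      have "m + z - ?h = (1/2) *\<^sub>R z"
        by (simp add: vec_eq_iff field_simps)
      then have "norm (m + z - ?h) = norm z / 2" by (simp only: norm_scaleR)
      then show ?thesis using lip[of "m + z" ?h] by (simp only:)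
    qed
    have b2: "\<bar>\<beta> m - \<beta> ?h\<bar> \<le> k * (norm z / 2)"
      using lip[of m ?h] by simp
    have 2: "\<Phi> (m + z) - \<Phi> ?h \<ge> \<Phi> ?h - \<Phi> m + a / 2 * ((norm z)\<^sup>2 / 2) - k * norm z"
    proof -
      have "\<Phi> (m + z) + \<beta> (m + z) + \<Phi> m + \<beta> m - 2 * \<Phi> ?h - 2 * \<beta> ?h
          \<ge> a / 2 * ((norm (m + z))\<^sup>2 - 2 * (norm ?h)\<^sup>2 + (norm m)\<^sup>2)"
        using 1 unfolding G_def by (simp add: algebra_simps)
      then show ?thesis unfolding n using b1 b2 by linarith
    qed
    have "0 \<le> (a * norm z - 4 * k)\<^sup>2 / (8 * a)" using a by simp
    also have "\<dots> = a / 2 * ((norm z)\<^sup>2 / 2) - k * norm z - (a / 8 * (norm z)\<^sup>2 - 2 * k\<^sup>2 / a)"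
      using a by (simp add: power2_eq_square field_simps)
    finally show ?thesis using 2 m[of ?h] by linarith
  qed
  let ?c = "2 * k\<^sup>2 / a + 1"
  have half: "(\<integral>\<^sup>+z. ennreal (exp (- \<Phi> (m + (1/2) *\<^sub>R z))) \<partial>lborel) = ennreal (2 ^ CARD('d))"
  proof -
    have "1 = (\<integral>\<^sup>+x. ennreal (exp (- \<Phi> x)) \<partial>lborel)"
      using prob_space.emeasure_space_1[OF prob]
        emeasure_density_space[of "\<lambda>x. ennreal (exp (- \<Phi> x))" lborel]
      by (simp add: gibbs_def)
    also have "\<dots> = ennreal ((1/2) ^ CARD('d)) * (\<integral>\<^sup>+z. ennreal (exp (- \<Phi> (m + (1/2) *\<^sub>R z))) \<partial>lborel)"
      by (subst nn_integral_lborel_affine[of _ "1/2" m]) auto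
    finally have "ennreal (2 ^ CARD('d)) * 1 = ennreal (2 ^ CARD('d)) * (ennreal ((1/2) ^ CARD('d)) *
        (\<integral>\<^sup>+z. ennreal (exp (- \<Phi> (m + (1/2) *\<^sub>R z))) \<partial>lborel))"
      by simp
    also have "\<dots> = (\<integral>\<^sup>+z. ennreal (exp (- \<Phi> (m + (1/2) *\<^sub>R z))) \<partial>lborel)"
      by (subst mult.assoc[symmetric], subst ennreal_mult'[symmetric])
        (auto simp: power_mult_distrib[symmetric])
    finally show ?thesis by simp
  qed
  have "(\<integral>\<^sup>+x. ennreal (exp (a / 8 * (norm (x - m))\<^sup>2)) \<partial>gibbs \<Phi>)
      = (\<integral>\<^sup>+x. ennreal (exp (- \<Phi> x)) * ennreal (exp (a / 8 * (norm (x - m))\<^sup>2)) \<partial>lborel)"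
    unfolding gibbs_def by (subst nn_integral_density) auto
  also have "\<dots> = (\<integral>\<^sup>+x. ennreal (exp (a / 8 * (norm (x - m))\<^sup>2 - \<Phi> x)) \<partial>lborel)"
    by (intro nn_integral_cong) (auto simp: ennreal_mult'[symmetric] exp_add[symmetric])
  also have "\<dots> = (\<integral>\<^sup>+z. ennreal (exp (a / 8 * (norm z)\<^sup>2 - \<Phi> (m + z))) \<partial>lborel)"
    by (subst nn_integral_lborel_affine[of _ 1 m]) auto
  also have "\<dots> \<le> (\<integral>\<^sup>+z. ennreal (exp ?c) * ennreal (exp (- \<Phi> (m + (1/2) *\<^sub>R z))) \<partial>lborel)"
  proof (intro nn_integral_mono)
    fix z
    have "exp (a / 8 * (norm z)\<^sup>2 - \<Phi> (m + z)) \<le> exp (?c + - \<Phi> (m + (1/2) *\<^sub>R z))"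
      using growth[of z] by simp
    then show "ennreal (exp (a / 8 * (norm z)\<^sup>2 - \<Phi> (m + z)))
        \<le> ennreal (exp ?c) * ennreal (exp (- \<Phi> (m + (1/2) *\<^sub>R z)))"
      by (subst ennreal_mult'[symmetric]) (auto simp: exp_add[symmetric] intro!: ennreal_leI)
  qed
  also have "\<dots> = ennreal (exp ?c) * ennreal (2 ^ CARD('d))"
    by (subst nn_integral_cmult) (auto simp: half)
  also have "\<dots> = ennreal (2 ^ CARD('d) * exp ?c)"
    by (subst ennreal_mult'[symmetric]) (auto simp: mult.commute)
  finally show ?thesis by blast
qed

text \<open>The hypothesis says \<open>F x = ln (\<integral> exp (g y x + c y) dM)\<close>. Subtracting the
convex combination of the values of \<open>F\<close> in the exponent normalises both endpoints to integral \<open>1\<close>, so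
convexity of the exponential function bounds the integral at the intermediate point by \<open>1\<close>.\<close>

lemma convex_on_log_partition:
  fixes F :: "'a::real_vector \<Rightarrow> real"
  assumes conv: "\<And>y. convex_on UNIV (g y)"
    and meas: "\<And>x. (\<lambda>y. g y x + c y) \<in> borel_measurable M"
    and one: "\<And>x. (\<integral>\<^sup>+y. ennreal (exp (g y x - F x + c y)) \<partial>M) = 1"
  shows "convex_on UNIV F"
proof (rule convex_onI)
  fix t :: real and x1 x2 assume t: "0 < t" "t < 1"
  have [measurable]: "(\<lambda>y. g y x - b + c y) \<in> borel_measurable M" for x b
  proof -
    have "(\<lambda>y. (g y x + c y) - b) \<in> borel_measurable M" using meas by measurable
    then show ?thesis by (simp add: algebra_simps)
  qed
  let ?x = "(1 - t) *\<^sub>R x1 + t *\<^sub>R x2" and ?F = "(1 - t) * F x1 + t * F x2"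
  have pt: "exp (g y ?x - ?F + c y) \<le> (1 - t) * exp (g y x1 - F x1 + c y) + t * exp (g y x2 - F x2 + c y)" for y
  proof -
    have "g y ?x - ?F + c y \<le> (1 - t) *\<^sub>R (g y x1 - F x1 + c y) + t *\<^sub>R (g y x2 - F x2 + c y)"
      using convex_onD[OF conv[of y], of t x1 x2] t by (simp add: algebra_simps)
    then have "exp (g y ?x - ?F + c y) \<le> exp ((1 - t) *\<^sub>R (g y x1 - F x1 + c y) + t *\<^sub>R (g y x2 - F x2 + c y))"
      by (rule exp_le_cancel_iff[THEN iffD2])
    also have "\<dots> \<le> (1 - t) * exp (g y x1 - F x1 + c y) + t * exp (g y x2 - F x2 + c y)"
      using t by (intro convex_onD[OF exp_convex]) auto
    finally show ?thesis .
  qed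
  have shift: "ennreal (exp (F x - b)) = (\<integral>\<^sup>+y. ennreal (exp (g y x - b + c y)) \<partial>M)" for x b
  proof -
    have "ennreal (exp (F x - b)) = ennreal (exp (F x - b)) * (\<integral>\<^sup>+y. ennreal (exp (g y x - F x + c y)) \<partial>M)"
      by (simp add: one)
    also have "\<dots> = (\<integral>\<^sup>+y. ennreal (exp (g y x - b + c y)) \<partial>M)"
      by (subst nn_integral_cmult[symmetric])
        (auto simp: ennreal_mult'[symmetric] exp_add[symmetric] intro!: nn_integral_cong)
    finally show ?thesis .
  qed
  have "ennreal (exp (F ?x - ?F)) = (\<integral>\<^sup>+y. ennreal (exp (g y ?x - ?F + c y)) \<partial>M)"
    by (rule shift)
  also have "\<dots> \<le> (\<integral>\<^sup>+y. ennreal (1 - t) * ennreal (exp (g y x1 - F x1 + c y))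
      + ennreal t * ennreal (exp (g y x2 - F x2 + c y)) \<partial>M)"
  proof (intro nn_integral_mono)
    fix y
    show "ennreal (exp (g y ?x - ?F + c y)) \<le> ennreal (1 - t) * ennreal (exp (g y x1 - F x1 + c y))
      + ennreal t * ennreal (exp (g y x2 - F x2 + c y))"
      using t ennreal_leI[OF pt[of y]] by (simp add: ennreal_plus ennreal_mult')
  qed
  also have "\<dots> = ennreal (1 - t) * 1 + ennreal t * 1"
    by (subst nn_integral_add; (subst nn_integral_cmult)?) (auto simp: one nn_integral_cmult)
  also have "\<dots> = 1" using t by (simp add: ennreal_plus[symmetric] del: ennreal_plus)
  finally have "exp (F ?x - ?F) \<le> 1" by simp
  then show "F ?x \<le> ?F" by simp
qed simp

text \<open>The derivatives of a section are derivatives of the full function in directions \<open>(h, 0)\<close>.\<close>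

section \<open>Second derivatives along lines\<close>

lemma Ck_section: "Ck k F \<Longrightarrow> Ck k (\<lambda>x. F (x, y))"
proof (induction k arbitrary: F)
  case 0
  then show ?case by (auto intro!: continuous_on_compose2[of UNIV F] continuous_intros)
next
  case (Suc k)
  then have dF: "F differentiable at z" for z by (cases z) (auto simp: differentiable_on_def)
  have d: "((\<lambda>x. F (x, y)) has_derivative (\<lambda>h. frechet_derivative F (at (x, y)) (h, 0))) (at x)" for x
  proof -
    have "((\<lambda>x. (x, y)) has_derivative (\<lambda>h. (h, 0))) (at x)"
      by (auto intro!: derivative_eq_intros)
    moreover have "(F has_derivative frechet_derivative F (at (x, y))) (at (x, y))"
      using dF frechet_derivative_works by blast
    ultimately show ?thesis by (rule has_derivative_compose)
  qed
  then have e: "frechet_derivative (\<lambda>x. F (x, y)) (at x) h = frechet_derivative F (at (x, y)) (h, 0)" for x h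
    using frechet_derivative_at by metis
  have "(\<lambda>x. F (x, y)) differentiable_on UNIV"
    using d by (auto simp: differentiable_on_def differentiable_def)
  moreover have "Ck k (\<lambda>x. frechet_derivative F (at (x, y)) (h, 0))" for h
    using Suc.IH[of "\<lambda>z. frechet_derivative F (at z) (h, 0)"] Suc.prems by simp
  ultimately show ?case by (simp add: e)
qed

lemma smooth_section: "smooth (\<lambda>z. W (fst z) (snd z)) \<Longrightarrow> smooth (\<lambda>x. W x y)"
  unfolding smooth_def using Ck_section[of _ "\<lambda>z. W (fst z) (snd z)" y] by simp

lemma smooth_derivative:
  fixes f :: "real^'d \<Rightarrow> real"
  assumes "smooth f"
  shows "(f has_derivative (\<lambda>h. grad f x \<bullet> h)) (at x)"
proof -
  have "Ck (Suc 0) f" using assms unfolding smooth_def by blast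
  then have d: "(f has_derivative frechet_derivative f (at x)) (at x)"
    by (auto simp: differentiable_on_def frechet_derivative_works[symmetric])
  then interpret bounded_linear "frechet_derivative f (at x)" by (rule has_derivative_bounded_linear)
  have "frechet_derivative f (at x) h = grad f x \<bullet> h" for h
  proof -
    have "frechet_derivative f (at x) h = frechet_derivative f (at x) (\<Sum>i\<in>UNIV. h $ i *s axis i 1)"
      by (simp only: basis_expansion)
    also have "\<dots> = (\<Sum>i\<in>UNIV. h $ i * frechet_derivative f (at x) (axis i 1))"
      by (simp add: sum scaleR scalar_mult_eq_scaleR)
    finally show ?thesis by (simp add: grad_def inner_vec_def mult.commute)
  qed
  then show ?thesis using d by presburger
qed

lemma smooth_grad_derivative:
  fixes f :: "real^'d \<Rightarrow> real"
  assumes "smooth f"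
  shows "(grad f has_derivative (\<lambda>h. hessian f x *v h)) (at x)"
proof -
  have "Ck (Suc (Suc 0)) f" using assms unfolding smooth_def by blast
  then have d: "(\<lambda>x. frechet_derivative f (at x) h) differentiable (at x)" for h
    by (auto simp: differentiable_on_def)
  have "(\<lambda>x. grad f x \<bullet> b) differentiable (at x)" if b: "b \<in> Basis" for b
  proof -
    obtain i :: 'd and u :: real where "b = axis i u" "u \<in> Basis"
      using b unfolding Basis_vec_def by blast
    then have "b = axis i 1" by simp
    then show ?thesis using d[of "axis i 1"] by (simp add: inner_axis grad_def)
  qed
  then have "grad f differentiable (at x)"
    using differentiable_componentwise_within[of "grad f" x UNIV] by simp
  then show ?thesis unfolding hessian_def by (simp add: jacobian_works)
qed

lemma line_derivative: "((\<lambda>s. x + s *\<^sub>R h) has_derivative (\<lambda>t. t *\<^sub>R h)) (at s)"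
  by (auto intro!: derivative_eq_intros)

lemma smooth_line_derivative:
  fixes f :: "real^'d \<Rightarrow> real"
  assumes "smooth f"
  shows "((\<lambda>s. f (x + s *\<^sub>R h)) has_real_derivative (grad f (x + s *\<^sub>R h) \<bullet> h)) (at s)"
  using has_derivative_compose[OF line_derivative smooth_derivative[OF assms]]
  by (simp add: has_field_derivative_def mult_commute_abs)

lemma smooth_line_derivative2:
  fixes f :: "real^'d \<Rightarrow> real"
  assumes "smooth f"
  shows "((\<lambda>s. grad f (x + s *\<^sub>R h) \<bullet> h) has_real_derivative
    (h \<bullet> (hessian f (x + s *\<^sub>R h) *v h))) (at s)"
proof -
  have "((\<lambda>s. grad f (x + s *\<^sub>R h)) has_derivative (\<lambda>t. hessian f (x + s *\<^sub>R h) *v (t *\<^sub>R h))) (at s)"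
    by (rule has_derivative_compose[OF line_derivative smooth_grad_derivative[OF assms]])
  from has_derivative_inner_left[OF this, of h]
  show ?thesis
    by (simp add: has_field_derivative_def mult_commute_abs inner_commute[of h]
        matrix_vector_mult_scaleR)
qed

lemma quadratic_line_derivative:
  fixes A :: "real^'d^'d"
  shows "((\<lambda>s. (x + s *\<^sub>R h) \<bullet> (A *v (x + s *\<^sub>R h))) has_real_derivative
      ((x + s *\<^sub>R h) \<bullet> (A *v h) + h \<bullet> (A *v (x + s *\<^sub>R h)))) (at s)"
    and "((\<lambda>s. (x + s *\<^sub>R h) \<bullet> (A *v h) + h \<bullet> (A *v (x + s *\<^sub>R h))) has_real_derivative
      (2 * (h \<bullet> (A *v h)))) (at s)"
proof -
  have e: "A *v (x + s *\<^sub>R h) = A *v x + s *\<^sub>R (A *v h)" for s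
    by (simp add: matrix_vector_right_distrib matrix_vector_mult_scaleR)
  show "((\<lambda>s. (x + s *\<^sub>R h) \<bullet> (A *v (x + s *\<^sub>R h))) has_real_derivative
      ((x + s *\<^sub>R h) \<bullet> (A *v h) + h \<bullet> (A *v (x + s *\<^sub>R h)))) (at s)"
    unfolding e inner_add_left inner_add_right inner_scaleR_left inner_scaleR_right
    by (auto intro!: derivative_eq_intros simp: algebra_simps)
  show "((\<lambda>s. (x + s *\<^sub>R h) \<bullet> (A *v h) + h \<bullet> (A *v (x + s *\<^sub>R h))) has_real_derivative
      (2 * (h \<bullet> (A *v h)))) (at s)"
    unfolding e inner_add_left inner_add_right inner_scaleR_left inner_scaleR_right
    by (auto intro!: derivative_eq_intros simp: algebra_simps)
qed

lemma convex_on_if_line_derivative2_nonneg: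
  fixes g :: "'a::real_normed_vector \<Rightarrow> real"
  assumes d1: "\<And>x h s. ((\<lambda>s. g (x + s *\<^sub>R h)) has_real_derivative G1 (x + s *\<^sub>R h) h) (at s)"
    and d2: "\<And>x h s. ((\<lambda>s. G1 (x + s *\<^sub>R h) h) has_real_derivative G2 (x + s *\<^sub>R h) h) (at s)"
    and nn: "\<And>x h. G2 x h \<ge> 0"
  shows "convex_on UNIV g"
proof (rule convex_onI)
  fix t :: real and x y :: 'a assume t: "0 < t" "t < 1"
  have "convex_on UNIV (\<lambda>s. g (x + s *\<^sub>R (y - x)))"
    by (rule f''_ge0_imp_convex[OF _ d1 d2 nn]) auto
  from convex_onD[OF this, of t 0 1] t
  show "g ((1 - t) *\<^sub>R x + t *\<^sub>R y) \<le> (1 - t) * g x + t * g y"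
    by (simp add: algebra_simps)
qed simp

lemma sqrt_line_derivative:
  fixes x h :: "'a::real_inner"
  assumes D: "D > 0"
  defines "r \<equiv> \<lambda>z::'a. sqrt (D\<^sup>2 + z \<bullet> z)"
  shows "((\<lambda>s. r (x + s *\<^sub>R h)) has_real_derivative ((x + s *\<^sub>R h) \<bullet> h / r (x + s *\<^sub>R h))) (at s)"
    and "((\<lambda>s. (x + s *\<^sub>R h) \<bullet> h / r (x + s *\<^sub>R h)) has_real_derivative
      ((h \<bullet> h - ((x + s *\<^sub>R h) \<bullet> h / r (x + s *\<^sub>R h))\<^sup>2) / r (x + s *\<^sub>R h))) (at s)"
proof -
  have pos: "D\<^sup>2 + z \<bullet> z > 0" for z :: 'a using D by (intro add_pos_nonneg) auto
  have rpos: "r z > 0" for z using pos by (simp add: r_def)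
  have din: "((\<lambda>s. D\<^sup>2 + (x + s *\<^sub>R h) \<bullet> (x + s *\<^sub>R h)) has_real_derivative 2 * ((x + s *\<^sub>R h) \<bullet> h)) (at s)" for s
    unfolding inner_add_left inner_add_right inner_scaleR_left inner_scaleR_right
    by (auto intro!: derivative_eq_intros simp: algebra_simps inner_commute[of h x])
  have din2: "((\<lambda>s. (x + s *\<^sub>R h) \<bullet> h) has_real_derivative h \<bullet> h) (at s)" for s
    unfolding inner_add_left inner_scaleR_left
    by (auto intro!: derivative_eq_intros)
  show d1: "((\<lambda>s. r (x + s *\<^sub>R h)) has_real_derivative ((x + s *\<^sub>R h) \<bullet> h / r (x + s *\<^sub>R h))) (at s)" for s
  proof -
    have e: "inverse r' / 2 * (2 * p) = p / r'" for r' p :: real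
      by (simp add: field_simps)
    show ?thesis
      using DERIV_chain2[OF DERIV_real_sqrt[OF pos] din, of s] unfolding r_def e .
  qed
  show "((\<lambda>s. (x + s *\<^sub>R h) \<bullet> h / r (x + s *\<^sub>R h)) has_real_derivative
      ((h \<bullet> h - ((x + s *\<^sub>R h) \<bullet> h / r (x + s *\<^sub>R h))\<^sup>2) / r (x + s *\<^sub>R h))) (at s)"
  proof -
    have e: "(c * r' - p * (p / r')) / (r' * r') = (c - (p / r')\<^sup>2) / r'" if "r' > 0" for c r' p :: real
      using that by (simp add: field_simps power2_eq_square)
    show ?thesis
      using DERIV_divide[OF din2 d1, of s] rpos[of "x + s *\<^sub>R h"]
      unfolding e[OF rpos] by simp
  qed
qed

text \<open>The function \<open>sqrt (D\<^sup>2 + |z|\<^sup>2)\<close> is \<open>1\<close>-Lipschitz and convex, and its Hessian is bounded below on the ball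
of radius \<open>D\<close>. A multiple of it therefore repairs a lack of convexity on a ball at the expense of a
Lipschitz term.\<close>

lemma sqrt_second_derivative_ge:
  fixes z h :: "'a::real_inner"
  assumes D: "D > 0"
  defines "r \<equiv> sqrt (D\<^sup>2 + z \<bullet> z)"
  shows "0 \<le> (h \<bullet> h - (z \<bullet> h / r)\<^sup>2) / r"
    and "norm z \<le> D \<Longrightarrow> (norm h)\<^sup>2 / (4 * D) \<le> (h \<bullet> h - (z \<bullet> h / r)\<^sup>2) / r"
proof -
  have r2: "r\<^sup>2 = D\<^sup>2 + (norm z)\<^sup>2" by (simp add: r_def power2_norm_eq_inner)
  have r: "r > 0" unfolding r_def using D by (intro real_sqrt_gt_zero add_pos_nonneg) auto
  have "(z \<bullet> h)\<^sup>2 \<le> (norm z)\<^sup>2 * (norm h)\<^sup>2"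
    using Cauchy_Schwarz_ineq[of z h] by (simp add: power2_norm_eq_inner)
  moreover have "(norm h)\<^sup>2 * r\<^sup>2 = (norm h)\<^sup>2 * D\<^sup>2 + (norm z)\<^sup>2 * (norm h)\<^sup>2"
    unfolding r2 by (simp add: algebra_simps)
  ultimately have "(norm h)\<^sup>2 * D\<^sup>2 \<le> (norm h)\<^sup>2 * r\<^sup>2 - (z \<bullet> h)\<^sup>2" by linarith
  then have "(norm h)\<^sup>2 * D\<^sup>2 / r\<^sup>2 \<le> ((norm h)\<^sup>2 * r\<^sup>2 - (z \<bullet> h)\<^sup>2) / r\<^sup>2"
    by (rule divide_right_mono) simp
  also have "\<dots> = (norm h)\<^sup>2 - (z \<bullet> h / r)\<^sup>2"
    using r by (simp add: diff_divide_distrib power_divide)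
  finally have lb: "(norm h)\<^sup>2 * D\<^sup>2 / r\<^sup>2 \<le> h \<bullet> h - (z \<bullet> h / r)\<^sup>2"
    by (simp only: power2_norm_eq_inner)
  then show "0 \<le> (h \<bullet> h - (z \<bullet> h / r)\<^sup>2) / r"
    using r by (intro divide_nonneg_pos order_trans[OF _ lb]) auto
  assume "norm z \<le> D"
  then have "(norm z)\<^sup>2 \<le> D\<^sup>2" by (intro power_mono) auto
  then have r22: "r\<^sup>2 \<le> 2 * D\<^sup>2" using r2 by simp
  also have "\<dots> \<le> (2 * D)\<^sup>2" by (simp add: power_mult_distrib)
  finally have "r \<le> 2 * D" by (rule power2_le_imp_le) (use D in simp)
  then have r3: "r\<^sup>2 * r \<le> 2 * D\<^sup>2 * (2 * D)" using r22 r by (intro mult_mono) auto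
  have "(norm h)\<^sup>2 / (4 * D) = (norm h)\<^sup>2 * D\<^sup>2 / (2 * D\<^sup>2 * (2 * D))"
    using D by (simp add: field_simps)
  also have "\<dots> \<le> (norm h)\<^sup>2 * D\<^sup>2 / (r\<^sup>2 * r)"
    using r3 r D by (intro divide_left_mono) auto
  also have "\<dots> = (norm h)\<^sup>2 * D\<^sup>2 / r\<^sup>2 / r" by simp
  also have "\<dots> \<le> (h \<bullet> h - (z \<bullet> h / r)\<^sup>2) / r"
    using lb r by (intro divide_right_mono) auto
  finally show "(norm h)\<^sup>2 / (4 * D) \<le> (h \<bullet> h - (z \<bullet> h / r)\<^sup>2) / r" .
qed

text \<open>The square root is the norm of \<open>(D, x)\<close> in the product space.\<close>

lemma sqrt_lipschitz:
  fixes x y :: "'a::real_inner"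
  shows "\<bar>sqrt (D\<^sup>2 + x \<bullet> x) - sqrt (D\<^sup>2 + y \<bullet> y)\<bar> \<le> norm (x - y)"
proof -
  have n: "sqrt (D\<^sup>2 + x \<bullet> x) = norm (D, x)" for x :: 'a
    by (simp add: norm_Pair power2_norm_eq_inner)
  have "\<bar>norm (D, x) - norm (D, y)\<bar> \<le> norm ((D, x) - (D, y))" by (rule norm_triangle_ineq3)
  also have "norm ((D, x) - (D, y)) = norm (x - y)" by (simp add: norm_Pair)
  finally show ?thesis unfolding n .
qed

section \<open>Positive definite matrices\<close>

lemma pos_def_mult_inverse:
  assumes "pos_def (A :: real^'d^'d)"
  shows "A *v (matrix_inv A *v x) = x"
proof -
  have "\<forall>x. A *v x = 0 \<longrightarrow> x = 0"
    using assms unfolding pos_def_def by (metis inner_zero_right less_irrefl)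
  then have "invertible A" by (simp add: invertible_left_inverse matrix_left_invertible_ker)
  then have "A ** matrix_inv A = mat 1"
    unfolding invertible_def matrix_inv_def by (rule someI2_ex) simp
  then show ?thesis by (simp add: matrix_vector_mul_assoc)
qed

lemma symmetric_inner: "transpose A = A \<Longrightarrow> x \<bullet> (A *v y) = y \<bullet> ((A :: real^'d^'d) *v x)"
  by (metis dot_lmul_matrix inner_commute transpose_matrix_vector)

text \<open>With \<open>p = A\<^sup>-\<^sup>1 x\<close> and \<open>q = B\<^sup>-\<^sup>1 x\<close>, positivity of \<open>A\<close> at \<open>p - q\<close> gives \<open>x \<bullet> p \<ge> 2 * (x \<bullet> q) - q \<bullet> A q\<close>, and
\<open>q \<bullet> A q < q \<bullet> B q = x \<bullet> q\<close>.\<close>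

lemma matrix_inv_strict_antimono:
  fixes A B :: "real^'d^'d"
  assumes A: "pos_def A" and B: "pos_def B" and less: "loewner_less A B" and x: "x \<noteq> 0"
  shows "x \<bullet> (matrix_inv B *v x) < x \<bullet> (matrix_inv A *v x)"
proof -
  define p where "p = matrix_inv A *v x"
  define q where "q = matrix_inv B *v x"
  have Ap: "A *v p = x" and Bq: "B *v q = x"
    using pos_def_mult_inverse A B by (auto simp: p_def q_def)
  have q0: "q \<noteq> 0" using Bq x by auto
  have "0 < q \<bullet> ((B - A) *v q)" using less q0 by (simp add: loewner_less_def pos_def_def)
  then have 1: "q \<bullet> (A *v q) < q \<bullet> x" by (simp add: matrix_vector_mult_diff_rdistrib inner_diff_right Bq)
  have "0 \<le> (p - q) \<bullet> (A *v (p - q))" using A unfolding pos_def_def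
    by (cases "p - q = 0") (auto simp: less_imp_le)
  also have "\<dots> = p \<bullet> x - 2 * (q \<bullet> x) + q \<bullet> (A *v q)"
    using symmetric_inner[of A p q] A
    by (simp add: matrix_vector_mult_diff_distrib inner_diff_left inner_diff_right Ap pos_def_def)
  finally show ?thesis using 1 unfolding p_def[symmetric] q_def[symmetric]
    by (simp add: inner_commute)
qed

text \<open>The minimum of the form on the compact unit sphere serves as the constant.\<close>

lemma positive_quadratic_form_ge:
  fixes A :: "real^'d^'d"
  assumes "\<And>x. x \<noteq> 0 \<Longrightarrow> 0 < x \<bullet> (A *v x)"
  shows "\<exists>a>0. \<forall>x. a * (norm x)\<^sup>2 \<le> x \<bullet> (A *v x)"
proof -
  have ne: "sphere (0::real^'d) 1 \<noteq> {}" by simp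
  have "continuous_on (sphere 0 1) (\<lambda>x. x \<bullet> (A *v x))"
    by (intro continuous_on_inner continuous_on_id linear_continuous_on[OF matrix_vector_mul_bounded_linear])
  then obtain u where u: "u \<in> sphere 0 1" "\<And>x. x \<in> sphere 0 1 \<Longrightarrow> u \<bullet> (A *v u) \<le> x \<bullet> (A *v x)"
    using continuous_attains_inf[OF compact_sphere ne] by blast
  have "u \<bullet> (A *v u) * (norm x)\<^sup>2 \<le> x \<bullet> (A *v x)" for x
  proof (cases "x = 0")
    case False
    let ?y = "(1 / norm x) *\<^sub>R x"
    have "u \<bullet> (A *v u) \<le> ?y \<bullet> (A *v ?y)" using False by (intro u) simp
    also have "\<dots> = x \<bullet> (A *v x) / (norm x)\<^sup>2"
      by (simp add: matrix_vector_mult_scaleR power2_eq_square)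
    finally show ?thesis using False by (simp add: pos_le_divide_eq)
  qed simp
  moreover have "0 < u \<bullet> (A *v u)" using u(1) by (intro assms) auto
  ultimately show ?thesis by blast
qed

lemma quadratic_form_le:
  fixes A :: "real^'d^'d"
  shows "x \<bullet> (A *v x) \<le> onorm ((*v) A) * (norm x)\<^sup>2"
proof -
  have "x \<bullet> (A *v x) \<le> norm x * norm (A *v x)" by (rule norm_cauchy_schwarz)
  also have "\<dots> \<le> norm x * (onorm ((*v) A) * norm x)"
    by (intro mult_left_mono onorm matrix_vector_mul_bounded_linear) auto
  finally show ?thesis by (simp add: power2_eq_square algebra_simps)
qed

section \<open>Uniform entropy bounds for the Sinkhorn kernels\<close>

lemma gibbs_inject:
  assumes "gibbs f = gibbs g" "continuous_on UNIV f" "continuous_on UNIV g"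
  shows "f x = g x"
proof (rule AE_lborel_continuous_eq[where f=f and g=g])
  have [measurable]: "f \<in> borel_measurable borel" "g \<in> borel_measurable borel"
    using assms by (auto intro!: borel_measurable_continuous_onI)
  have "AE x in lborel. ennreal (exp (- f x)) = ennreal (exp (- g x))"
    using assms(1) unfolding gibbs_def
    by (subst (asm) sigma_finite_measure.density_unique_iff[OF sigma_finite_lborel]) auto
  then show "AE x in lborel. f x = g x" by eventually_elim simp
qed (fact assms)+

lemma convex_on_hessian_difference:
  fixes f g :: "real^'d \<Rightarrow> real"
  assumes f: "smooth f" and g: "smooth g"
    and le: "\<And>x. loewner_le (hessian f x - hessian g x) A"
  shows "convex_on UNIV (\<lambda>x. g x - f x + 1 / 2 * (x \<bullet> (A *v x)))"
proof (rule convex_on_if_line_derivative2_nonneg)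
  show "((\<lambda>s. g (x + s *\<^sub>R h) - f (x + s *\<^sub>R h) + 1 / 2 * ((x + s *\<^sub>R h) \<bullet> (A *v (x + s *\<^sub>R h))))
      has_real_derivative grad g (x + s *\<^sub>R h) \<bullet> h - grad f (x + s *\<^sub>R h) \<bullet> h
        + 1 / 2 * ((x + s *\<^sub>R h) \<bullet> (A *v h) + h \<bullet> (A *v (x + s *\<^sub>R h)))) (at s)" for x h s
    by (intro DERIV_add DERIV_diff DERIV_cmult smooth_line_derivative f g quadratic_line_derivative)
  show "((\<lambda>s. grad g (x + s *\<^sub>R h) \<bullet> h - grad f (x + s *\<^sub>R h) \<bullet> h
        + 1 / 2 * ((x + s *\<^sub>R h) \<bullet> (A *v h) + h \<bullet> (A *v (x + s *\<^sub>R h))))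
      has_real_derivative h \<bullet> (hessian g (x + s *\<^sub>R h) *v h) - h \<bullet> (hessian f (x + s *\<^sub>R h) *v h)
        + 1 / 2 * (2 * (h \<bullet> (A *v h)))) (at s)" for x h s
    by (intro DERIV_add DERIV_diff DERIV_cmult smooth_line_derivative2 f g quadratic_line_derivative)
  show "0 \<le> h \<bullet> (hessian g x *v h) - h \<bullet> (hessian f x *v h) + 1 / 2 * (2 * (h \<bullet> (A *v h)))" for x h
  proof -
    have "0 \<le> h \<bullet> ((A - (hessian f x - hessian g x)) *v h)"
      using le[of x] by (simp add: loewner_le_def pos_semidef_def)
    then show ?thesis by (simp add: matrix_vector_mult_diff_rdistrib inner_diff_right)
  qed
qed

text \<open>Inside the ball of radius \<open>\<delta>\<close>, where the Hessian of \<open>U\<close> may fall short by \<open>b\<close>, the factor \<open>4 * D * b\<close> is just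
what the second derivative \<open>1 / (4 * D)\<close> of the square root needs to make up for it.\<close>

lemma convex_on_hessian_indicator:
  fixes U :: "real^'d \<Rightarrow> real"
  assumes U: "smooth U" and D: "D > 0" "\<delta> \<le> D" and b: "b \<ge> 0"
    and outside: "\<And>x h. norm x \<ge> \<delta> \<Longrightarrow> h \<bullet> (A *v h) + c * (norm h)\<^sup>2 \<le> h \<bullet> (hessian U x *v h)"
    and inside: "\<And>x h. norm x < \<delta> \<Longrightarrow> h \<bullet> (A *v h) + c * (norm h)\<^sup>2 \<le> h \<bullet> (hessian U x *v h) + b * (norm h)\<^sup>2"
  shows "convex_on UNIV (\<lambda>x. U x + 4 * D * b * sqrt (D\<^sup>2 + x \<bullet> x) - 1 / 2 * (x \<bullet> (A *v x)) - c / 2 * (norm x)\<^sup>2)"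
proof -
  let ?r = "\<lambda>z::real^'d. sqrt (D\<^sup>2 + z \<bullet> z)"
  let ?I = "mat 1 :: real^'d^'d"
  have "convex_on UNIV (\<lambda>x. U x + 4 * D * b * ?r x - 1 / 2 * (x \<bullet> (A *v x)) - c / 2 * (x \<bullet> (?I *v x)))"
  proof (rule convex_on_if_line_derivative2_nonneg)
    show "((\<lambda>s. U (x + s *\<^sub>R h) + 4 * D * b * ?r (x + s *\<^sub>R h)
          - 1 / 2 * ((x + s *\<^sub>R h) \<bullet> (A *v (x + s *\<^sub>R h)))
          - c / 2 * ((x + s *\<^sub>R h) \<bullet> (?I *v (x + s *\<^sub>R h))))
        has_real_derivative grad U (x + s *\<^sub>R h) \<bullet> h + 4 * D * b * ((x + s *\<^sub>R h) \<bullet> h / ?r (x + s *\<^sub>R h))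
          - 1 / 2 * ((x + s *\<^sub>R h) \<bullet> (A *v h) + h \<bullet> (A *v (x + s *\<^sub>R h)))
          - c / 2 * ((x + s *\<^sub>R h) \<bullet> (?I *v h) + h \<bullet> (?I *v (x + s *\<^sub>R h)))) (at s)" for x h s
      by (intro DERIV_add DERIV_diff DERIV_cmult smooth_line_derivative U quadratic_line_derivative
          sqrt_line_derivative D)
    show "((\<lambda>s. grad U (x + s *\<^sub>R h) \<bullet> h + 4 * D * b * ((x + s *\<^sub>R h) \<bullet> h / ?r (x + s *\<^sub>R h))
          - 1 / 2 * ((x + s *\<^sub>R h) \<bullet> (A *v h) + h \<bullet> (A *v (x + s *\<^sub>R h)))
          - c / 2 * ((x + s *\<^sub>R h) \<bullet> (?I *v h) + h \<bullet> (?I *v (x + s *\<^sub>R h))))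
        has_real_derivative h \<bullet> (hessian U (x + s *\<^sub>R h) *v h)
          + 4 * D * b * ((h \<bullet> h - ((x + s *\<^sub>R h) \<bullet> h / ?r (x + s *\<^sub>R h))\<^sup>2) / ?r (x + s *\<^sub>R h))
          - 1 / 2 * (2 * (h \<bullet> (A *v h))) - c / 2 * (2 * (h \<bullet> (?I *v h)))) (at s)" for x h s
      by (intro DERIV_add DERIV_diff DERIV_cmult smooth_line_derivative2 U quadratic_line_derivative
          sqrt_line_derivative D)
    fix x h :: "real^'d"
    let ?S = "(h \<bullet> h - (x \<bullet> h / ?r x)\<^sup>2) / ?r x"
    have "0 \<le> h \<bullet> (hessian U x *v h) + 4 * D * b * ?S - h \<bullet> (A *v h) - c * (norm h)\<^sup>2"
    proof (cases "norm x < \<delta>")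
      case True
      then have "(norm h)\<^sup>2 / (4 * D) \<le> ?S" using D by (intro sqrt_second_derivative_ge) auto
      then have "4 * D * b * ((norm h)\<^sup>2 / (4 * D)) \<le> 4 * D * b * ?S"
        using D b by (intro mult_left_mono) auto
      moreover have "4 * D * b * ((norm h)\<^sup>2 / (4 * D)) = b * (norm h)\<^sup>2" using D by simp
      ultimately show ?thesis using inside[OF True, of h] by linarith
    next
      case False
      have "0 \<le> 4 * D * b * ?S"
        using D b by (intro mult_nonneg_nonneg sqrt_second_derivative_ge) auto
      then show ?thesis using outside[of x h] False by linarith
    qed
    then show "0 \<le> h \<bullet> (hessian U x *v h) + 4 * D * b * ?S
        - 1 / 2 * (2 * (h \<bullet> (A *v h))) - c / 2 * (2 * (h \<bullet> (?I *v h)))"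
      by (simp add: power2_norm_eq_inner)
  qed
  then show ?thesis by (simp add: power2_norm_eq_inner)
qed

lemma smooth_difference_lipschitz:
  fixes f g :: "real^'d \<Rightarrow> real"
  assumes f: "smooth f" and g: "smooth g" and le: "\<And>x. norm (grad f x - grad g x) \<le> L"
  shows "\<bar>(f x - g x) - (f m - g m)\<bar> \<le> L * norm (x - m)"
proof -
  let ?h = "x - m"
  have "\<exists>z::real. 0 < z \<and> z < 1 \<and> (f (m + 1 *\<^sub>R ?h) - g (m + 1 *\<^sub>R ?h)) - (f (m + 0 *\<^sub>R ?h) - g (m + 0 *\<^sub>R ?h))
      = (1 - 0) * (grad f (m + z *\<^sub>R ?h) \<bullet> ?h - grad g (m + z *\<^sub>R ?h) \<bullet> ?h)"
    by (rule MVT2) (auto intro!: DERIV_diff smooth_line_derivative f g)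
  then obtain z :: real where "(f x - g x) - (f m - g m) = (grad f (m + z *\<^sub>R ?h) - grad g (m + z *\<^sub>R ?h)) \<bullet> ?h"
    by (auto simp: inner_diff_left)
  then have "\<bar>(f x - g x) - (f m - g m)\<bar> \<le> norm (grad f (m + z *\<^sub>R ?h) - grad g (m + z *\<^sub>R ?h)) * norm ?h"
    by (simp add: Cauchy_Schwarz_ineq2)
  also have "\<dots> \<le> L * norm ?h" by (intro mult_right_mono le) auto
  finally show ?thesis .
qed

context sinkhorn_potentials
begin

text \<open>Each Sinkhorn step only adds functions of a single variable to the potential of the joint law, which
starts from \<open>W\<close>.\<close>

lemma separable_potentials:
  assumes W: "continuous_on UNIV (\<lambda>z. W (fst z) (snd z))" and K0: "K 0 = gibbs_kernel W"
  shows "\<exists>\<alpha> \<gamma>. \<forall>x y. (if even n then w n x y else w n y x) = W x y + \<alpha> x + \<gamma> y"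
proof (induction n)
  case 0
  have "w 0 x y = W x y" for x y
  proof (rule gibbs_inject)
    show "gibbs (w 0 x) = gibbs (W x)"
      using K0 K_eq[of 0] by (simp add: gibbs_kernel_def fun_eq_iff)
    show "continuous_on UNIV (w 0 x)" "continuous_on UNIV (W x)"
      using continuous_on_section[OF continuous_w[of 0], of UNIV "\<lambda>_. x" "\<lambda>y. y"]
        continuous_on_section[OF W, of UNIV "\<lambda>_. x" "\<lambda>y. y"] by auto
  qed
  then show ?case by (intro exI[of _ "\<lambda>_. 0"]) simp
next
  case (Suc n)
  then obtain \<alpha> \<gamma> where ag: "\<And>x y. (if even n then w n x y else w n y x) = W x y + \<alpha> x + \<gamma> y"
    by blast
  show ?case
  proof (cases "even n")
    case True
    then have "w (Suc n) y x = W x y + (\<alpha> x + U x) + (\<gamma> y - a n y)" for x y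
      using ag[of x y] potentials[of n x y] by simp
    then show ?thesis using True
      by (intro exI[of _ "\<lambda>x. \<alpha> x + U x"] exI[of _ "\<lambda>y. \<gamma> y - a n y"]) simp
  next
    case False
    then have "w (Suc n) x y = W x y + (\<alpha> x - a n x) + (\<gamma> y + V y)" for x y
      using ag[of x y] potentials[of n y x] by simp
    then show ?thesis using False
      by (intro exI[of _ "\<lambda>x. \<alpha> x - a n x"] exI[of _ "\<lambda>y. \<gamma> y + V y"]) simp
  qed
qed

text \<open>By separability, \<open>w n x y\<close> equals \<open>w (Suc n) y0 x - U x + (W x y - W x y0)\<close> up to a function of \<open>y\<close>.
Since \<open>exp (- w n x y)\<close> integrates to \<open>1\<close> in \<open>y\<close>, the function \<open>w (Suc n) y0 x - U x\<close> is the logarithm of the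
integral of \<open>exp (W x y0 - W x y + c y)\<close> for some \<open>c\<close>, and the exponents become convex in \<open>x\<close> after
adding \<open>q\<close>.\<close>

lemma potential_convex:
  assumes W: "continuous_on UNIV (\<lambda>z. W (fst z) (snd z))" and K0: "K 0 = gibbs_kernel W"
    and conv: "\<And>y. convex_on UNIV (\<lambda>x. W x y0 - W x y + q x)" and n: "even n"
  shows "convex_on UNIV (\<lambda>x. w (Suc n) y0 x - U x + q x)"
proof -
  obtain \<alpha> \<gamma> where ag: "\<And>x y. w (Suc n) y x = W x y + \<alpha> x + \<gamma> y"
    using separable_potentials[OF W K0, of "Suc n"] n by auto
  define F where "F x = w (Suc n) y0 x - U x + q x" for x
  define c where "c y = \<gamma> y0 - a n y - \<gamma> y" for y
  have e: "(W x y0 - W x y + q x) - F x + c y = - w n x y" for x y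
    using potentials[of n x y] n by (simp add: F_def c_def ag)
  have wm[measurable]: "w n x \<in> borel_measurable borel" for x
    using continuous_on_section[OF continuous_w[of n], of UNIV "\<lambda>_. x" "\<lambda>y. y"]
    by (auto intro!: borel_measurable_continuous_onI)
  have "convex_on UNIV F"
  proof (rule convex_on_log_partition[where g="\<lambda>y x. W x y0 - W x y + q x" and c=c and M=lborel])
    fix x
    have "(\<lambda>y. (W x y0 - W x y + q x) + c y) = (\<lambda>y. F x - w n x y)"
      using e[of x] by (auto simp: fun_eq_iff algebra_simps)
    then show "(\<lambda>y. (W x y0 - W x y + q x) + c y) \<in> borel_measurable lborel" by simp
    have "prob_space (gibbs (w n x))" using kernel_prob_space[OF kernel[of n], of x] by (simp add: K_eq)
    then have "1 = (\<integral>\<^sup>+y. ennreal (exp (- w n x y)) \<partial>lborel)"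
      using prob_space.emeasure_space_1[of "gibbs (w n x)"]
        emeasure_density_space[of "\<lambda>y. ennreal (exp (- w n x y))" lborel]
      by (simp add: gibbs_def)
    then show "(\<integral>\<^sup>+y. ennreal (exp ((W x y0 - W x y + q x) - F x + c y)) \<partial>lborel) = 1"
      unfolding e by simp
  qed (rule conv)
  then show ?thesis by (simp add: F_def[abs_def])
qed

text \<open>The two convexity assumptions add up to convexity of the potential of \<open>K (Suc n) y2\<close> modulo a Lipschitz
and a quadratic term; the potentials for \<open>y1\<close> and \<open>y2\<close> differ by a Lipschitz function and a constant.\<close>

lemma kernel_entropy_le:
  assumes W: "continuous_on UNIV (\<lambda>z. W (fst z) (snd z))" and K0: "K 0 = gibbs_kernel W"
    and convW: "\<And>y y'. convex_on UNIV (\<lambda>x. W x y - W x y' + q x)"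
    and convU: "convex_on UNIV (\<lambda>x. U x + \<beta> x - q x - l / 2 * (norm x)\<^sup>2)"
    and l: "l > 0" and k: "k \<ge> 0" and lip\<beta>: "\<And>x y. \<bar>\<beta> x - \<beta> y\<bar> \<le> k * norm (x - y)"
    and \<kappa>: "\<kappa> \<ge> 0"
    and lipW: "\<And>x m y y'. \<bar>(W x y - W x y') - (W m y - W m y')\<bar> \<le> \<kappa> * norm (y - y') * norm (x - m)"
    and n: "even n"
  shows "rel_entropy (K (Suc n) y1) (K (Suc n) y2) \<le> ennreal ((\<kappa> * norm (y1 - y2))\<^sup>2 *
    ((2 + 8 * (2 ^ CARD('d) * exp (2 * k\<^sup>2 / l + 1) - 1)) / (l / 8)))"
proof -
  have c: "continuous_on UNIV (w (Suc n) y)" for y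
    using continuous_on_section[OF continuous_w[of "Suc n"], of UNIV "\<lambda>_. y" "\<lambda>y. y"] by simp
  have p: "prob_space (gibbs (w (Suc n) y))" for y
    using kernel_prob_space[OF kernel[of "Suc n"], of y] by (simp add: K_eq)
  have "convex_on UNIV (\<lambda>x. (w (Suc n) y2 x - U x + q x) + (U x + \<beta> x - q x - l / 2 * (norm x)\<^sup>2))"
    by (intro convex_on_add potential_convex[OF W K0 _ n] convW convU)
  then have "convex_on UNIV (\<lambda>x. w (Suc n) y2 x + \<beta> x - l / 2 * (norm x)\<^sup>2)"
    by (simp add: algebra_simps)
  from exp_moment_strongly_convex_mod_lipschitz[OF c p l k lip\<beta> this]
  obtain m where m: "(\<integral>\<^sup>+x. ennreal (exp (l / 8 * (norm (x - m))\<^sup>2)) \<partial>gibbs (w (Suc n) y2))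
      \<le> ennreal (2 ^ CARD('d) * exp (2 * k\<^sup>2 / l + 1))" by blast
  obtain \<alpha> \<gamma> where ag: "\<And>x y. w (Suc n) y x = W x y + \<alpha> x + \<gamma> y"
    using separable_potentials[OF W K0, of "Suc n"] n by auto
  have "\<bar>(w (Suc n) y2 x - w (Suc n) y1 x) - (w (Suc n) y2 m - w (Suc n) y1 m)\<bar>
      \<le> \<kappa> * norm (y1 - y2) * norm (x - m)" for x
    using lipW[of x y2 y1 m] by (simp add: ag norm_minus_commute)
  then show ?thesis
    unfolding K_eq using \<kappa> l
    by (intro rel_entropy_lipschitz_le[OF c c p p _ _ _ m]) auto
qed

end

text \<open>Inversion reverses the Loewner order strictly, so \<open>u_plus\<^sup>-\<^sup>1\<close> exceeds \<open>u_hat\<^sup>-\<^sup>1\<close> by a positive multiple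
\<open>c\<close> of the identity; \<open>b\<close> bounds the deficit of convexity inside the ball.\<close>

lemma loewner_constants:
  fixes u_plus u_hat u_bar :: "real^'d^'d"
  assumes A: "pos_def u_plus" and less: "loewner_less u_plus u_hat"
  obtains c b where "c > 0" "b \<ge> 0"
    "\<And>x. x \<bullet> (matrix_inv u_hat *v x) + c * (norm x)\<^sup>2 \<le> x \<bullet> (matrix_inv u_plus *v x)"
    "\<And>x. x \<bullet> (matrix_inv u_hat *v x) + c * (norm x)\<^sup>2 \<le> - (x \<bullet> (u_bar *v x)) + b * (norm x)\<^sup>2"
proof -
  have B: "pos_def u_hat"
  proof -
    have "transpose u_hat = transpose (u_hat - u_plus) + transpose u_plus"
      by (simp add: transpose_def vec_eq_iff)
    then have "transpose u_hat = u_hat"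
      using A less by (simp add: pos_def_def loewner_less_def)
    moreover have "0 < x \<bullet> (u_hat *v x)" if "x \<noteq> 0" for x
    proof -
      have "0 < x \<bullet> ((u_hat - u_plus) *v x)" "0 < x \<bullet> (u_plus *v x)"
        using A less that by (auto simp: pos_def_def loewner_less_def)
      then show ?thesis by (simp add: matrix_vector_mult_diff_rdistrib inner_diff_right)
    qed
    ultimately show ?thesis by (simp add: pos_def_def)
  qed
  have "0 < x \<bullet> ((matrix_inv u_plus - matrix_inv u_hat) *v x)" if "x \<noteq> 0" for x
    using matrix_inv_strict_antimono[OF A B less that]
    by (simp add: matrix_vector_mult_diff_rdistrib inner_diff_right)
  then obtain c where c: "c > 0"
      "\<And>x. c * (norm x)\<^sup>2 \<le> x \<bullet> ((matrix_inv u_plus - matrix_inv u_hat) *v x)"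
    using positive_quadratic_form_ge by blast
  define b where "b = onorm ((*v) (matrix_inv u_hat)) + onorm ((*v) u_bar) + c"
  show ?thesis
  proof
    show "c > 0" by fact
    show "b \<ge> 0" unfolding b_def using c
      by (intro add_nonneg_nonneg onorm_pos_le matrix_vector_mul_bounded_linear) auto
    show "x \<bullet> (matrix_inv u_hat *v x) + c * (norm x)\<^sup>2 \<le> x \<bullet> (matrix_inv u_plus *v x)" for x
      using c(2)[of x] by (simp add: matrix_vector_mult_diff_rdistrib inner_diff_right)
    show "x \<bullet> (matrix_inv u_hat *v x) + c * (norm x)\<^sup>2 \<le> - (x \<bullet> (u_bar *v x)) + b * (norm x)\<^sup>2" for x
      using quadratic_form_le[of x "matrix_inv u_hat"] quadratic_form_le[of x u_bar]
      unfolding b_def by (simp add: algebra_simps)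
  qed
qed

text \<open>The constants \<open>c\<close>, \<open>b\<close> and \<open>D\<close>, and with them the convexity modulus and the Lipschitz correction \<open>k\<close>, are
fixed before the potentials are introduced; this is why \<open>\<rho>\<close> depends on the matrices and \<open>\<delta>\<close> only.\<close>

lemma sinkhorn_kernel_entropy_uniform:
  fixes u_plus u_hat u_bar :: "real^'d^'d"
  assumes pd: "pos_def u_plus" and less: "loewner_less u_plus u_hat" and \<delta>: "\<delta> \<ge> 0"
  shows "\<exists>\<rho>>0. \<forall>U V W K B \<kappa> v_hat v_plus n y1 y2.
    sinkhorn_setting U V W K B \<longrightarrow> cond_W W \<kappa> u_hat v_hat \<longrightarrow> cond_CV_minus U V u_plus u_bar \<delta> v_plus \<longrightarrow>
    rel_entropy (K (2 * n + 1) y1) (K (2 * n + 1) y2) \<le> ennreal (\<kappa>\<^sup>2 * \<rho> / 2 * (norm (y1 - y2))\<^sup>2)"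
proof -
  let ?A = "matrix_inv u_hat"
  obtain c b where c: "c > 0" and b: "b \<ge> 0"
    and outside: "\<And>x. x \<bullet> (?A *v x) + c * (norm x)\<^sup>2 \<le> x \<bullet> (matrix_inv u_plus *v x)"
    and inside: "\<And>x. x \<bullet> (?A *v x) + c * (norm x)\<^sup>2 \<le> - (x \<bullet> (u_bar *v x)) + b * (norm x)\<^sup>2"
    using loewner_constants[OF pd less, of u_bar] by metis
  \<comment> \<open>Any radius at least \<open>\<delta>\<close> will do, but it has to be positive even for \<open>\<delta> = 0\<close>.\<close>
  define D where "D = \<delta> + 1"
  have D: "D > 0" "\<delta> \<le> D" using \<delta> by (auto simp: D_def)
  define k where "k = 4 * D * b"
  have k: "k \<ge> 0" using D b by (simp add: k_def)
  define C where "C = 2 ^ CARD('d) * exp (2 * k\<^sup>2 / c + 1)"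
  have C1: "C \<ge> 1"
    unfolding C_def using c by (intro mult_ge1_I) (auto intro: add_nonneg_nonneg)
  define \<rho> where "\<rho> = 2 * ((2 + 8 * (C - 1)) / (c / 8))"
  have \<rho>2: "(2 + 8 * (C - 1)) / (c / 8) = \<rho> / 2"
    unfolding \<rho>_def by (rule nonzero_mult_div_cancel_left[symmetric]) simp
  have \<rho>: "\<rho> > 0" unfolding \<rho>_def using c C1 by (intro mult_pos_pos divide_pos_pos) auto
  have "rel_entropy (K (2 * n + 1) y1) (K (2 * n + 1) y2) \<le> ennreal (\<kappa>\<^sup>2 * \<rho> / 2 * (norm (y1 - y2))\<^sup>2)"
    if set: "sinkhorn_setting U V W K B" and cW: "cond_W W \<kappa> u_hat v_hat"
      and cV: "cond_CV_minus U V u_plus u_bar \<delta> v_plus"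
    for U V W K B \<kappa> v_hat v_plus n y1 y2
  proof -
    obtain w a where "sinkhorn_potentials U V w a K"
      using sinkhorn_potentials_exist[OF set] .
    then interpret sinkhorn_potentials U V w a K .
    have sU: "smooth U" and sW: "smooth (\<lambda>z. W (fst z) (snd z))" and K0: "K 0 = gibbs_kernel W"
      using set by (auto simp: sinkhorn_setting_def sinkhorn_transitions_def)
    have sWy: "smooth (\<lambda>x. W x y)" for y using sW by (rule smooth_section)
    have flat: "flat W y = (\<lambda>x. W x y)" for y by (simp add: flat_def fun_eq_iff)
    have convW: "convex_on UNIV (\<lambda>x. W x y - W x y' + 1 / 2 * (x \<bullet> (?A *v x)))" for y y'
      using cW by (intro convex_on_hessian_difference sWy) (simp add: cond_W_def)
    have hess: "0 \<le> h \<bullet> ((hessian U x - (indicator {x. norm x \<ge> \<delta>} x *\<^sub>R matrix_inv u_plus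
                        - indicator {x. norm x < \<delta>} x *\<^sub>R u_bar)) *v h)" for x h
      using cV by (simp add: cond_CV_minus_def loewner_le_def pos_semidef_def)
    have convU: "convex_on UNIV (\<lambda>x. U x + k * sqrt (D\<^sup>2 + x \<bullet> x) - 1 / 2 * (x \<bullet> (?A *v x)) - c / 2 * (norm x)\<^sup>2)"
      unfolding k_def
    proof (rule convex_on_hessian_indicator[OF sU D b])
      fix x h :: "real^'d"
      show "h \<bullet> (?A *v h) + c * (norm h)\<^sup>2 \<le> h \<bullet> (hessian U x *v h)" if "norm x \<ge> \<delta>"
        using that hess[of h x] outside[of h]
        by (simp add: matrix_vector_mult_diff_rdistrib inner_diff_right)
      show "h \<bullet> (?A *v h) + c * (norm h)\<^sup>2 \<le> h \<bullet> (hessian U x *v h) + b * (norm h)\<^sup>2" if "norm x < \<delta>"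
        using that hess[of h x] inside[of h]
        by (simp add: matrix_vector_mult_add_rdistrib inner_add_right)
    qed
    have lip: "\<bar>k * sqrt (D\<^sup>2 + x \<bullet> x) - k * sqrt (D\<^sup>2 + y \<bullet> y)\<bar> \<le> k * norm (x - y)" for x y :: "real^'d"
    proof -
      have "\<bar>k * sqrt (D\<^sup>2 + x \<bullet> x) - k * sqrt (D\<^sup>2 + y \<bullet> y)\<bar> = k * \<bar>sqrt (D\<^sup>2 + x \<bullet> x) - sqrt (D\<^sup>2 + y \<bullet> y)\<bar>"
        using k by (simp add: right_diff_distrib[symmetric] abs_mult)
      also have "\<dots> \<le> k * norm (x - y)" using k by (intro mult_left_mono sqrt_lipschitz)
      finally show ?thesis .
    qed
    have lipW: "\<bar>(W x y - W x y') - (W m y - W m y')\<bar> \<le> \<kappa> * norm (y - y') * norm (x - m)" for x m y y'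
      using cW by (intro smooth_difference_lipschitz[OF sWy sWy]) (simp add: cond_W_def flat)
    have "\<kappa> \<ge> 0" using cW by (simp add: cond_W_def)
    from kernel_entropy_le[OF smooth_continuous[OF sW] K0 convW convU c k lip this lipW, of "2 * n" y1 y2, OF even_mult_iff[THEN iffD2, OF disjI1, OF even_numeral]]
    have "rel_entropy (K (Suc (2 * n)) y1) (K (Suc (2 * n)) y2) \<le> ennreal ((\<kappa> * norm (y1 - y2))\<^sup>2 * (\<rho> / 2))"
      by (simp only: C_def[symmetric] \<rho>2)
    also have "(\<kappa> * norm (y1 - y2))\<^sup>2 * (\<rho> / 2) = \<kappa>\<^sup>2 * \<rho> / 2 * (norm (y1 - y2))\<^sup>2"
      by (simp add: power_mult_distrib)
    finally show ?thesis by simp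
  qed
  with \<rho> show ?thesis by blast
qed

lemma cond_A0_entropy_le:
  assumes "cond_A0 K \<kappa> \<rho>"
  shows "rel_entropy (K y1) (K y2) \<le> ennreal (\<kappa>\<^sup>2 * \<rho> / 2 * (norm (y1 - y2))\<^sup>2)"
proof -
  have \<rho>: "\<rho> > 0" using assms by (simp add: cond_A0_def)
  have "rel_entropy (K y1) (K y2) \<le> ennreal (\<rho> / 2) * fisher_info (K y1) (K y2)"
    using assms by (simp add: cond_A0_def)
  also have "\<dots> \<le> ennreal (\<rho> / 2) * ennreal (\<kappa>\<^sup>2 * (norm (y1 - y2))\<^sup>2)"
    using assms by (intro mult_left_mono) (auto simp: cond_A0_def)
  also have "\<dots> = ennreal (\<rho> / 2 * (\<kappa>\<^sup>2 * (norm (y1 - y2))\<^sup>2))"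
    using \<rho> by (intro ennreal_mult'[symmetric]) auto
  also have "\<rho> / 2 * (\<kappa>\<^sup>2 * (norm (y1 - y2))\<^sup>2) = \<kappa>\<^sup>2 * \<rho> / 2 * (norm (y1 - y2))\<^sup>2" by simp
  finally show ?thesis .
qed

theorem theorem6p8:
  shows
  "(\<forall>(U :: real^'d \<Rightarrow> real) V W K B (\<kappa> :: nat \<Rightarrow> real) (\<rho> :: nat \<Rightarrow> real) (v_plus :: real^'d^'d)
       (\<epsilon> :: nat \<Rightarrow> real).
      sinkhorn_setting U V W K B \<longrightarrow>
      (\<forall>n\<ge>1. cond_A0 (K (2 * n - 1)) (\<kappa> (2 * n - 1)) (\<rho> (2 * n - 1))) \<longrightarrow>
      pos_def v_plus \<longrightarrow>
      T2 (gibbs V) (spectral_norm v_plus) \<longrightarrow>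
      (\<forall>n. \<epsilon> (2 * n + 1) = (\<kappa> (2 * n + 1))\<^sup>2 * \<rho> (2 * n + 1) * spectral_norm v_plus) \<longrightarrow>
      (\<forall>n\<ge>1. rel_entropy B (sinkhorn_joint (gibbs U) (gibbs V) K (2 * n + 1))
         \<le> ennreal (inverse (1 + inverse (\<epsilon> (2 * n + 1)))) *
            rel_entropy B (sinkhorn_joint (gibbs U) (gibbs V) K (2 * n - 1)))) \<and>
   (\<forall>(u_plus :: real^'d^'d) (u_hat :: real^'d^'d) (u_bar :: real^'d^'d) (\<delta> :: real).
      pos_def u_plus \<and> loewner_less u_plus u_hat \<and> pos_semidef u_bar \<and> \<delta> \<ge> 0 \<longrightarrow>
      (\<exists>\<rho>u > 0.
         \<forall>(U :: real^'d \<Rightarrow> real) V W K B (\<kappa> :: real) (v_hat :: real^'d^'d) (v_plus :: real^'d^'d)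
           (\<epsilon> :: real).
           sinkhorn_setting U V W K B \<longrightarrow>
           cond_W W \<kappa> u_hat v_hat \<longrightarrow>
           pos_def v_plus \<longrightarrow>
           cond_CV_minus U V u_plus u_bar \<delta> v_plus \<longrightarrow>
           \<epsilon> = \<kappa>\<^sup>2 * \<rho>u * spectral_norm v_plus \<longrightarrow>
           (\<forall>n\<ge>1. rel_entropy B (sinkhorn_joint (gibbs U) (gibbs V) K (2 * n + 1))
              \<le> ennreal (inverse (1 + inverse \<epsilon>)) *
                 rel_entropy B (sinkhorn_joint (gibbs U) (gibbs V) K (2 * n - 1)))))"
proof (intro conjI allI impI, goal_cases)
  case (1 U V W K B \<kappa> \<rho> v_plus \<epsilon> n)
  have A0: "cond_A0 (K (2 * n + 1)) (\<kappa> (2 * n + 1)) (\<rho> (2 * n + 1))"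
    using 1(2)[rule_format, of "Suc n"] by simp
  have e: "\<epsilon> (2 * n + 1) = (\<kappa> (2 * n + 1))\<^sup>2 * \<rho> (2 * n + 1) * spectral_norm v_plus"
    using 1(5) by blast
  have "(\<kappa> (2 * n + 1))\<^sup>2 * \<rho> (2 * n + 1) > 0" using A0 by (simp add: cond_A0_def)
  then show ?case
    unfolding e by (intro sinkhorn_setting_contraction[OF 1(1)] 1(3,4,6) cond_A0_entropy_le A0)
next
  case (2 u_plus u_hat u_bar \<delta>)
  then obtain \<rho>u where \<rho>u: "\<rho>u > 0" and le: "\<And>(U :: real^'d \<Rightarrow> real) V W K B \<kappa> v_hat v_plus n y1 y2.
      sinkhorn_setting U V W K B \<Longrightarrow> cond_W W \<kappa> u_hat v_hat \<Longrightarrow> cond_CV_minus U V u_plus u_bar \<delta> v_plus \<Longrightarrow>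
      rel_entropy (K (2 * n + 1) y1) (K (2 * n + 1) y2) \<le> ennreal (\<kappa>\<^sup>2 * \<rho>u / 2 * (norm (y1 - y2))\<^sup>2)"
    using sinkhorn_kernel_entropy_uniform[of u_plus u_hat \<delta> u_bar] by blast
  show ?case
  proof (intro exI[of _ \<rho>u] conjI allI impI \<rho>u, goal_cases)
    case (1 U V W K B \<kappa> v_hat v_plus \<epsilon> n)
    have "\<kappa>\<^sup>2 * \<rho>u > 0" using 1(2) \<rho>u by (simp add: cond_W_def)
    moreover have "T2 (gibbs V) (spectral_norm v_plus)" using 1(4) by (simp add: cond_CV_minus_def)
    ultimately show ?case
      unfolding 1(5) by (intro sinkhorn_setting_contraction[OF 1(1)] 1(3,6) le[OF 1(1,2,4)])
  qed
qed

end
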